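(* Let $\hat W_n := \arg\min_W U_n(W)$ with $$U_n(W):=\log\det\left(\frac1n\sum_{t=1}^n (Y_t-F_W(Z_t))(Y_t-F_W(Z_t))^T\right),$$ and let $W_n^*$ be the generalized least squares estimator computed with the true noise covariance matrix $\Gamma_0$, $$W_n^*:=\arg\min_W\frac1n\sum_{t=1}^n (Y_t-F_W(Z_t))^T\Gamma_0^{-1}(Y_t-F_W(Z_t)).$$ Then, in the setting given in the context, $$\lim_{n\to\infty}\sqrt n\,(W_n^*-W^0)=\lim_{n\to\infty}\sqrt n\,(\hat W_n-W^0)=\mathcal N(0,I_0^{-1}),$$ the limits being limits in law; that is, both estimators have the same Gaussian limit law $\mathcal N(0,I_0^{-1})$. Here $I_0$ is the matrix whose $(k,l)$ component is $$(I_0)_{kl}=\mathrm{tr}\left(\Gamma_0^{-1}\,E\left[\frac{\partial F_{W^0}(Z)}{\partial W_k}\,\frac{\partial F_{W^0}(Z)}{\partial W_l}^T\right]\right).$$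
   Context: Model. $(Y_t,Z_t)_{t\in\mathbb N}$ is a sequence of i.i.d. random vectors, each pair having the same law as a generic pair $(Y,Z)$, with $Y_t\in\mathbb R^d$, and $Y_t=F_{W^0}(Z_t)+\varepsilon_t$, where $F_{W^0}$ is a function represented by a multilayer perceptron (MLP) with parameters (weights) $W^0$, and $(\varepsilon_t)$ is an i.i.d. centered noise with unknown invertible covariance matrix $\Gamma_0$. $F_W$ denotes the $\mathbb R^d$-valued function represented by the MLP with weight vector $W$. Notation. $T$ is transposition, $\Vert\cdot\Vert$ the Euclidean norm. $\frac{\partial F_W(Z)}{\partial W_k}$ and $\frac{\partial^2 F_W(Z)}{\partial W_k\partial W_l}$ denote the $d$-dimensional vectors of first (respectively second order) partial derivatives of the components of $F_W(Z)$. Assumptions. The true architecture of the MLP is assumed known, so that the Hessian matrix (the limit $2I_0$ of the Hessian of $U_n$ at $W^0$) satisfies the assumption of being positive definite. The noise has a moment of order at least 2; it is asserted that $\hat W_n$ is then strongly consistent, i.e. $\hat W_n\to W^0$ almost surely. $Z$ has a moment of order at least 3. It is also asserted that for an MLP function there exists a constant $C$ such that $\left\Vert \frac{\partial F_W(Z)}{\partial W_k}\right\Vert\le C(1+\Vert Z\Vert)$, $\left\Vert \frac{\partial^2 F_W(Z)}{\partial W_k\partial W_l}\right\Vert\le C(1+\Vert Z\Vert^2)$ and $\left\Vert \frac{\partial^2 F_W(Z)}{\partial W_k\partial W_l}-\frac{\partial^2 F_{W^0}(Z)}{\partial W_k\partial W_l}\right\Vert\le C\Vert W-W^0\Vert(1+\Vert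 Z\Vert^3)$.
   Formalization: Strong consistency of W_n^* is assumed as well as that of Ŵ_n (otherwise weight symmetries of the MLP let the arg min W_n^* lie near another copy of W^0), and the noise is taken to be independent of Z. *)

theory Defs
  imports "HOL-Probability.Probability"
begin

text \<open>
  Multilayer perceptrons. The list \<open>ns\<close> contains the widths of all layers, input and output
  included. The weight \<open>w (l, i, j)\<close> goes from unit \<open>j\<close> of layer \<open>l\<close> to unit \<open>i\<close> of layer
  \<open>Suc l\<close>; the additional position \<open>j = ns ! l\<close> holds the bias of that unit. Activation functions
  may vary from layer to layer, so linear output units are the case where the last one is the
  identity.
\<close>

definition mlp_slots :: "nat list \<Rightarrow> (nat \<times> nat \<times> nat) set" where
  "mlp_slots ns = {(l, i, j). Suc l < length ns \<and> i < ns ! Suc l \<and> j \<le> ns ! l}"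

primrec mlp_layer ::
  "(nat \<Rightarrow> real \<Rightarrow> real) \<Rightarrow> nat list \<Rightarrow> (nat \<times> nat \<times> nat \<Rightarrow> real) \<Rightarrow> (nat \<Rightarrow> real) \<Rightarrow> nat \<Rightarrow> nat \<Rightarrow> real"
where
  "mlp_layer \<phi> ns w x 0 = x"
| "mlp_layer \<phi> ns w x (Suc l) =
     (\<lambda>i. \<phi> l (w (l, i, ns ! l) + (\<Sum>j<ns ! l. w (l, i, j) * mlp_layer \<phi> ns w x l j)))"

definition mlp_widths :: "nat list \<Rightarrow> 'q::finite itself \<Rightarrow> 'd::finite itself \<Rightarrow> nat list" where
  "mlp_widths hs q d = CARD('q) # hs @ [CARD('d)]"

text \<open>
  The function \<open>F\<^sub>W\<close>, where \<open>hs\<close> lists the widths of the hidden layers and \<open>idx\<close> names the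
  coordinate of the weight vector \<open>W\<close> that is used at each position of the network. It is meant to
  be a bijection from the positions \<open>mlp_slots (mlp_widths hs _ _)\<close> onto the index type of \<open>W\<close>.
\<close>

definition mlp ::
  "(nat \<Rightarrow> real \<Rightarrow> real) \<Rightarrow> nat list \<Rightarrow> (nat \<times> nat \<times> nat \<Rightarrow> 'k::finite)
     \<Rightarrow> real^'k \<Rightarrow> real^'q::finite \<Rightarrow> real^'d::finite"
where
  "mlp \<phi> hs idx W z =
     (\<chi> i. mlp_layer \<phi> (mlp_widths hs TYPE('q) TYPE('d)) (\<lambda>s. W $ idx s)
              (\<lambda>j. z $ from_nat_into UNIV j) (Suc (length hs)) (to_nat_on UNIV i))"

definition partial_deriv :: "'k::finite \<Rightarrow> (real^'k \<Rightarrow> real^'d::finite) \<Rightarrow> real^'k \<Rightarrow> real^'d" where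
  "partial_deriv k f W = vector_derivative (\<lambda>t. f (W + t *\<^sub>R axis k 1)) (at 0)"

definition outer :: "real^'m::finite \<Rightarrow> real^'n::finite \<Rightarrow> real^'n^'m" where
  "outer u v = (\<chi> i j. u $ i * v $ j)"

definition pos_def :: "real^'n::finite^'n \<Rightarrow> bool" where
  "pos_def A \<longleftrightarrow> transpose A = A \<and> (\<forall>v. v \<noteq> 0 \<longrightarrow> v \<bullet> (A *v v) > 0)"

definition covariance_matrix :: "'a measure \<Rightarrow> ('a \<Rightarrow> real^'d::finite) \<Rightarrow> real^'d^'d" where
  "covariance_matrix M X =
     (let m = (\<integral>\<omega>. X \<omega> \<partial>M) in \<integral>\<omega>. outer (X \<omega> - m) (X \<omega> - m) \<partial>M)"

text \<open>
  The empirical covariance matrix can be singular (always so if \<open>n < d\<close>). Since \<open>ln 0 = 0\<close> for real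
  numbers, the logarithm below takes the value \<open>-\<infinity>\<close> there, as it should in a minimization.
\<close>

definition ereal_ln :: "real \<Rightarrow> ereal" where
  "ereal_ln x = (if x \<le> 0 then -\<infinity> else ereal (ln x))"

definition logdet_contrast ::
  "('w \<Rightarrow> real^'q::finite \<Rightarrow> real^'d::finite) \<Rightarrow> (nat \<Rightarrow> real^'d) \<Rightarrow> (nat \<Rightarrow> real^'q)
     \<Rightarrow> nat \<Rightarrow> 'w \<Rightarrow> ereal"
where
  "logdet_contrast F y z n W =
     ereal_ln (det ((1 / real n) *\<^sub>R (\<Sum>t=1..n. outer (y t - F W (z t)) (y t - F W (z t)))))"

definition gls_contrast ::
  "real^'d::finite^'d \<Rightarrow> ('w \<Rightarrow> real^'q::finite \<Rightarrow> real^'d) \<Rightarrow> (nat \<Rightarrow> real^'d) \<Rightarrow> (nat \<Rightarrow> real^'q)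
     \<Rightarrow> nat \<Rightarrow> 'w \<Rightarrow> real"
where
  "gls_contrast \<Gamma> F y z n W =
     (1 / real n) * (\<Sum>t=1..n. (y t - F W (z t)) \<bullet> (matrix_inv \<Gamma> *v (y t - F W (z t))))"

definition info_matrix ::
  "'a measure \<Rightarrow> real^'d::finite^'d \<Rightarrow> (real^'k::finite \<Rightarrow> real^'q::finite \<Rightarrow> real^'d)
     \<Rightarrow> real^'k \<Rightarrow> ('a \<Rightarrow> real^'q) \<Rightarrow> real^'k^'k"
where
  "info_matrix M \<Gamma> F W Z =
     (\<chi> k l. trace (matrix_inv \<Gamma> **
        (\<integral>\<omega>. outer (partial_deriv k (\<lambda>V. F V (Z \<omega>)) W) (partial_deriv l (\<lambda>V. F V (Z \<omega>)) W) \<partial>M)))"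

text \<open>The Gaussian law with mean \<open>m\<close> and positive definite covariance matrix \<open>\<Sigma>\<close>.\<close>

definition multi_normal :: "real^'n::finite \<Rightarrow> real^'n^'n \<Rightarrow> (real^'n) measure" where
  "multi_normal m \<Sigma> = density lborel (\<lambda>x. ennreal
     (exp (- ((x - m) \<bullet> (matrix_inv \<Sigma> *v (x - m))) / 2) / sqrt ((2 * pi) ^ CARD('n) * det \<Sigma>)))"

definition converges_in_law ::
  "'a measure \<Rightarrow> (nat \<Rightarrow> 'a \<Rightarrow> 'b::euclidean_space) \<Rightarrow> 'b measure \<Rightarrow> bool"
where
  "converges_in_law M X \<mu> \<longleftrightarrow>
     (\<forall>f :: 'b \<Rightarrow> real. continuous_on UNIV f \<longrightarrow> bounded (range f) \<longrightarrow>
        (\<lambda>n. \<integral>\<omega>. f (X n \<omega>) \<partial>M) \<longlonglongrightarrow> (\<integral>x. f x \<partial>\<mu>))"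

end

theory Submission
  imports Defs "HOL-Library.Landau_Symbols"
begin

text \<open>
  For \<open>h \<rightarrow> 0\<close>, the increment of either contrast between \<open>W\<^sub>0\<close> and \<open>W\<^sub>0 + h\<close> is, up to a factor,
  \<open>h \<bullet> I\<^sub>0 h - 2 (h \<bullet> g\<^sub>n) + o(|h|\<^sup>2 + b\<^sub>n\<^sup>2)\<close>, uniformly in probability. Here \<open>g\<^sub>n\<close> is the score
  \<open>n\<^sup>-\<^sup>1 \<Sum>\<^sub>t DF(Z\<^sub>t)\<^sup>T \<Gamma>\<^sub>0\<^sup>-\<^sup>1 \<epsilon>\<^sub>t\<close> and \<open>b\<^sub>n\<close> is the norm of the array of the averages of the products
  \<open>\<epsilon>\<^sub>t\<^sub>,\<^sub>a \<partial>\<^sub>kF\<^sub>b(Z\<^sub>t)\<close>, so that \<open>\<surd>n b\<^sub>n\<close> is bounded in \<open>L\<^sup>2\<close>. Any consistent minimizer therefore satisfies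
  \<open>\<surd>n (W\<^sub>n - W\<^sub>0) = I\<^sub>0\<^sup>-\<^sup>1 \<surd>n g\<^sub>n + o(1)\<close>, and \<open>\<surd>n g\<^sub>n\<close> is asymptotically Gaussian with covariance \<open>I\<^sub>0\<close>.

  Both contrasts are functions of the empirical covariance \<open>\<Gamma>\<^sub>n(W)\<close> of the residuals: the generalized
  least squares contrast is \<open>tr (\<Gamma>\<^sub>0\<^sup>-\<^sup>1 \<Gamma>\<^sub>n(W))\<close>, and minimizing \<open>log det \<Gamma>\<^sub>n(W)\<close> amounts to minimizing
  \<open>det (\<Gamma>\<^sub>0\<^sup>-\<^sup>1 \<Gamma>\<^sub>n(W))\<close>. Since \<open>\<Gamma>\<^sub>0\<^sup>-\<^sup>1 \<Gamma>\<^sub>n(W\<^sub>0)\<close> tends to the identity, the two have the same expansion.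
  Working with increments instead of Hessians needs no differentiation of the contrast, and laws of
  large numbers in probability suffice.
\<close>

section \<open>Convergence in probability as a filter\<close>

text \<open>A comparison with one competitor takes the place of first-order conditions. The
  displacement of the estimator from \<open>W0\<close> and the step
  \<open>matrix_inv I0 *v score_vec p\<close> both tend to 0, so the expansion may be evaluated at
  either one; as the estimator does at least as well, completing the square bounds their distance by
  the expansion errors alone. Sample and displacement go to their limits jointly, in the product of
  \<open>whp M\<close> and \<open>nhds 0\<close>: a Landau term there is uniform in the
  displacement, so a random one may be inserted.

  The moment assumptions shape the expansion. Squared network increments need the weight (1 + |Z|)(1
  + |Z|^2), a cubic. Terms linear in the noise are expanded further, because their second-order part
  averages out by independence and centring; the remainder has weight |e|(1 + |Z|^3), whose mean
  factors.

  The limit law comes from characteristic functions: a compactly supported test function, smoothed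
  by a Gaussian, has an integral that depends on the law only through its characteristic function,
  and such test functions suffice since the limit has total mass 1.\<close>

definition whp :: "'a measure \<Rightarrow> (nat \<times> 'a) filter" where
  "whp M = Abs_filter (\<lambda>P. \<exists>A. (\<forall>n. A n \<in> sets M) \<and> (\<lambda>n. measure M (A n)) \<longlonglongrightarrow> 0 \<and>
      (\<forall>n. \<forall>\<omega>\<in>space M - A n. P (n, \<omega>)))"

text \<open>Only a measurable cover of the failures of \<open>P\<close> is asked for, so
  \<open>P\<close> itself may be any statement about estimators and suprema. Limits of random
  variables along \<open>whp M\<close> are limits in probability, and the general limit and Landau
  calculus of filters becomes available for them.\<close>

lemma (in finite_measure) eventually_whp:
  "eventually P (whp M) \<longleftrightarrow> (\<exists>A. (\<forall>n. A n \<in> sets M) \<and> (\<lambda>n. measure M (A n)) \<longlonglongrightarrow> 0 \<and>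
      (\<forall>n. \<forall>\<omega>\<in>space M - A n. P (n, \<omega>)))"
  unfolding whp_def
proof (rule eventually_Abs_filter, rule is_filter.intro)
  show "\<exists>A. (\<forall>n. A n \<in> sets M) \<and> (\<lambda>n. measure M (A n)) \<longlonglongrightarrow> 0 \<and> (\<forall>n. \<forall>\<omega>\<in>space M - A n. True)"
    by (rule exI[of _ "\<lambda>_. {}"]) simp
next
  fix P Q :: "nat \<times> 'a \<Rightarrow> bool"
  assume "\<exists>A. (\<forall>n. A n \<in> sets M) \<and> (\<lambda>n. measure M (A n)) \<longlonglongrightarrow> 0 \<and> (\<forall>n. \<forall>\<omega>\<in>space M - A n. P (n, \<omega>))"
    and "\<exists>A. (\<forall>n. A n \<in> sets M) \<and> (\<lambda>n. measure M (A n)) \<longlonglongrightarrow> 0 \<and> (\<forall>n. \<forall>\<omega>\<in>space M - A n. Q (n, \<omega>))"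
  then obtain A B where A: "\<And>n. A n \<in> sets M" "(\<lambda>n. measure M (A n)) \<longlonglongrightarrow> 0" "\<And>n \<omega>. \<omega>\<in>space M - A n \<Longrightarrow> P (n, \<omega>)"
    and B: "\<And>n. B n \<in> sets M" "(\<lambda>n. measure M (B n)) \<longlonglongrightarrow> 0" "\<And>n \<omega>. \<omega>\<in>space M - B n \<Longrightarrow> Q (n, \<omega>)"
    by metis
  have "(\<lambda>n. measure M (A n \<union> B n)) \<longlonglongrightarrow> 0"
  proof (rule tendsto_sandwich[OF _ _ tendsto_const])
    show "(\<lambda>n. measure M (A n) + measure M (B n)) \<longlonglongrightarrow> 0"
      using tendsto_add[OF A(2) B(2)] by simp
    show "\<forall>\<^sub>F n in sequentially. measure M (A n \<union> B n) \<le> measure M (A n) + measure M (B n)"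
      using A(1) B(1) by (intro always_eventually allI measure_Un_le)
  qed simp
  then show "\<exists>A. (\<forall>n. A n \<in> sets M) \<and> (\<lambda>n. measure M (A n)) \<longlonglongrightarrow> 0 \<and> (\<forall>n. \<forall>\<omega>\<in>space M - A n. P (n, \<omega>) \<and> Q (n, \<omega>))"
    using A B by (intro exI[of _ "\<lambda>n. A n \<union> B n"]) auto
qed blast

lemma (in finite_measure) eventually_whpI:
  assumes "\<And>n. {\<omega>\<in>space M. \<not> P (n, \<omega>)} \<in> sets M"
    and "(\<lambda>n. measure M {\<omega>\<in>space M. \<not> P (n, \<omega>)}) \<longlonglongrightarrow> 0"
  shows "eventually P (whp M)"
  unfolding eventually_whp
  by (rule exI[of _ "\<lambda>n. {\<omega>\<in>space M. \<not> P (n, \<omega>)}"]) (use assms in auto)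

text \<open>The exceptional set is the whole space for the finitely many \<open>n < n0\<close> and
  one fixed null set from then on.\<close>

lemma (in finite_measure) eventually_whp_AE:
  assumes "AE \<omega> in M. \<forall>n\<ge>n0. P (n, \<omega>)"
  shows "eventually P (whp M)"
proof -
  obtain N where N: "{\<omega> \<in> space M. \<not> (\<forall>n\<ge>n0. P (n, \<omega>))} \<subseteq> N" "emeasure M N = 0" "N \<in> sets M"
    using assms by (rule AE_E)
  have "measure M N = 0" using N by (simp add: measure_def)
  then have "(\<lambda>n. measure M (if n < n0 then space M else N)) \<longlonglongrightarrow> 0"
    by (intro tendsto_eventually eventually_sequentiallyI[of n0]) auto
  then show ?thesis
    unfolding eventually_whp using N
    by (intro exI[of _ "\<lambda>n. if n < n0 then space M else N"]) (auto simp: not_less)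
qed

text \<open>The way back from the filter to probabilities, for failure events that are themselves
  measurable.\<close>

lemma (in finite_measure) measure_not_whp:
  assumes "eventually P (whp M)" and "\<And>n. {\<omega>\<in>space M. \<not> P (n, \<omega>)} \<in> sets M"
  shows "(\<lambda>n. measure M {\<omega>\<in>space M. \<not> P (n, \<omega>)}) \<longlonglongrightarrow> 0"
proof -
  obtain A where A: "\<And>n. A n \<in> sets M" "(\<lambda>n. measure M (A n)) \<longlonglongrightarrow> 0" "\<And>n \<omega>. \<omega>\<in>space M - A n \<Longrightarrow> P (n, \<omega>)"
    using assms(1) unfolding eventually_whp by metis
  show ?thesis
  proof (rule tendsto_sandwich[OF _ _ tendsto_const A(2)])
    show "\<forall>\<^sub>F n in sequentially. measure M {\<omega>\<in>space M. \<not> P (n, \<omega>)} \<le> measure M (A n)"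
      using A by (intro always_eventually allI finite_measure_mono) auto
  qed simp
qed

text \<open>Dominated convergence applied to the indicators of the deviation events.\<close>

lemma (in finite_measure) tendsto_whp_AE:
  fixes X :: "nat \<Rightarrow> 'a \<Rightarrow> 'b::{metric_space,second_countable_topology}"
  assumes [measurable]: "\<And>n. X n \<in> borel_measurable M"
    and conv: "AE \<omega> in M. (\<lambda>n. X n \<omega>) \<longlonglongrightarrow> x"
  shows "((\<lambda>p. X (fst p) (snd p)) \<longlongrightarrow> x) (whp M)"
proof (rule tendstoI)
  fix e :: real assume e: "e > 0"
  have "(\<lambda>n. \<integral>\<omega>. indicator {\<omega>\<in>space M. \<not> dist (X n \<omega>) x < e} \<omega> \<partial>M) \<longlonglongrightarrow> (\<integral>\<omega>. 0 \<partial>M :: real)"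
  proof (rule integral_dominated_convergence[where w = "\<lambda>_. 1"])
    show "AE \<omega> in M. (\<lambda>n. indicator {\<omega>\<in>space M. \<not> dist (X n \<omega>) x < e} \<omega> :: real) \<longlonglongrightarrow> 0"
      using conv
    proof eventually_elim
      case (elim \<omega>)
      have "\<forall>\<^sub>F n in sequentially. dist (X n \<omega>) x < e"
        by (rule tendstoD[OF elim e])
      then show ?case
        by (rule tendsto_eventually[OF eventually_mono]) auto
    qed
  qed auto
  moreover have "{\<omega>\<in>space M. \<not> dist (X n \<omega>) x < e} \<inter> space M = {\<omega>\<in>space M. \<not> dist (X n \<omega>) x < e}" for n
    by auto
  ultimately show "\<forall>\<^sub>F p in whp M. dist (X (fst p) (snd p)) x < e"
    by (intro eventually_whpI) simp_all
qed

lemma (in finite_measure) tendsto_whp_markov: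
  fixes X :: "nat \<Rightarrow> 'a \<Rightarrow> real"
  assumes int: "\<And>n. integrable M (X n)" and nonneg: "\<And>n \<omega>. \<omega> \<in> space M \<Longrightarrow> 0 \<le> X n \<omega>"
    and lim: "(\<lambda>n. \<integral>\<omega>. X n \<omega> \<partial>M) \<longlonglongrightarrow> 0"
  shows "((\<lambda>p. X (fst p) (snd p)) \<longlongrightarrow> 0) (whp M)"
proof (rule tendstoI)
  fix e :: real assume e: "e > 0"
  note [measurable] = borel_measurable_integrable[OF int]
  have "(\<lambda>n. measure M {\<omega>\<in>space M. e \<le> X n \<omega>}) \<longlonglongrightarrow> 0"
  proof (rule tendsto_sandwich[OF _ _ tendsto_const])
    show "\<forall>\<^sub>F n in sequentially. measure M {\<omega>\<in>space M. e \<le> X n \<omega>} \<le> (\<integral>\<omega>. X n \<omega> \<partial>M) / e"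
      using e nonneg int
      by (intro always_eventually allI integral_Markov_inequality_measure[where A="space M"] AE_I2) auto
    show "(\<lambda>n. (\<integral>\<omega>. X n \<omega> \<partial>M) / e) \<longlonglongrightarrow> 0"
      using tendsto_divide[OF lim tendsto_const, of e] e by simp
  qed simp
  moreover have "{\<omega> \<in> space M. \<not> dist (X n \<omega>) 0 < e} = {\<omega>\<in>space M. e \<le> X n \<omega>}" for n
    using nonneg by auto
  ultimately show "\<forall>\<^sub>F p in whp M. dist (X (fst p) (snd p)) 0 < e"
    by (intro eventually_whpI) (auto simp: not_less)
qed

section \<open>Sums of independent variables and the weak law of large numbers\<close>

lemma (in prob_space) expectation_sum_square_indep:
  fixes X :: "nat \<Rightarrow> 'a \<Rightarrow> real"
  assumes indep: "indep_vars (\<lambda>_. borel) X UNIV"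
    and sq: "\<And>t. integrable M (\<lambda>\<omega>. (X t \<omega>)\<^sup>2)"
    and mean: "\<And>t. expectation (X t) = 0"
    and var: "\<And>t. expectation (\<lambda>\<omega>. (X t \<omega>)\<^sup>2) = v"
    and fin: "finite I"
  shows "integrable M (\<lambda>\<omega>. (\<Sum>t\<in>I. X t \<omega>)\<^sup>2)"
    and "expectation (\<lambda>\<omega>. (\<Sum>t\<in>I. X t \<omega>)\<^sup>2) = real (card I) * v"
proof -
  have rv[measurable]: "random_variable borel (X t)" for t
    using indep unfolding indep_vars_def2 by simp
  have int: "integrable M (X t)" for t
    by (rule square_integrable_imp_integrable[OF _ sq]) simp
  have prod: "integrable M (\<lambda>\<omega>. X s \<omega> * X t \<omega>) \<and>
      expectation (\<lambda>\<omega>. X s \<omega> * X t \<omega>) = (if s = t then v else 0)" for s t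
  proof (cases "s = t")
    case True
    then show ?thesis using sq[of t] var[of t] by (simp add: power2_eq_square)
  next
    case False
    have "indep_vars (\<lambda>_. borel) X {s, t}"
      by (rule indep_vars_subset[OF indep]) auto
    then show ?thesis
      using False indep_vars_lebesgue_integral[of "{s, t}" X] indep_vars_integrable[of "{s, t}" X] int
      by (simp add: mean)
  qed
  have eq: "(\<Sum>t\<in>I. X t \<omega>)\<^sup>2 = (\<Sum>s\<in>I. \<Sum>t\<in>I. X s \<omega> * X t \<omega>)" for \<omega>
    by (simp add: power2_eq_square sum_product)
  show "integrable M (\<lambda>\<omega>. (\<Sum>t\<in>I. X t \<omega>)\<^sup>2)"
    unfolding eq using prod by (intro Bochner_Integration.integrable_sum) auto
  show "expectation (\<lambda>\<omega>. (\<Sum>t\<in>I. X t \<omega>)\<^sup>2) = real (card I) * v"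
    unfolding eq using prod fin
    by (subst Bochner_Integration.integral_sum | (intro Bochner_Integration.integrable_sum) | simp)+
qed


text \<open>Truncation is used because only first moments are at hand: products of two noise
  coordinates, for instance, are merely integrable. The mean deviation is shown to tend to 0 in L1,
  which gives convergence in probability by Markov's inequality.\<close>

lemma (in prob_space) law_of_large_numbers:
  fixes X :: "nat \<Rightarrow> 'a \<Rightarrow> real"
  assumes indep: "indep_vars (\<lambda>_. borel) X UNIV"
    and ident: "\<And>t. distr M borel (X t) = distr M borel (X 0)"
    and int0: "integrable M (X 0)"
  shows "((\<lambda>p. 1 / real (fst p) * (\<Sum>t=1..fst p. X t (snd p))) \<longlongrightarrow> expectation (X 0)) (whp M)"
proof -
  have rv[measurable]: "random_variable borel (X t)" for t
    using indep unfolding indep_vars_def2 by simp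
  have int_eq: "integrable M (\<lambda>\<omega>. g (X t \<omega>)) \<longleftrightarrow> integrable M (\<lambda>\<omega>. g (X 0 \<omega>))"
    if [measurable]: "g \<in> borel_measurable borel" for g :: "real \<Rightarrow> real" and t
    using integrable_distr_eq[OF rv[of t], of g] integrable_distr_eq[OF rv[of 0], of g] ident[of t] by simp
  have expect_eq: "expectation (\<lambda>\<omega>. g (X t \<omega>)) = expectation (\<lambda>\<omega>. g (X 0 \<omega>))"
    if [measurable]: "g \<in> borel_measurable borel" for g :: "real \<Rightarrow> real" and t
    using integral_distr[OF rv[of t], of g] integral_distr[OF rv[of 0], of g] ident[of t] by simp
  define m where "m = expectation (X 0)"
  define D where "D n \<omega> = 1 / real n * (\<Sum>t=1..n. X t \<omega>) - m" for n \<omega>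
  have int: "integrable M (X t)" for t
    using int_eq[of "\<lambda>x. x" t] int0 by simp
  have intD: "integrable M (D n)" for n
    unfolding D_def using int by auto
  have lim: "(\<lambda>n. expectation (\<lambda>\<omega>. \<bar>D n \<omega>\<bar>)) \<longlonglongrightarrow> 0"
  proof (rule LIMSEQ_I)
    fix e :: real assume e: "e > 0"
    define cut :: "nat \<Rightarrow> real \<Rightarrow> real" where "cut c x = (if \<bar>x\<bar> \<le> real c then x else 0)" for c x
    have cut_meas[measurable]: "cut c \<in> borel_measurable borel" for c
      unfolding cut_def by measurable
    have "(\<lambda>c. expectation (\<lambda>\<omega>. \<bar>X 0 \<omega> - cut c (X 0 \<omega>)\<bar>)) \<longlonglongrightarrow> expectation (\<lambda>_. 0)"
    proof (rule integral_dominated_convergence[where w = "\<lambda>\<omega>. \<bar>X 0 \<omega>\<bar>"])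
      show "AE \<omega> in M. (\<lambda>c. \<bar>X 0 \<omega> - cut c (X 0 \<omega>)\<bar>) \<longlonglongrightarrow> 0"
      proof (rule AE_I2)
        fix \<omega>
        obtain N where "\<bar>X 0 \<omega>\<bar> \<le> real N" using real_arch_simple by blast
        then show "(\<lambda>c. \<bar>X 0 \<omega> - cut c (X 0 \<omega>)\<bar>) \<longlonglongrightarrow> 0"
          by (intro tendsto_eventually eventually_sequentiallyI[of N]) (auto simp: cut_def)
      qed
    qed (use int0 in \<open>auto simp: cut_def\<close>)
    \<comment> \<open>The truncation level is fixed by \<open>e\<close> alone and does not move with
      \<open>n\<close>, so the truncated variables keep one constant variance.\<close>
    then have "\<forall>\<^sub>F c in sequentially. expectation (\<lambda>\<omega>. \<bar>X 0 \<omega> - cut c (X 0 \<omega>)\<bar>) < e / 8"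
      using e by (intro order_tendstoD) auto
    then obtain c where c: "expectation (\<lambda>\<omega>. \<bar>X 0 \<omega> - cut c (X 0 \<omega>)\<bar>) < e / 8"
      by (meson eventually_sequentially order_refl)
    \<comment> \<open>Splitting of \<open>X t\<close>: \<open>U\<close> is the truncated, recentred
      part, controlled by its variance; \<open>V\<close> is the discarded tail, controlled in
      mean.\<close>
    define u where "u = expectation (\<lambda>\<omega>. cut c (X 0 \<omega>))"
    define U where "U t \<omega> = cut c (X t \<omega>) - u" for t \<omega>
    define V where "V t \<omega> = X t \<omega> - cut c (X t \<omega>)" for t \<omega>
    define v where "v = expectation (\<lambda>\<omega>. (U 0 \<omega>)\<^sup>2)"
    have cut_bd: "\<bar>cut c x\<bar> \<le> c" for x by (auto simp: cut_def)
    have int_cut: "integrable M (\<lambda>\<omega>. cut c (X t \<omega>))" for t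
      using cut_bd by (intro integrable_const_bound[of _ "real c"]) auto
    have [measurable]: "random_variable borel (U t)" for t
      unfolding U_def by measurable
    have indepU: "indep_vars (\<lambda>_. borel) U UNIV"
      unfolding U_def by (rule indep_vars_compose2[OF indep]) measurable
    have sqU: "integrable M (\<lambda>\<omega>. (U t \<omega>)\<^sup>2)" for t
    proof (rule integrable_const_bound[of _ "(real c + \<bar>u\<bar>)\<^sup>2"])
      have "\<bar>U t \<omega>\<bar> \<le> real c + \<bar>u\<bar>" for \<omega>
        using cut_bd[of "X t \<omega>"] by (auto simp: U_def)
      then show "AE \<omega> in M. norm ((U t \<omega>)\<^sup>2) \<le> (real c + \<bar>u\<bar>)\<^sup>2"
        by (auto simp: abs_le_square_iff[symmetric])
    qed measurable
    have meanU: "expectation (U t) = 0" for t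
      using int_cut expect_eq[of "cut c" t] by (simp add: U_def[abs_def] u_def prob_space)
    have varU: "expectation (\<lambda>\<omega>. (U t \<omega>)\<^sup>2) = v" for t
      using expect_eq[of "\<lambda>x. (cut c x - u)\<^sup>2" t] by (simp add: U_def v_def)
    note sumU = expectation_sum_square_indep[OF indepU sqU meanU varU]
    have intV: "integrable M (V t)" for t
      unfolding V_def using int int_cut by simp
    have expV: "expectation (\<lambda>\<omega>. \<bar>V t \<omega>\<bar>) < e / 8" for t
      using c expect_eq[of "\<lambda>x. \<bar>x - cut c x\<bar>" t] by (simp add: V_def)
    have mu: "\<bar>u - m\<bar> \<le> e / 8"
    proof -
      have "m - u = expectation (V 0)"
        using int int_cut by (simp add: V_def[abs_def] m_def u_def)
      also have "\<bar>\<dots>\<bar> \<le> expectation (\<lambda>\<omega>. \<bar>V 0 \<omega>\<bar>)"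
        using integral_norm_bound[of M "V 0"] by simp
      finally show ?thesis using expV[of 0] by linarith
    qed
    have bound: "expectation (\<lambda>\<omega>. \<bar>D n \<omega>\<bar>) \<le> e / 2 + v / n * (4 / e)" if n: "n \<ge> 1" for n
    proof -
      define W where "W \<omega> = 1 / real n * (\<Sum>t=1..n. U t \<omega>)" for \<omega>
      have W2: "(W \<omega>)\<^sup>2 = 1 / (real n)\<^sup>2 * (\<Sum>t=1..n. U t \<omega>)\<^sup>2" for \<omega>
        unfolding W_def by (simp add: power_mult_distrib power_divide)
      have intW2: "integrable M (\<lambda>\<omega>. (W \<omega>)\<^sup>2)"
        unfolding W2 using sumU(1) by auto
      have EW2: "expectation (\<lambda>\<omega>. (W \<omega>)\<^sup>2) = v / n"
        unfolding W2 using n sumU by (simp add: power2_eq_square)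
      have D_eq: "D n \<omega> = W \<omega> + (1 / real n * (\<Sum>t=1..n. V t \<omega>) + (u - m))" for \<omega>
        using n by (simp add: D_def W_def U_def V_def sum_subtractf algebra_simps)
      \<comment> \<open>Trades the mean of \<open>\<bar>W\<bar>\<close> for its second moment at the
        price of \<open>e / 4\<close>. Together with \<open>e / 8\<close> for the tail and
        \<open>e / 8\<close> for the recentring this accounts for the \<open>e / 2\<close> in the
        bound.\<close>
      have amgm: "\<bar>x\<bar> \<le> x\<^sup>2 * (4 / e) + e / 4" for x :: real
      proof (cases "\<bar>x\<bar> \<le> e / 4")
        case True
        then show ?thesis using e by (smt (verit) divide_nonneg_pos mult_nonneg_nonneg zero_le_power2)
      next
        case False
        then have "\<bar>x\<bar> * (e / 4) \<le> \<bar>x\<bar> * \<bar>x\<bar>" by (intro mult_left_mono) auto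
        then have "\<bar>x\<bar> \<le> x\<^sup>2 * (4 / e)" using e by (simp add: field_simps power2_eq_square)
        then show ?thesis using e by simp
      qed
      have "\<bar>D n \<omega>\<bar> \<le> ((W \<omega>)\<^sup>2 * (4 / e) + e / 4) + (1 / real n * (\<Sum>t=1..n. \<bar>V t \<omega>\<bar>) + e / 8)" for \<omega>
      proof -
        have "\<bar>1 / real n * (\<Sum>t=1..n. V t \<omega>)\<bar> \<le> 1 / real n * (\<Sum>t=1..n. \<bar>V t \<omega>\<bar>)"
          by (simp add: abs_mult divide_right_mono)
        then show ?thesis
          unfolding D_eq using amgm[of "W \<omega>"] mu by linarith
      qed
      then have "expectation (\<lambda>\<omega>. \<bar>D n \<omega>\<bar>) \<le>
          expectation (\<lambda>\<omega>. ((W \<omega>)\<^sup>2 * (4 / e) + e / 4) + (1 / real n * (\<Sum>t=1..n. \<bar>V t \<omega>\<bar>) + e / 8))"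
        using intD intW2 intV by (intro integral_mono) auto
      also have "\<dots> = v / n * (4 / e) + e / 4 + (1 / real n * (\<Sum>t=1..n. expectation (\<lambda>\<omega>. \<bar>V t \<omega>\<bar>)) + e / 8)"
      proof -
        have "integrable M (\<lambda>\<omega>. (W \<omega>)\<^sup>2 * (4 / e) + e / 4)" using intW2 by auto
        moreover have "integrable M (\<lambda>\<omega>. 1 / real n * (\<Sum>t=1..n. \<bar>V t \<omega>\<bar>) + e / 8)" using intV by auto
        ultimately show ?thesis
          using intV intW2 by (simp add: prob_space EW2)
      qed
      also have "1 / real n * (\<Sum>t=1..n. expectation (\<lambda>\<omega>. \<bar>V t \<omega>\<bar>)) \<le> 1 / real n * (\<Sum>t=1..n. e / 8)"
        using expV by (intro mult_left_mono sum_mono) (auto intro: less_imp_le)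
      also have "1 / real n * (\<Sum>t=1..n. e / 8) = e / 8" using n by simp
      finally show ?thesis by simp
    qed
    have "(\<lambda>n. e / 2 + v * (4 / e) * (1 / real n)) \<longlonglongrightarrow> e / 2 + v * (4 / e) * 0"
      by (intro tendsto_intros lim_1_over_n)
    then have "\<forall>\<^sub>F n in sequentially. e / 2 + v * (4 / e) * (1 / real n) < e"
      by (rule order_tendstoD(2)) (use e in simp)
    then have "\<forall>\<^sub>F n in sequentially. norm (expectation (\<lambda>\<omega>. \<bar>D n \<omega>\<bar>) - 0) < e"
      using eventually_ge_at_top[of 1]
    proof eventually_elim
      case (elim n)
      have "0 \<le> expectation (\<lambda>\<omega>. \<bar>D n \<omega>\<bar>)" by simp
      then show ?case using bound[OF elim(2)] elim(1) by (simp add: ac_simps)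
    qed
    then show "\<exists>no. \<forall>n\<ge>no. norm (expectation (\<lambda>\<omega>. \<bar>D n \<omega>\<bar>) - 0) < e"
      by (simp add: eventually_sequentially)
  qed
  have "((\<lambda>p. \<bar>D (fst p) (snd p)\<bar>) \<longlongrightarrow> 0) (whp M)"
    by (rule tendsto_whp_markov[of "\<lambda>n \<omega>. \<bar>D n \<omega>\<bar>"]) (use intD lim in auto)
  then show ?thesis
    unfolding tendsto_rabs_zero_iff D_def m_def[symmetric] by (simp add: LIM_zero_iff)
qed

text \<open>By Markov's inequality for the square of \<open>b\<close>, the event
  \<open>e / \<eta> \<le> \<bar>b\<bar>\<close> has small probability when \<open>\<eta>\<close> is
  small; off it, a remainder below \<open>\<eta> * \<bar>b\<bar>\<close> stays below
  \<open>e\<close>. This is the passage from "negligible against a variable bounded in mean square"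
  to "negligible".\<close>

lemma (in prob_space) tendsto_whp_tight:
  fixes R :: "nat \<Rightarrow> 'a \<Rightarrow> 'b::{real_normed_vector,second_countable_topology}" and b :: "nat \<Rightarrow> 'a \<Rightarrow> real"
  assumes [measurable]: "\<And>n. R n \<in> borel_measurable M" "\<And>n. b n \<in> borel_measurable M"
    and int: "\<And>n. integrable M (\<lambda>\<omega>. (b n \<omega>)\<^sup>2)" and C: "\<And>n. expectation (\<lambda>\<omega>. (b n \<omega>)\<^sup>2) \<le> C"
    and small: "\<And>\<eta>. \<eta> > 0 \<Longrightarrow> \<forall>\<^sub>F p in whp M. norm (R (fst p) (snd p)) \<le> \<eta> * \<bar>b (fst p) (snd p)\<bar>"
  shows "((\<lambda>p. R (fst p) (snd p)) \<longlongrightarrow> 0) (whp M)"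
proof (rule tendstoI)
  fix e :: real assume e: "e > 0"
  have C0: "C \<ge> 0"
    using C[of 0] by (rule order_trans[rotated]) simp
  have "(\<lambda>n. prob {\<omega>\<in>space M. e \<le> norm (R n \<omega>)}) \<longlonglongrightarrow> 0"
  proof (rule LIMSEQ_I)
    fix d :: real assume d: "d > 0"
    \<comment> \<open>Solves \<open>C * (\<eta> / e)\<^sup>2 \<le> d / 2\<close>;
      \<open>C + 1\<close> stands for \<open>C\<close> so that the denominator is positive even if
      \<open>C = 0\<close>.\<close>
    define \<eta> where "\<eta> = e * sqrt (d / (2 * (C + 1)))"
    have \<eta>: "\<eta> > 0" and \<eta>2: "C * (\<eta> / e)\<^sup>2 \<le> d / 2"
      using e d C0 by (auto simp: \<eta>_def field_simps power2_eq_square)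
    have "(\<lambda>n. prob {\<omega>\<in>space M. \<not> norm (R n \<omega>) \<le> \<eta> * \<bar>b n \<omega>\<bar>}) \<longlonglongrightarrow> 0"
      using measure_not_whp[OF small[OF \<eta>]] by simp
    then have "\<forall>\<^sub>F n in sequentially. prob {\<omega>\<in>space M. \<not> norm (R n \<omega>) \<le> \<eta> * \<bar>b n \<omega>\<bar>} < d / 2"
      using d by (intro order_tendstoD) auto
    then have "\<forall>\<^sub>F n in sequentially. norm (prob {\<omega>\<in>space M. e \<le> norm (R n \<omega>)} - 0) < d"
    proof eventually_elim
      case (elim n)
      have sub: "{\<omega>\<in>space M. e \<le> norm (R n \<omega>)} \<subseteq>
          {\<omega>\<in>space M. \<not> norm (R n \<omega>) \<le> \<eta> * \<bar>b n \<omega>\<bar>} \<union> {\<omega>\<in>space M. (e / \<eta>)\<^sup>2 \<le> (b n \<omega>)\<^sup>2}"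
      proof -
        have "(e / \<eta>)\<^sup>2 \<le> (b n \<omega>)\<^sup>2"
          if "e \<le> norm (R n \<omega>)" "norm (R n \<omega>) \<le> \<eta> * \<bar>b n \<omega>\<bar>" for \<omega>
        proof -
          from that have "\<bar>e / \<eta>\<bar> \<le> \<bar>b n \<omega>\<bar>" using e \<eta> by (simp add: field_simps)
          then show ?thesis by (simp only: abs_le_square_iff)
        qed
        then show ?thesis by blast
      qed
      have "prob {\<omega>\<in>space M. (e / \<eta>)\<^sup>2 \<le> (b n \<omega>)\<^sup>2} \<le> expectation (\<lambda>\<omega>. (b n \<omega>)\<^sup>2) / (e / \<eta>)\<^sup>2"
        using e \<eta> int by (intro integral_Markov_inequality_measure[where A = "space M"]) auto
      also have "\<dots> \<le> C / (e / \<eta>)\<^sup>2"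
        using C by (intro divide_right_mono) auto
      also have "\<dots> \<le> d / 2"
        using \<eta>2 by (simp add: power_divide)
      finally have 2: "prob {\<omega>\<in>space M. (e / \<eta>)\<^sup>2 \<le> (b n \<omega>)\<^sup>2} \<le> d / 2" .
      have "prob {\<omega>\<in>space M. e \<le> norm (R n \<omega>)} \<le>
          prob ({\<omega>\<in>space M. \<not> norm (R n \<omega>) \<le> \<eta> * \<bar>b n \<omega>\<bar>} \<union> {\<omega>\<in>space M. (e / \<eta>)\<^sup>2 \<le> (b n \<omega>)\<^sup>2})"
        by (rule finite_measure_mono[OF sub]) measurable
      also have "\<dots> \<le> prob {\<omega>\<in>space M. \<not> norm (R n \<omega>) \<le> \<eta> * \<bar>b n \<omega>\<bar>} + prob {\<omega>\<in>space M. (e / \<eta>)\<^sup>2 \<le> (b n \<omega>)\<^sup>2}"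
        by (rule measure_Un_le) measurable
      also have "\<dots> < d" using elim 2 by linarith
      finally show ?case by simp
    qed
    then show "\<exists>no. \<forall>n\<ge>no. norm (prob {\<omega>\<in>space M. e \<le> norm (R n \<omega>)} - 0) < d"
      by (simp add: eventually_sequentially)
  qed
  then show "\<forall>\<^sub>F p in whp M. dist (R (fst p) (snd p)) 0 < e"
    by (intro eventually_whpI) (simp_all add: not_less)
qed

section \<open>Weak convergence from characteristic functions\<close>

text \<open>A continuous stand-in for the indicator of a ball. Being itself an admissible compactly
  supported test function, it detects whether mass escapes to infinity.\<close>

definition cutoff :: "nat \<Rightarrow> 'b::real_normed_vector \<Rightarrow> real" where
  "cutoff j x = max 0 (min 1 (real j + 1 - norm x))"

lemma cutoff_bounds: "0 \<le> cutoff j x" "cutoff j x \<le> 1"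
  by (auto simp: cutoff_def)

lemma abs_cutoff[simp]: "\<bar>cutoff j x\<bar> = cutoff j x"
  by (simp add: cutoff_bounds)

lemma cutoff_eq_0: "real j + 1 \<le> norm x \<Longrightarrow> cutoff j x = 0"
  by (auto simp: cutoff_def)

lemma continuous_on_cutoff: "continuous_on UNIV (cutoff j)"
  unfolding cutoff_def[abs_def] by (intro continuous_intros)

lemma borel_measurable_cutoff[measurable]: "cutoff j \<in> borel_measurable (borel :: 'b::real_normed_vector measure)"
  using continuous_on_cutoff by (rule borel_measurable_continuous_onI)

lemma integral_cutoff_tendsto:
  fixes \<mu> :: "'b::real_normed_vector measure"
  assumes "prob_space \<mu>" and [measurable_cong]: "sets \<mu> = sets borel"
  shows "(\<lambda>j. \<integral>x. cutoff j x \<partial>\<mu>) \<longlonglongrightarrow> 1"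
proof -
  interpret prob_space \<mu> by fact
  have "(\<lambda>j. \<integral>x. cutoff j x \<partial>\<mu>) \<longlonglongrightarrow> (\<integral>x. 1 \<partial>\<mu>)"
  proof (rule integral_dominated_convergence[where w = "\<lambda>_. 1"])
    show "AE x in \<mu>. (\<lambda>j. cutoff j x) \<longlonglongrightarrow> 1"
    proof (rule AE_I2)
      fix x :: 'b
      obtain N where "norm x \<le> real N" using real_arch_simple by blast
      then show "(\<lambda>j. cutoff j x) \<longlonglongrightarrow> 1"
        by (intro tendsto_eventually eventually_sequentiallyI[of N]) (auto simp: cutoff_def)
    qed
  qed (auto simp: cutoff_bounds)
  then show ?thesis by (simp add: prob_space)
qed

text \<open>Tightness is inherited from the limit: \<open>\<mu>\<close> has total mass 1, so some
  \<open>cutoff j\<close> has integral near 1 under \<open>\<mu>\<close> and therefore, by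
  convergence on this test function, under the law of \<open>X n\<close> for large \<open>n\<close>.
  A bounded \<open>f\<close> may then be replaced by its product with
  \<open>cutoff j\<close>.\<close>

lemma converges_in_law_compact_supportI:
  fixes X :: "nat \<Rightarrow> 'a \<Rightarrow> 'b::euclidean_space"
  assumes "prob_space M" "prob_space \<mu>" and sets_\<mu>[simp, measurable_cong]: "sets \<mu> = sets borel"
    and [measurable]: "\<And>n. X n \<in> borel_measurable M"
    and conv: "\<And>(f :: 'b \<Rightarrow> real) r. continuous_on UNIV f \<Longrightarrow> (\<And>x. norm x \<ge> r \<Longrightarrow> f x = 0) \<Longrightarrow>
        (\<lambda>n. \<integral>\<omega>. f (X n \<omega>) \<partial>M) \<longlonglongrightarrow> (\<integral>x. f x \<partial>\<mu>)"
  shows "converges_in_law M X \<mu>"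
  unfolding converges_in_law_def
proof (intro allI impI)
  fix f :: "'b \<Rightarrow> real"
  assume f: "continuous_on UNIV f" and "bounded (range f)"
  then obtain K0 where "\<And>x. norm (f x) \<le> K0"
    unfolding bounded_iff by blast
  then obtain K where K: "\<And>x. \<bar>f x\<bar> \<le> K" "K > 0"
    by (metis max.cobounded1 max.coboundedI2 order_trans real_norm_def zero_less_one max_less_iff_conj less_max_iff_disj)
  interpret M: prob_space M by fact
  interpret \<mu>: prob_space \<mu> by fact
  have [measurable]: "f \<in> borel_measurable borel"
    using f by (rule borel_measurable_continuous_onI)
  show "(\<lambda>n. \<integral>\<omega>. f (X n \<omega>) \<partial>M) \<longlonglongrightarrow> (\<integral>x. f x \<partial>\<mu>)"
  proof (rule LIMSEQ_I)
    fix e :: real assume e: "e > 0"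
    have "(\<lambda>j. \<integral>x. cutoff j x \<partial>\<mu>) \<longlonglongrightarrow> 1"
      using assms(2,3) by (rule integral_cutoff_tendsto)
    then have "\<forall>\<^sub>F j in sequentially. (\<integral>x. cutoff j x \<partial>\<mu>) > 1 - e / (4 * K)"
      using e K by (intro order_tendstoD) (auto simp: \<mu>.prob_space)
    then obtain j where j: "(\<integral>x. cutoff j x \<partial>\<mu>) > 1 - e / (4 * K)"
      by (meson eventually_sequentially order_refl)
    have c1: "(\<lambda>n. \<integral>\<omega>. cutoff j (X n \<omega>) \<partial>M) \<longlonglongrightarrow> (\<integral>x. cutoff j x \<partial>\<mu>)"
      by (rule conv[OF continuous_on_cutoff]) (rule cutoff_eq_0)
    have c2: "(\<lambda>n. \<integral>\<omega>. f (X n \<omega>) * cutoff j (X n \<omega>) \<partial>M) \<longlonglongrightarrow> (\<integral>x. f x * cutoff j x \<partial>\<mu>)"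
      by (rule conv[of _ "real j + 1"])
         (auto intro!: continuous_on_mult f continuous_on_cutoff simp: cutoff_eq_0)
    have ev1: "\<forall>\<^sub>F n in sequentially. (\<integral>\<omega>. cutoff j (X n \<omega>) \<partial>M) > 1 - e / (4 * K)"
      by (rule order_tendstoD(1)[OF c1 j])
    have ev2: "\<forall>\<^sub>F n in sequentially. dist (\<integral>\<omega>. f (X n \<omega>) * cutoff j (X n \<omega>) \<partial>M) (\<integral>x. f x * cutoff j x \<partial>\<mu>) < e / 2"
      by (rule tendstoD[OF c2]) (use e in simp)
    \<comment> \<open>Stated for a general variable because it serves twice: for \<open>X n\<close>
      under \<open>M\<close> and for the identity under \<open>\<mu>\<close>.\<close>
    have tail: "\<bar>(\<integral>\<omega>. f (Y \<omega>) \<partial>N) - (\<integral>\<omega>. f (Y \<omega>) * cutoff j (Y \<omega>) \<partial>N)\<bar> \<le> e / 4"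
      if "prob_space N" and Y[measurable]: "Y \<in> borel_measurable N"
        and l: "(\<integral>\<omega>. cutoff j (Y \<omega>) \<partial>N) > 1 - e / (4 * K)" for N and Y :: "'c \<Rightarrow> 'b"
    proof -
      interpret N: prob_space N by fact
      have i1: "integrable N (\<lambda>\<omega>. f (Y \<omega>))"
        using K by (intro N.integrable_const_bound[of _ K]) auto
      have i2: "integrable N (\<lambda>\<omega>. cutoff j (Y \<omega>))"
        by (intro N.integrable_const_bound[of _ 1]) (auto simp: cutoff_bounds)
      have b3: "\<bar>f x * cutoff j x\<bar> \<le> K" for x
        using mult_mono[OF K(1)[of x] cutoff_bounds(2)[of j x]] K cutoff_bounds[of j x]
        by (simp add: abs_mult)
      have i3: "integrable N (\<lambda>\<omega>. f (Y \<omega>) * cutoff j (Y \<omega>))"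
        using b3 by (intro N.integrable_const_bound[of _ K]) auto
      have "\<bar>(\<integral>\<omega>. f (Y \<omega>) \<partial>N) - (\<integral>\<omega>. f (Y \<omega>) * cutoff j (Y \<omega>) \<partial>N)\<bar>
          = \<bar>\<integral>\<omega>. f (Y \<omega>) - f (Y \<omega>) * cutoff j (Y \<omega>) \<partial>N\<bar>"
        using i1 i3 by simp
      also have "\<dots> \<le> (\<integral>\<omega>. \<bar>f (Y \<omega>) - f (Y \<omega>) * cutoff j (Y \<omega>)\<bar> \<partial>N)"
        using integral_norm_bound[of N "\<lambda>\<omega>. f (Y \<omega>) - f (Y \<omega>) * cutoff j (Y \<omega>)"] by simp
      also have "\<dots> \<le> (\<integral>\<omega>. K * (1 - cutoff j (Y \<omega>)) \<partial>N)"
      proof (rule integral_mono)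
        fix \<omega>
        have "\<bar>f (Y \<omega>) - f (Y \<omega>) * cutoff j (Y \<omega>)\<bar> = \<bar>f (Y \<omega>)\<bar> * \<bar>1 - cutoff j (Y \<omega>)\<bar>"
          by (simp add: abs_mult[symmetric] algebra_simps)
        also have "\<bar>1 - cutoff j (Y \<omega>)\<bar> = 1 - cutoff j (Y \<omega>)"
          using cutoff_bounds[of j "Y \<omega>"] by simp
        also have "\<bar>f (Y \<omega>)\<bar> * (1 - cutoff j (Y \<omega>)) \<le> K * (1 - cutoff j (Y \<omega>))"
          using K cutoff_bounds[of j "Y \<omega>"] by (intro mult_right_mono) auto
        finally show "\<bar>f (Y \<omega>) - f (Y \<omega>) * cutoff j (Y \<omega>)\<bar> \<le> K * (1 - cutoff j (Y \<omega>))" .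
      qed (use i1 i2 i3 in auto)
      also have "\<dots> = K * (1 - (\<integral>\<omega>. cutoff j (Y \<omega>) \<partial>N))"
        using i2 by (simp add: N.prob_space)
      also have "\<dots> \<le> K * (e / (4 * K))"
        using l K by (intro mult_left_mono) auto
      finally show ?thesis using K by simp
    qed
    have t\<mu>: "\<bar>(\<integral>x. f x \<partial>\<mu>) - (\<integral>x. f x * cutoff j x \<partial>\<mu>)\<bar> \<le> e / 4"
      using tail[of \<mu> "\<lambda>x. x"] j \<open>prob_space \<mu>\<close> by simp
    from ev1 ev2 have "\<forall>\<^sub>F n in sequentially. norm ((\<integral>\<omega>. f (X n \<omega>) \<partial>M) - (\<integral>x. f x \<partial>\<mu>)) < e"
    proof eventually_elim
      case (elim n)
      have "\<bar>(\<integral>\<omega>. f (X n \<omega>) \<partial>M) - (\<integral>\<omega>. f (X n \<omega>) * cutoff j (X n \<omega>) \<partial>M)\<bar> \<le> e / 4"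
        by (rule tail) (use elim \<open>prob_space M\<close> in auto)
      then show ?case using elim(2) t\<mu> unfolding dist_real_def real_norm_def by linarith
    qed
    then show "\<exists>no. \<forall>n\<ge>no. norm ((\<integral>\<omega>. f (X n \<omega>) \<partial>M) - (\<integral>x. f x \<partial>\<mu>)) < e"
      by (simp add: eventually_sequentially)
  qed
qed

lemma compact_support_bounded:
  fixes f :: "'b::euclidean_space \<Rightarrow> real"
  assumes "continuous_on UNIV f" and zero: "\<And>x. norm x \<ge> r \<Longrightarrow> f x = 0"
  shows "\<exists>K>0. \<forall>x. \<bar>f x\<bar> \<le> K"
proof -
  have "compact (f ` cball 0 r)"
    by (intro compact_continuous_image continuous_on_subset[OF assms(1)]) auto
  then have "bounded (f ` cball 0 r)" by (rule compact_imp_bounded)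
  then obtain K where K: "\<forall>y\<in>f ` cball 0 r. norm y \<le> K"
    unfolding bounded_iff by blast
  have "\<bar>f x\<bar> \<le> \<bar>K\<bar> + 1" for x
  proof (cases "norm x \<le> r")
    case True
    then have "norm (f x) \<le> K" using K by auto
    then show ?thesis by simp
  next
    case False
    then show ?thesis using zero[of x] by simp
  qed
  then show ?thesis by (intro exI[of _ "\<bar>K\<bar> + 1"]) auto
qed

lemma compact_support_uniformly_continuous:
  fixes f :: "'b::euclidean_space \<Rightarrow> real"
  assumes "continuous_on UNIV f" and zero: "\<And>x. norm x \<ge> r \<Longrightarrow> f x = 0"
  shows "uniformly_continuous_on UNIV f"
  unfolding uniformly_continuous_on_def
proof (intro allI impI)
  fix e :: real assume e: "e > 0"
  \<comment> \<open>The extra radius 1 separates two cases for points at distance below 1: both lie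
    in the ball, or \<open>f\<close> vanishes at both.\<close>
  have "uniformly_continuous_on (cball 0 (r + 1)) f"
    by (intro compact_uniformly_continuous continuous_on_subset[OF assms(1)]) auto
  then obtain d where d: "d > 0"
    "\<And>x x'. x \<in> cball 0 (r + 1) \<Longrightarrow> x' \<in> cball 0 (r + 1) \<Longrightarrow> dist x' x < d \<Longrightarrow> dist (f x') (f x) < e"
    using e unfolding uniformly_continuous_on_def by metis
  have "dist (f x') (f x) < e" if "dist x' x < min d 1" for x x'
  proof (cases "x \<in> cball 0 (r + 1) \<and> x' \<in> cball 0 (r + 1)")
    case True
    then show ?thesis using d that by auto
  next
    case False
    have "norm x \<le> norm x' + 1" "norm x' \<le> norm x + 1"
      using that norm_triangle_ineq2[of x x'] norm_triangle_ineq2[of x' x]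
      by (auto simp: dist_norm norm_minus_commute)
    then have "f x = 0" "f x' = 0" using False by (auto intro!: zero)
    then show ?thesis using e by simp
  qed
  then show "\<exists>d>0. \<forall>x\<in>UNIV. \<forall>x'\<in>UNIV. dist x' x < d \<longrightarrow> dist (f x') (f x) < e"
    using d(1) by (intro exI[of _ "min d 1"]) auto
qed

text \<open>Uniform continuity of \<open>f\<close> controls the difference where the two sequences
  are close; on the complement, whose probability vanishes, the crude bound \<open>2 * K\<close> is
  enough.\<close>

lemma (in prob_space) slutsky_compact_support:
  fixes X X' :: "nat \<Rightarrow> 'a \<Rightarrow> 'b::euclidean_space" and f :: "'b \<Rightarrow> real"
  assumes [measurable]: "\<And>n. X n \<in> borel_measurable M" "\<And>n. X' n \<in> borel_measurable M"
    and f: "continuous_on UNIV f" "\<And>x. norm x \<ge> r \<Longrightarrow> f x = 0"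
    and diff: "((\<lambda>p. X' (fst p) (snd p) - X (fst p) (snd p)) \<longlongrightarrow> 0) (whp M)"
    and conv: "(\<lambda>n. expectation (\<lambda>\<omega>. f (X n \<omega>))) \<longlonglongrightarrow> L"
  shows "(\<lambda>n. expectation (\<lambda>\<omega>. f (X' n \<omega>))) \<longlonglongrightarrow> L"
proof -
  obtain K where K: "\<And>x. \<bar>f x\<bar> \<le> K" "K > 0"
    using compact_support_bounded[OF f] by auto
  have [measurable]: "f \<in> borel_measurable borel"
    using f(1) by (rule borel_measurable_continuous_onI)
  have int: "integrable M (\<lambda>\<omega>. f (X n \<omega>))" "integrable M (\<lambda>\<omega>. f (X' n \<omega>))" for n
    using K by (intro integrable_const_bound[of _ K]; auto)+
  have "(\<lambda>n. expectation (\<lambda>\<omega>. f (X' n \<omega>)) - expectation (\<lambda>\<omega>. f (X n \<omega>))) \<longlonglongrightarrow> 0"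
  proof (rule LIMSEQ_I)
    fix e :: real assume e: "e > 0"
    have "uniformly_continuous_on UNIV f"
      using f by (rule compact_support_uniformly_continuous)
    then obtain d where d: "d > 0" "\<And>x x'. dist x' x < d \<Longrightarrow> dist (f x') (f x) < e / 2"
      using e unfolding uniformly_continuous_on_def by (metis UNIV_I half_gt_zero)
    define B where "B n = {\<omega>\<in>space M. \<not> dist (X' n \<omega>) (X n \<omega>) < d}" for n
    have [measurable, simp]: "B n \<in> sets M" for n unfolding B_def by measurable
    have "(\<lambda>n. prob (B n)) \<longlonglongrightarrow> 0"
      unfolding B_def using measure_not_whp[OF tendstoD[OF diff d(1)]] by (simp add: dist_norm)
    then have "\<forall>\<^sub>F n in sequentially. prob (B n) < e / (4 * K)"
      using e K by (intro order_tendstoD) auto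
    then have "\<forall>\<^sub>F n in sequentially. norm (expectation (\<lambda>\<omega>. f (X' n \<omega>)) - expectation (\<lambda>\<omega>. f (X n \<omega>)) - 0) < e"
    proof eventually_elim
      case (elim n)
      have "\<bar>expectation (\<lambda>\<omega>. f (X' n \<omega>)) - expectation (\<lambda>\<omega>. f (X n \<omega>))\<bar> =
          \<bar>expectation (\<lambda>\<omega>. f (X' n \<omega>) - f (X n \<omega>))\<bar>"
        using int by simp
      also have "\<dots> \<le> expectation (\<lambda>\<omega>. \<bar>f (X' n \<omega>) - f (X n \<omega>)\<bar>)"
        using integral_norm_bound[of M "\<lambda>\<omega>. f (X' n \<omega>) - f (X n \<omega>)"] by simp
      also have "\<dots> \<le> expectation (\<lambda>\<omega>. e / 2 + 2 * K * indicator (B n) \<omega>)"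
      proof (rule integral_mono)
        fix \<omega> assume "\<omega> \<in> space M"
        then show "\<bar>f (X' n \<omega>) - f (X n \<omega>)\<bar> \<le> e / 2 + 2 * K * indicator (B n) \<omega>"
          using K(1)[of "X n \<omega>"] K(1)[of "X' n \<omega>"] e d(2)[of "X' n \<omega>" "X n \<omega>"]
          by (cases "\<omega> \<in> B n") (auto simp: B_def dist_real_def)
      qed (use int in \<open>auto simp: less_top[symmetric]\<close>)
      also have "\<dots> = e / 2 + 2 * K * prob (B n)"
        by (subst Bochner_Integration.integral_add) (auto simp: prob_space less_top[symmetric])
      also have "\<dots> < e" using elim K by (simp add: field_simps)
      finally show ?case by simp
    qed
    then show "\<exists>no. \<forall>n\<ge>no. norm (expectation (\<lambda>\<omega>. f (X' n \<omega>)) - expectation (\<lambda>\<omega>. f (X n \<omega>)) - 0) < e"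
      by (simp add: eventually_sequentially)
  qed
  from tendsto_add[OF this conv] show ?thesis by simp
qed

section \<open>Gaussian smoothing and the continuity theorem\<close>

definition std_gauss :: "'b::euclidean_space measure" where
  "std_gauss = density lborel (\<lambda>x. ennreal (\<Prod>b\<in>Basis. std_normal_density (x \<bullet> b)))"

lemma sets_std_gauss[simp, measurable_cong]: "sets std_gauss = sets borel"
  by (simp add: std_gauss_def)

lemma space_std_gauss[simp]: "space std_gauss = UNIV"
  by (simp add: std_gauss_def)

lemma prod_std_normal_density:
  fixes x :: "'b::euclidean_space"
  shows "(\<Prod>b\<in>Basis. std_normal_density (x \<bullet> b)) = exp (- (x \<bullet> x) / 2) / sqrt ((2 * pi) ^ DIM('b))"
proof -
  have "(\<Prod>b\<in>(Basis::'b set). std_normal_density (x \<bullet> b)) =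
      (\<Prod>b\<in>(Basis::'b set). 1 / sqrt (2 * pi)) * (\<Prod>b\<in>Basis. exp (- (x \<bullet> b)\<^sup>2 / 2))"
    by (simp add: std_normal_density_def prod.distrib[symmetric] del: prod_constant)
  also have "(\<Prod>b\<in>Basis. exp (- (x \<bullet> b)\<^sup>2 / 2)) = exp (\<Sum>b\<in>Basis. - (x \<bullet> b)\<^sup>2 / 2)"
    by (simp add: exp_sum)
  also have "(\<Sum>b\<in>Basis. - (x \<bullet> b)\<^sup>2 / 2) = - (x \<bullet> x) / 2"
    by (subst euclidean_inner[of x x])
       (simp add: sum_divide_distrib[symmetric] sum_negf power2_eq_square)
  finally show ?thesis by (simp add: real_sqrt_power power_divide power_mult_distrib real_sqrt_mult)
qed

lemma prob_space_std_gauss: "prob_space (std_gauss :: 'b::euclidean_space measure)"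
proof
  have 1: "(\<integral>\<^sup>+x. ennreal (std_normal_density x) \<partial>lborel) = 1"
    using prob_space.emeasure_space_1[OF prob_space_normal_density[of 1 0]]
    by (simp add: emeasure_density)
  have "emeasure (std_gauss :: 'b measure) (space std_gauss) =
      (\<integral>\<^sup>+x. (\<Prod>b\<in>(Basis::'b set). ennreal (std_normal_density (x \<bullet> b))) \<partial>lborel)"
    by (simp add: std_gauss_def emeasure_density prod_ennreal)
  also have "\<dots> = (\<Prod>b\<in>(Basis::'b set). (\<integral>\<^sup>+x. ennreal (std_normal_density x) \<partial>lborel))"
    by (rule nn_integral_lborel_prod) auto
  finally show "emeasure (std_gauss :: 'b measure) (space std_gauss) = 1"
    by (simp add: 1)
qed

text \<open>Density and exponential both factor over the coordinates, so Fubini on the product of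
  lines leaves a product of one-dimensional Gaussian characteristic functions.\<close>

lemma char_std_gauss:
  fixes u :: "'b::euclidean_space"
  shows "(CLINT x|std_gauss. iexp (u \<bullet> x)) = complex_of_real (exp (- (u \<bullet> u) / 2))"
proof -
  interpret product_sigma_finite "\<lambda>_::'b. lborel :: real measure"
    by standard
  define g :: "'b \<Rightarrow> real \<Rightarrow> complex" where
    "g b s = std_normal_density s *\<^sub>R iexp ((u \<bullet> b) * s)" for b s
  have int_g: "integrable lborel (g b)" for b
    unfolding g_def
    by (rule Bochner_Integration.integrable_bound[OF integrable_normal_moment[of 1 0 0]])
       (auto simp: norm_mult)
  have ig: "integral\<^sup>L lborel (g b) = complex_of_real (exp (- (u \<bullet> b)\<^sup>2 / 2))" for b
    using fun_cong[OF char_std_normal_distribution, of "u \<bullet> b"]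
    unfolding char_def g_def by (subst (asm) integral_density) auto
  have "(CLINT x|std_gauss. iexp (u \<bullet> x)) =
      (CLINT x|lborel. (\<Prod>b\<in>Basis. std_normal_density (x \<bullet> b)) *\<^sub>R iexp (u \<bullet> x))"
    unfolding std_gauss_def by (subst integral_density) (auto intro!: prod_nonneg)
  also have "\<dots> = (CLINT x|lborel. (\<Prod>b\<in>Basis. g b (x \<bullet> b)))"
  proof (rule Bochner_Integration.integral_cong[OF refl])
    fix x :: 'b
    have "iexp (u \<bullet> x) = (\<Prod>b\<in>Basis. iexp ((u \<bullet> b) * (x \<bullet> b)))"
      by (subst euclidean_inner[of u x]) (simp add: exp_sum sum_distrib_left)
    then show "(\<Prod>b\<in>Basis. std_normal_density (x \<bullet> b)) *\<^sub>R iexp (u \<bullet> x) = (\<Prod>b\<in>Basis. g b (x \<bullet> b))"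
      by (simp add: g_def scaleR_conv_of_real prod.distrib)
  qed
  also have "\<dots> = (CLINT f|(\<Pi>\<^sub>M b\<in>(Basis::'b set). lborel). (\<Prod>b\<in>Basis. g b (f b)))"
    unfolding lborel_eq[where ?'a='b]
  proof (subst integral_distr)
    show "(CLINT x|(\<Pi>\<^sub>M b\<in>(Basis::'b set). lborel). (\<Prod>b\<in>Basis. g b ((\<Sum>b\<in>Basis. x b *\<^sub>R b) \<bullet> b))) =
        (CLINT f|(\<Pi>\<^sub>M b\<in>(Basis::'b set). lborel). (\<Prod>b\<in>Basis. g b (f b)))"
      by (intro Bochner_Integration.integral_cong refl prod.cong) (simp add: inner_sum_left_Basis)
  qed (auto simp: g_def)
  also have "\<dots> = (\<Prod>b\<in>(Basis::'b set). integral\<^sup>L lborel (g b))"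
    by (rule product_integral_prod) (auto intro: int_g)
  also have "\<dots> = complex_of_real (exp (- (u \<bullet> u) / 2))"
    unfolding ig by (subst euclidean_inner[of u u])
      (simp add: exp_sum[symmetric] sum_divide_distrib[symmetric] sum_negf power2_eq_square flip: of_real_prod)
  finally show ?thesis .
qed

lemma integral_lborel_affine:
  fixes g :: "'b::euclidean_space \<Rightarrow> real"
  assumes [measurable]: "g \<in> borel_measurable borel" and "s > 0"
  shows "(\<integral>y. g y \<partial>lborel) = s ^ DIM('b) * (\<integral>v. g (x + s *\<^sub>R v) \<partial>lborel)"
  using \<open>s > 0\<close> by (subst lborel_affine[of s x]) (auto simp: integral_density integral_distr)


text \<open>\<open>char_std_gauss\<close> read backwards: the Gaussian kernel is an average of
  \<open>iexp\<close> over Gaussian frequencies, and Fubini brings the integration over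
  \<open>\<nu>\<close> inside. Hence kernel averages of a law are determined by its characteristic
  function.\<close>

lemma char_smoothing:
  fixes \<nu> :: "'b::euclidean_space measure"
  assumes "prob_space \<nu>" and [simp, measurable_cong]: "sets \<nu> = sets borel"
  shows "complex_of_real (\<integral>x. exp (- (((y - x) /\<^sub>R s) \<bullet> ((y - x) /\<^sub>R s)) / 2) \<partial>\<nu>) =
    (CLINT u|std_gauss. iexp ((y /\<^sub>R s) \<bullet> u) * (CLINT x|\<nu>. iexp ((- u /\<^sub>R s) \<bullet> x)))"
proof -
  interpret \<nu>: prob_space \<nu> by fact
  interpret \<gamma>: prob_space "std_gauss :: 'b measure" by (rule prob_space_std_gauss)
  interpret pair_prob_space \<nu> "std_gauss :: 'b measure" ..
  have space_\<nu>[simp]: "space \<nu> = UNIV" using sets_eq_imp_space_eq[OF assms(2)] by simp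
  have eq: "iexp (((y - x) /\<^sub>R s) \<bullet> u) = iexp ((y /\<^sub>R s) \<bullet> u) * iexp ((- u /\<^sub>R s) \<bullet> x)" for x u :: 'b
    by (simp add: exp_add[symmetric] inner_simps inner_commute[of u x] algebra_simps)
  have "complex_of_real (\<integral>x. exp (- (((y - x) /\<^sub>R s) \<bullet> ((y - x) /\<^sub>R s)) / 2) \<partial>\<nu>) =
      (CLINT x|\<nu>. complex_of_real (exp (- (((y - x) /\<^sub>R s) \<bullet> ((y - x) /\<^sub>R s)) / 2)))"
    by simp
  also have "\<dots> = (CLINT x|\<nu>. CLINT u|std_gauss. iexp (((y - x) /\<^sub>R s) \<bullet> u))"
    by (simp only: char_std_gauss)
  also have "\<dots> = (CLINT u|std_gauss. CLINT x|\<nu>. iexp (((y - x) /\<^sub>R s) \<bullet> u))"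
    by (rule Fubini_integral[symmetric], rule P.integrable_const_bound[of _ 1])
       (auto simp: case_prod_beta)
  also have "\<dots> = (CLINT u|std_gauss. iexp ((y /\<^sub>R s) \<bullet> u) * (CLINT x|\<nu>. iexp ((- u /\<^sub>R s) \<bullet> x)))"
    unfolding eq by simp
  finally show ?thesis .
qed

text \<open>The substitution \<open>y = x + s *\<^sub>R v\<close> moves the translation from
  \<open>f\<close> to the kernel. After Fubini, \<open>f\<close> is integrated against the density
  of \<open>\<nu>\<close> convolved with a Gaussian of scale \<open>s\<close>.\<close>

lemma integral_smoothing:
  fixes \<nu> :: "'b::euclidean_space measure" and f :: "'b \<Rightarrow> real"
  assumes "prob_space \<nu>" and [simp, measurable_cong]: "sets \<nu> = sets borel"
    and f: "integrable lborel f" and s: "s > 0"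
  shows "(\<integral>x. (\<integral>v. f (x + s *\<^sub>R v) \<partial>std_gauss) \<partial>\<nu>) =
    1 / (sqrt ((2 * pi) ^ DIM('b)) * s ^ DIM('b)) *
      (\<integral>y. f y * (\<integral>x. exp (- (((y - x) /\<^sub>R s) \<bullet> ((y - x) /\<^sub>R s)) / 2) \<partial>\<nu>) \<partial>lborel)"
proof -
  interpret \<nu>: prob_space \<nu> by fact
  interpret pair_sigma_finite \<nu> "lborel :: 'b measure" ..
  have [measurable]: "f \<in> borel_measurable borel" using f by auto
  define k :: "'b \<Rightarrow> real" where "k w = exp (- (w \<bullet> w) / 2)" for w
  have [measurable]: "k \<in> borel_measurable borel" unfolding k_def by measurable
  have k: "0 \<le> k w" "k w \<le> 1" for w by (auto simp: k_def)
  define c where "c = 1 / sqrt ((2 * pi) ^ DIM('b))"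
  have inner: "(\<integral>v. f (x + s *\<^sub>R v) \<partial>std_gauss) = c / s ^ DIM('b) * (\<integral>y. f y * k ((y - x) /\<^sub>R s) \<partial>lborel)" for x
  proof -
    have "(\<integral>v. f (x + s *\<^sub>R v) \<partial>std_gauss) = (\<integral>v. (k v * c) * f (x + s *\<^sub>R v) \<partial>lborel)"
      unfolding std_gauss_def prod_std_normal_density
      by (subst integral_density) (auto simp: k_def c_def)
    also have "\<dots> = c * (\<integral>v. f (x + s *\<^sub>R v) * k v \<partial>lborel)"
      by (subst integral_mult_right_zero[symmetric]) (simp add: ac_simps)
    also have "(\<integral>y. f y * k ((y - x) /\<^sub>R s) \<partial>lborel) = s ^ DIM('b) * (\<integral>v. f (x + s *\<^sub>R v) * k v \<partial>lborel)"
      using s by (subst integral_lborel_affine[of _ s x]) auto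
    then have "c * (\<integral>v. f (x + s *\<^sub>R v) * k v \<partial>lborel) = c / s ^ DIM('b) * (\<integral>y. f y * k ((y - x) /\<^sub>R s) \<partial>lborel)"
      using s by simp
    finally show ?thesis .
  qed
  have le: "\<bar>f y * k w\<bar> \<le> \<bar>f y\<bar>" for y w
    using mult_left_mono[OF k(2)[of w], of "\<bar>f y\<bar>"] k(1)[of w] by (simp add: abs_mult)
  have int: "integrable lborel (\<lambda>y. f y * k ((y - x) /\<^sub>R s))" for x
    by (rule Bochner_Integration.integrable_bound[OF f]) (auto simp: le)
  have "integrable (\<nu> \<Otimes>\<^sub>M lborel) (\<lambda>(x, y). f y * k ((y - x) /\<^sub>R s))"
  proof (rule Fubini_integrable)
    show "integrable \<nu> (\<lambda>x. \<integral>y. norm (case (x, y) of (x, y) \<Rightarrow> f y * k ((y - x) /\<^sub>R s)) \<partial>lborel)"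
    proof (rule \<nu>.integrable_const_bound[of _ "\<integral>y. \<bar>f y\<bar> \<partial>lborel"])
      have "(\<integral>y. \<bar>f y * k ((y - x) /\<^sub>R s)\<bar> \<partial>lborel) \<le> (\<integral>y. \<bar>f y\<bar> \<partial>lborel)" for x
        using int f le by (intro integral_mono) auto
      then show "AE x in \<nu>. norm (\<integral>y. norm (case (x, y) of (x, y) \<Rightarrow> f y * k ((y - x) /\<^sub>R s)) \<partial>lborel) \<le> (\<integral>y. \<bar>f y\<bar> \<partial>lborel)"
        by simp
    qed measurable
  qed (use int in auto)
  then have swap: "(\<integral>y. (\<integral>x. f y * k ((y - x) /\<^sub>R s) \<partial>\<nu>) \<partial>lborel) = (\<integral>x. (\<integral>y. f y * k ((y - x) /\<^sub>R s) \<partial>lborel) \<partial>\<nu>)"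
    by (rule Fubini_integral)
  show ?thesis
    unfolding inner k_def[symmetric] using swap by (simp add: c_def)
qed

lemma std_gauss_smoothing_close:
  fixes f :: "'b::euclidean_space \<Rightarrow> real"
  assumes f: "continuous_on UNIV f" "\<And>x. norm x \<ge> r \<Longrightarrow> f x = 0" and e: "e > 0"
  shows "\<exists>s>0. \<forall>x. \<bar>(\<integral>v. f (x + s *\<^sub>R v) \<partial>std_gauss) - f x\<bar> \<le> e"
proof -
  interpret prob_space "std_gauss :: 'b measure" by (rule prob_space_std_gauss)
  obtain K where K: "\<And>x. \<bar>f x\<bar> \<le> K" "K > 0"
    using compact_support_bounded[OF f] by auto
  have [measurable]: "f \<in> borel_measurable borel"
    using f(1) by (rule borel_measurable_continuous_onI)
  have "uniformly_continuous_on UNIV f"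
    using f by (rule compact_support_uniformly_continuous)
  then obtain d where d: "d > 0" "\<And>x x'. dist x' x < d \<Longrightarrow> dist (f x') (f x) < e / 2"
    using e unfolding uniformly_continuous_on_def by (metis UNIV_I half_gt_zero)
  have "\<forall>\<^sub>F j in sequentially. (\<integral>x. cutoff j x \<partial>(std_gauss :: 'b measure)) > 1 - e / (4 * K)"
    by (rule order_tendstoD(1)[OF integral_cutoff_tendsto[OF prob_space_std_gauss sets_std_gauss]])
       (use e K in auto)
  then obtain j where j: "(\<integral>x. cutoff j x \<partial>(std_gauss :: 'b measure)) > 1 - e / (4 * K)"
    by (meson eventually_sequentially order_refl)
  \<comment> \<open>Wherever \<open>cutoff j v\<close> is nonzero, the displacement
    \<open>s *\<^sub>R v\<close> is then shorter than the modulus of continuity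
    \<open>d\<close>.\<close>
  define s where "s = d / (real j + 1)"
  have s: "s > 0" using d by (simp add: s_def)
  have i1: "integrable std_gauss (\<lambda>v. f (x + s *\<^sub>R v))" for x
    using K by (intro integrable_const_bound[of _ K]) auto
  have i2: "integrable (std_gauss :: 'b measure) (cutoff j)"
    by (intro integrable_const_bound[of _ 1]) (auto simp: cutoff_bounds)
  have "\<bar>(\<integral>v. f (x + s *\<^sub>R v) \<partial>std_gauss) - f x\<bar> \<le> e" for x
  proof -
    have "(\<integral>v. f (x + s *\<^sub>R v) \<partial>std_gauss) - f x = (\<integral>v. f (x + s *\<^sub>R v) - f x \<partial>std_gauss)"
      using i1 prob_space by simp
    also have "\<bar>\<dots>\<bar> \<le> (\<integral>v. \<bar>f (x + s *\<^sub>R v) - f x\<bar> \<partial>std_gauss)"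
      using integral_norm_bound[of "std_gauss" "\<lambda>v. f (x + s *\<^sub>R v) - f x"] by simp
    also have "\<dots> \<le> (\<integral>v. e / 2 + 2 * K * (1 - cutoff j v) \<partial>(std_gauss :: 'b measure))"
    proof (rule integral_mono)
      fix v :: 'b
      show "\<bar>f (x + s *\<^sub>R v) - f x\<bar> \<le> e / 2 + 2 * K * (1 - cutoff j v)"
      proof (cases "norm v < real j + 1")
        case True
        then have "dist (x + s *\<^sub>R v) x < d"
          using mult_strict_left_mono[OF True d(1)] d(1) by (simp add: dist_norm s_def field_simps)
        then have "\<bar>f (x + s *\<^sub>R v) - f x\<bar> < e / 2"
          using d(2) by (simp add: dist_real_def)
        moreover have "0 \<le> 2 * K * (1 - cutoff j v)"
          using K cutoff_bounds(2)[of j v] by simp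
        ultimately show ?thesis by linarith
      next
        case False
        then have "cutoff j v = 0" by (intro cutoff_eq_0) simp
        then show ?thesis using K(1)[of "x + s *\<^sub>R v"] K(1)[of x] e by simp
      qed
    qed (use i1 i2 in auto)
    also have "\<dots> = e / 2 + 2 * K * (1 - (\<integral>v. cutoff j v \<partial>(std_gauss :: 'b measure)))"
      using i2 prob_space by simp
    also have "\<dots> \<le> e / 2 + 2 * K * (e / (4 * K))"
      using j K by (intro add_left_mono mult_left_mono) auto
    also have "\<dots> = e" using K by simp
    finally show ?thesis .
  qed
  with s show ?thesis by blast
qed

text \<open>Smoothing takes the role of Fourier inversion. Replacing \<open>f\<close> by its
  smoothing costs at most \<open>e / 4\<close> under either law. The smoothed integrals converge by
  two dominated convergences: over the frequency \<open>u\<close>, where integrands are bounded by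
  1, and over \<open>y\<close>, with majorant \<open>\<bar>f y\<bar>\<close>, integrable by compact
  support.\<close>

lemma (in prob_space) continuity_theorem_compact_support:
  fixes X :: "nat \<Rightarrow> 'a \<Rightarrow> 'b::euclidean_space" and f :: "'b \<Rightarrow> real"
  assumes [measurable]: "\<And>n. X n \<in> borel_measurable M"
    and \<mu>: "prob_space \<mu>" and sets_\<mu>[simp, measurable_cong]: "sets \<mu> = sets borel"
    and char: "\<And>u. (\<lambda>n. CLINT \<omega>|M. iexp (u \<bullet> X n \<omega>)) \<longlonglongrightarrow> (CLINT x|\<mu>. iexp (u \<bullet> x))"
    and f: "continuous_on UNIV f" "\<And>x. norm x \<ge> r \<Longrightarrow> f x = 0"
  shows "(\<lambda>n. expectation (\<lambda>\<omega>. f (X n \<omega>))) \<longlonglongrightarrow> (\<integral>x. f x \<partial>\<mu>)"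
proof (rule LIMSEQ_I)
  fix e :: real assume e: "e > 0"
  obtain K where K: "\<And>x. \<bar>f x\<bar> \<le> K" "K > 0"
    using compact_support_bounded[OF f] by auto
  have f_meas[measurable]: "f \<in> borel_measurable borel"
    using f(1) by (rule borel_measurable_continuous_onI)
  obtain s where s: "s > 0" and close: "\<And>x. \<bar>(\<integral>v. f (x + s *\<^sub>R v) \<partial>std_gauss) - f x\<bar> \<le> e / 4"
    using std_gauss_smoothing_close[OF f, where e = "e / 4"] e by auto
  have int_f: "integrable lborel f"
  proof -
    have "integrable lborel (\<lambda>x. indicator (cball 0 r) x *\<^sub>R f x)"
      by (rule borel_integrable_compact) (auto intro: continuous_on_subset[OF f(1)])
    also have "(\<lambda>x. indicator (cball 0 r) x *\<^sub>R f x) = f"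
      using f(2) by (auto simp: indicator_def fun_eq_iff)
    finally show ?thesis .
  qed
  define S where "S x = (\<integral>v. f (x + s *\<^sub>R v) \<partial>std_gauss)" for x
  interpret \<gamma>: prob_space "std_gauss :: 'b measure" by (rule prob_space_std_gauss)
  have [measurable]: "S \<in> borel_measurable borel" unfolding S_def by measurable
  \<comment> \<open>Up to the constant \<open>c\<close> below, the density of \<open>\<nu>\<close>
    convolved with a centred Gaussian of scale \<open>s\<close>.\<close>
  define H where "H \<nu> y = (\<integral>x. exp (- (((y - x) /\<^sub>R s) \<bullet> ((y - x) /\<^sub>R s)) / 2) \<partial>\<nu>)" for \<nu> :: "'b measure" and y
  define \<nu> where "\<nu> n = distr M borel (X n)" for n
  have \<nu>: "prob_space (\<nu> n)" "sets (\<nu> n) = sets borel" for n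
    unfolding \<nu>_def by (auto intro: prob_space_distr)
  note [measurable_cong] = \<nu>(2)
  have H_meas[measurable]: "H \<nu>' \<in> borel_measurable borel"
    if "prob_space \<nu>'" and [measurable_cong]: "sets \<nu>' = sets borel" for \<nu>'
  proof -
    interpret N: prob_space \<nu>' by fact
    show ?thesis unfolding H_def by measurable
  qed
  have H_bd: "\<bar>H \<nu>' y\<bar> \<le> 1" if "prob_space \<nu>'" and [measurable_cong]: "sets \<nu>' = sets borel" for \<nu>' y
  proof -
    interpret N: prob_space \<nu>' by fact
    have "H \<nu>' y \<le> (\<integral>x. 1 \<partial>\<nu>')"
      unfolding H_def by (intro integral_mono N.integrable_const_bound[of _ 1])
        (auto simp del: inner_scaleR_left inner_scaleR_right)
    moreover have "0 \<le> H \<nu>' y" unfolding H_def by simp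
    ultimately show ?thesis using N.prob_space by simp
  qed
  have H_lim: "(\<lambda>n. H (\<nu> n) y) \<longlonglongrightarrow> H \<mu> y" for y
  proof -
    have "(\<lambda>n. complex_of_real (H (\<nu> n) y)) \<longlonglongrightarrow> complex_of_real (H \<mu> y)"
      unfolding H_def char_smoothing[OF \<nu>] char_smoothing[OF \<mu> sets_\<mu>]
    proof (rule integral_dominated_convergence[where w = "\<lambda>_. 1"])
      show "AE u in std_gauss. (\<lambda>n. iexp ((y /\<^sub>R s) \<bullet> u) * (CLINT x|\<nu> n. iexp ((- u /\<^sub>R s) \<bullet> x)))
          \<longlonglongrightarrow> iexp ((y /\<^sub>R s) \<bullet> u) * (CLINT x|\<mu>. iexp ((- u /\<^sub>R s) \<bullet> x))"
      proof (intro AE_I2 tendsto_mult tendsto_const)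
        fix u
        show "(\<lambda>n. CLINT x|\<nu> n. iexp ((- u /\<^sub>R s) \<bullet> x)) \<longlonglongrightarrow> (CLINT x|\<mu>. iexp ((- u /\<^sub>R s) \<bullet> x))"
          unfolding \<nu>_def using char[of "- u /\<^sub>R s"] by (simp add: integral_distr)
      qed
      show "AE u in std_gauss. cmod (iexp ((y /\<^sub>R s) \<bullet> u) * (CLINT x|\<nu> n. iexp ((- u /\<^sub>R s) \<bullet> x))) \<le> 1" for n
      proof (rule AE_I2)
        fix u
        interpret N: prob_space "\<nu> n" by (rule \<nu>)
        have "cmod (CLINT x|\<nu> n. iexp ((- u /\<^sub>R s) \<bullet> x)) \<le> (\<integral>x. cmod (iexp ((- u /\<^sub>R s) \<bullet> x)) \<partial>\<nu> n)"
          by (rule integral_norm_bound)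
        also have "\<dots> = 1" by (simp add: N.prob_space)
        finally show "cmod (iexp ((y /\<^sub>R s) \<bullet> u) * (CLINT x|\<nu> n. iexp ((- u /\<^sub>R s) \<bullet> x))) \<le> 1"
          by (simp add: norm_mult)
      qed
      interpret \<mu>: prob_space \<mu> by fact
      show "(\<lambda>u. iexp ((y /\<^sub>R s) \<bullet> u) * (CLINT x|\<mu>. iexp ((- u /\<^sub>R s) \<bullet> x))) \<in> borel_measurable std_gauss"
        by measurable
      show "(\<lambda>u. iexp ((y /\<^sub>R s) \<bullet> u) * (CLINT x|\<nu> n. iexp ((- u /\<^sub>R s) \<bullet> x))) \<in> borel_measurable std_gauss" for n
      proof -
        interpret N: prob_space "\<nu> n" by (rule \<nu>)
        show ?thesis by measurable
      qed
    qed auto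
    then show ?thesis by (rule tendsto_of_real_iff[THEN iffD1])
  qed
  define c where "c = 1 / (sqrt ((2 * pi) ^ DIM('b)) * s ^ DIM('b))"
  have "(\<lambda>n. c * (\<integral>y. f y * H (\<nu> n) y \<partial>lborel)) \<longlonglongrightarrow> c * (\<integral>y. f y * H \<mu> y \<partial>lborel)"
  proof (intro tendsto_mult tendsto_const integral_dominated_convergence[where w = "\<lambda>y. \<bar>f y\<bar>"])
    show "AE y in lborel. (\<lambda>n. f y * H (\<nu> n) y) \<longlonglongrightarrow> f y * H \<mu> y"
      by (intro AE_I2 tendsto_mult tendsto_const H_lim)
    show "AE y in lborel. norm (f y * H (\<nu> n) y) \<le> \<bar>f y\<bar>" for n
      using mult_left_mono[OF H_bd[OF \<nu>]] by (auto simp: abs_mult)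
    show "(\<lambda>y. f y * H \<mu> y) \<in> borel_measurable lborel" "(\<lambda>y. f y * H (\<nu> n) y) \<in> borel_measurable lborel" for n
      using H_meas[OF \<nu>] H_meas[OF \<mu> sets_\<mu>] by measurable
  qed (use int_f in auto)
  then have S_lim: "(\<lambda>n. \<integral>x. S x \<partial>\<nu> n) \<longlonglongrightarrow> (\<integral>x. S x \<partial>\<mu>)"
    unfolding S_def H_def c_def
    by (simp only: integral_smoothing[OF \<nu> int_f s] integral_smoothing[OF \<mu> sets_\<mu> int_f s])
  have S_close: "\<bar>(\<integral>x. S x \<partial>\<nu>') - (\<integral>x. f x \<partial>\<nu>')\<bar> \<le> e / 4"
    if "prob_space \<nu>'" and [measurable_cong]: "sets \<nu>' = sets borel" for \<nu>'
  proof -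
    interpret N: prob_space \<nu>' by fact
    have i1: "integrable \<nu>' f" using K by (intro N.integrable_const_bound[of _ K]) auto
    have "\<bar>S x\<bar> \<le> K + e / 4" for x
      using close[of x] K(1)[of x] unfolding S_def by linarith
    then have i2: "integrable \<nu>' S" by (intro N.integrable_const_bound[of _ "K + e / 4"]) auto
    have "\<bar>(\<integral>x. S x \<partial>\<nu>') - (\<integral>x. f x \<partial>\<nu>')\<bar> = \<bar>\<integral>x. S x - f x \<partial>\<nu>'\<bar>"
      using i1 i2 by simp
    also have "\<dots> \<le> (\<integral>x. \<bar>S x - f x\<bar> \<partial>\<nu>')"
      using integral_norm_bound[of \<nu>' "\<lambda>x. S x - f x"] by simp
    also have "\<dots> \<le> (\<integral>x. e / 4 \<partial>\<nu>')"
      using i1 i2 close by (intro integral_mono) (auto simp: S_def[symmetric])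
    finally show ?thesis by (simp add: N.prob_space)
  qed
  have "\<forall>\<^sub>F n in sequentially. dist (\<integral>x. S x \<partial>\<nu> n) (\<integral>x. S x \<partial>\<mu>) < e / 4"
    by (rule tendstoD[OF S_lim]) (use e in simp)
  then have "\<forall>\<^sub>F n in sequentially. norm (expectation (\<lambda>\<omega>. f (X n \<omega>)) - (\<integral>x. f x \<partial>\<mu>)) < e"
  proof eventually_elim
    case (elim n)
    have "expectation (\<lambda>\<omega>. f (X n \<omega>)) = (\<integral>x. f x \<partial>\<nu> n)"
      unfolding \<nu>_def by (simp add: integral_distr)
    then show ?case
      using S_close[OF \<nu>, of n] S_close[OF \<mu> sets_\<mu>] elim e unfolding dist_real_def real_norm_def by linarith
  qed
  then show "\<exists>no. \<forall>n\<ge>no. norm (expectation (\<lambda>\<omega>. f (X n \<omega>)) - (\<integral>x. f x \<partial>\<mu>)) < e"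
    by (simp add: eventually_sequentially)
qed

section \<open>Gaussian vectors and the multivariate central limit theorem\<close>

lemma Basis_cart: "(Basis :: (real^'n) set) = range (\<lambda>i. axis i 1)"
  by (auto simp: Basis_vec_def)

lemma prod_Basis_axis: "prod g (Basis :: (real^'n) set) = (\<Prod>i\<in>UNIV. g (axis i 1))"
proof -
  have "inj (\<lambda>i::'n. axis i (1::real))"
    by (auto simp: inj_on_def axis_eq_axis)
  then show ?thesis unfolding Basis_cart by (subst prod.reindex) auto
qed

lemma prod_Basis_cart: "(\<Prod>b\<in>Basis. g ((x::real^'n) \<bullet> b)) = (\<Prod>i\<in>UNIV. g (x $ i))"
  by (simp add: prod_Basis_axis inner_axis)

lemma inner_matrix_vector_transpose:
  "((A::real^'n^'m) *v x) \<bullet> y = x \<bullet> (transpose A *v y)"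
  by (metis dot_lmul_matrix inner_commute transpose_matrix_vector)

section \<open>Linear change of variables for Lebesgue measure\<close>

lemma nn_integral_lborel_shear:
  fixes m n :: "'b::euclidean_space"
  assumes mn: "m \<in> Basis" "n \<in> Basis" "m \<noteq> n" and [measurable]: "g \<in> borel_measurable borel"
  shows "(\<integral>\<^sup>+x. g (x + (c * (x \<bullet> n)) *\<^sub>R m) \<partial>lborel) = (\<integral>\<^sup>+x. g x \<partial>lborel)"
proof -
  interpret product_sigma_finite "\<lambda>_::'b. lborel :: real measure"
    by standard
  define R where "R x = (\<Sum>b\<in>Basis - {m}. x b *\<^sub>R b)" for x :: "'b \<Rightarrow> real"
  have split: "(\<Sum>b\<in>Basis. (x(m := y)) b *\<^sub>R b) = y *\<^sub>R m + R x" for x y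
    using mn by (subst sum.remove[of _ m]) (auto simp: R_def intro!: sum.cong)
  have B: "insert m (Basis - {m}) = Basis" using mn by auto
  \<comment> \<open>Fubini with the coordinate along \<open>m\<close> innermost. With the other
    coordinates fixed, the shear merely translates it, because \<open>x \<bullet> n\<close> does not
    depend on it.\<close>
  have red: "(\<integral>\<^sup>+x. h x \<partial>lborel) =
      (\<integral>\<^sup>+x. (\<integral>\<^sup>+y. h (y *\<^sub>R m + R x) \<partial>lborel) \<partial>Pi\<^sub>M (Basis - {m}) (\<lambda>_. lborel))"
    if [measurable]: "h \<in> borel_measurable borel" for h :: "'b \<Rightarrow> ennreal"
  proof -
    have "(\<integral>\<^sup>+x. h x \<partial>lborel) = (\<integral>\<^sup>+f. h (\<Sum>b\<in>Basis. f b *\<^sub>R b) \<partial>Pi\<^sub>M (insert m (Basis - {m})) (\<lambda>_. lborel))"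
      unfolding lborel_eq[where ?'a='b] B by (rule nn_integral_distr) auto
    also have "\<dots> = (\<integral>\<^sup>+x. (\<integral>\<^sup>+y. h (\<Sum>b\<in>Basis. (x(m := y)) b *\<^sub>R b) \<partial>lborel) \<partial>Pi\<^sub>M (Basis - {m}) (\<lambda>_. lborel))"
      by (rule product_nn_integral_insert) (auto simp: B)
    finally show ?thesis by (simp only: split)
  qed
  have "n \<bullet> m = 0" using mn by (simp add: inner_not_same_Basis)
  have shift: "(y *\<^sub>R m + R x) + (c * ((y *\<^sub>R m + R x) \<bullet> n)) *\<^sub>R m = (c * (R x \<bullet> n) + 1 * y) *\<^sub>R m + R x" for x y
    using mn \<open>n \<bullet> m = 0\<close> by (simp add: inner_add_left scaleR_add_left inner_commute[of m n])
  have "(\<integral>\<^sup>+y. g (y *\<^sub>R m + R x) \<partial>lborel) = (\<integral>\<^sup>+y. g ((c * (R x \<bullet> n) + 1 * y) *\<^sub>R m + R x) \<partial>lborel)" for x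
    by (subst nn_integral_real_affine[where c = 1 and t = "c * (R x \<bullet> n)"]) auto
  then show ?thesis
    by (simp add: red shift del: mult_1)
qed

text \<open>The preimage of a box is a box with permuted side lengths, and Lebesgue measure is
  determined by its values on boxes.\<close>

lemma nn_integral_lborel_permute:
  fixes g :: "real^'n \<Rightarrow> ennreal"
  assumes p: "p permutes UNIV" and [measurable]: "g \<in> borel_measurable borel"
  shows "(\<integral>\<^sup>+x. g (\<chi> i. x $ p i) \<partial>lborel) = (\<integral>\<^sup>+x. g x \<partial>lborel)"
proof -
  have bij: "bij p" using p by (rule permutes_bij)
  have T[measurable]: "(\<lambda>x::real^'n. \<chi> i. x $ p i) \<in> borel_measurable borel"
    by (intro borel_measurable_continuous_onI continuous_intros)
  have "lborel = distr lborel borel (\<lambda>x::real^'n. \<chi> i. x $ p i)"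
  proof (rule lborel_eqI)
    fix l u :: "real^'n" assume le: "\<And>b. b \<in> Basis \<Longrightarrow> l \<bullet> b \<le> u \<bullet> b"
    then have le': "l $ i \<le> u $ i" for i
      by (metis axis_in_Basis_iff cart_eq_inner_axis Basis_real_def insertI1)
    have "(\<lambda>x. \<chi> i. x $ p i) -` box l u = box (\<chi> i. l $ inv p i) (\<chi> i. u $ inv p i)"
    proof (rule set_eqI)
      fix x
      have "(\<forall>i. P (p i) i) \<longleftrightarrow> (\<forall>i. P i (inv p i))" for P
        using bij by (metis bij_inv_eq_iff)
      from this[of "\<lambda>a i. l $ i < x $ a \<and> x $ a < u $ i"]
      show "x \<in> (\<lambda>x. \<chi> i. x $ p i) -` box l u \<longleftrightarrow> x \<in> box (\<chi> i. l $ inv p i) (\<chi> i. u $ inv p i)"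
        by (simp add: mem_box_cart)
    qed
    moreover have "(\<Prod>b\<in>Basis. ((\<chi> i. u $ inv p i) - (\<chi> i. l $ inv p i)) \<bullet> b) = (\<Prod>b\<in>Basis. (u - l) \<bullet> b)"
    proof -
      have "(\<Prod>i\<in>UNIV. u $ inv p i - l $ inv p i) = (\<Prod>i\<in>UNIV. u $ i - l $ i)"
        using prod.reindex_bij_betw[OF bij_betw_inv_into[OF bij], of "\<lambda>i. u $ i - l $ i"] by simp
      then show ?thesis
        using prod_Basis_cart[of "\<lambda>t. t" "(\<chi> i. u $ inv p i) - (\<chi> i. l $ inv p i)"]
          prod_Basis_cart[of "\<lambda>t. t" "u - l"] by simp
    qed
    moreover have "\<forall>b\<in>Basis. (\<chi> i. l $ inv p i) \<bullet> b \<le> (\<chi> i. u $ inv p i) \<bullet> b"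
      using le' by (auto simp: Basis_vec_def inner_axis)
    ultimately show "emeasure (distr lborel borel (\<lambda>x. \<chi> i. x $ p i)) (box l u) = ennreal (\<Prod>b\<in>Basis. (u - l) \<bullet> b)"
      by (simp add: emeasure_distr emeasure_lborel_box_eq)
  qed simp
  then have "(\<integral>\<^sup>+x. g x \<partial>lborel) = (\<integral>\<^sup>+x. g x \<partial>distr lborel borel (\<lambda>x::real^'n. \<chi> i. x $ p i))"
    by simp
  also have "\<dots> = (\<integral>\<^sup>+x. g (\<chi> i. x $ p i) \<partial>lborel)"
    by (subst nn_integral_distr) auto
  finally show ?thesis by simp
qed

lemma borel_measurable_matrix_vector_mult[measurable]:
  "(\<lambda>x. (A::real^'n^'m) *v x) \<in> borel_measurable borel"
  by (intro borel_measurable_continuous_onI linear_continuous_on) (simp add: linear_linear)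

text \<open>Induction over products of elementary matrices. The test function is quantified inside
  because a product needs the hypothesis for \<open>\<lambda>x. g (A *v x)\<close>, and the premise
  on the determinant disposes of matrices with a zero row.\<close>

lemma nn_integral_lborel_linear:
  fixes A :: "real^'n^'n"
  shows "det A \<noteq> 0 \<longrightarrow> (\<forall>g \<in> borel_measurable borel.
    (\<integral>\<^sup>+x. g x \<partial>lborel) = ennreal \<bar>det A\<bar> * (\<integral>\<^sup>+x. g (A *v x) \<partial>lborel))"
proof (induction A rule: induct_matrix_elementary[case_names mult zero_row diagonal swap1 idplus])
  case (mult A B)
  show ?case
  proof (intro impI ballI)
    fix g :: "real^'n \<Rightarrow> ennreal"
    assume d: "det (A ** B) \<noteq> 0" and g[measurable]: "g \<in> borel_measurable borel"
    have "det A \<noteq> 0" "det B \<noteq> 0" using d by (auto simp: det_mul)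
    then have "(\<integral>\<^sup>+x. g x \<partial>lborel) = ennreal \<bar>det A\<bar> * (ennreal \<bar>det B\<bar> * (\<integral>\<^sup>+x. g (A *v (B *v x)) \<partial>lborel))"
      using mult(1)[rule_format, of g] mult(2)[rule_format, of "\<lambda>x. g (A *v x)"] by simp
    then show "(\<integral>\<^sup>+x. g x \<partial>lborel) = ennreal \<bar>det (A ** B)\<bar> * (\<integral>\<^sup>+x. g ((A ** B) *v x) \<partial>lborel)"
      by (simp add: det_mul abs_mult ennreal_mult mult.assoc matrix_vector_mul_assoc)
  qed
next
  case (zero_row A i)
  then show ?case by (simp add: det_zero_row)
next
  case (diagonal A)
  have det: "det A = (\<Prod>i\<in>UNIV. A $ i $ i)"
    using diagonal by (rule det_diagonal)
  show ?case
  proof (intro impI ballI)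
    fix g :: "real^'n \<Rightarrow> ennreal"
    assume d: "det A \<noteq> 0" and [measurable]: "g \<in> borel_measurable borel"
    \<comment> \<open>The scaling lemma \<open>lborel_affine_euclidean\<close> indexes its factors
      by basis vectors; this reads the diagonal entry off the vector
      \<open>axis i 1\<close>.\<close>
    define c where "c x = A $ (THE i. x = axis i (1::real)) $ (THE i. x = axis i (1::real))" for x :: "real^'n"
    have c: "c (axis i 1) = A $ i $ i" for i
      by (simp add: c_def axis_eq_axis)
    have nz: "c j \<noteq> 0" if "j \<in> Basis" for j
      using that d det c by (auto simp: Basis_vec_def)
    have T: "(\<Sum>j\<in>Basis. (c j * (x \<bullet> j)) *\<^sub>R j) = A *v x" for x
    proof -
      have "A *v x = (\<Sum>j\<in>Basis. ((A *v x) \<bullet> j) *\<^sub>R j)" by (simp add: euclidean_representation)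
      also have "\<dots> = (\<Sum>j\<in>Basis. (c j * (x \<bullet> j)) *\<^sub>R j)"
      proof (rule sum.cong[OF refl])
        fix j :: "real^'n" assume "j \<in> Basis"
        then obtain i where j: "j = axis i 1" by (auto simp: Basis_vec_def)
        have "(\<Sum>k\<in>UNIV. A $ i $ k * x $ k) = (\<Sum>k\<in>UNIV. if k = i then A $ i $ i * x $ i else 0)"
          using diagonal by (intro sum.cong) auto
        then show "((A *v x) \<bullet> j) *\<^sub>R j = (c j * (x \<bullet> j)) *\<^sub>R j"
          by (simp add: j c inner_axis matrix_vector_mult_def)
      qed
      finally show ?thesis by simp
    qed
    have dc: "(\<Prod>j\<in>Basis. \<bar>c j\<bar>) = \<bar>det A\<bar>"
      by (simp add: prod_Basis_axis c det abs_prod)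
    have "lborel = density (distr lborel borel (\<lambda>x. 0 + (\<Sum>j\<in>Basis. (c j * (x \<bullet> j)) *\<^sub>R j))) (\<lambda>_. (\<Prod>j\<in>Basis. \<bar>c j\<bar>))"
      using nz by (rule lborel_affine_euclidean)
    then have eq: "lborel = density (distr lborel borel (\<lambda>x. A *v x)) (\<lambda>_. ennreal \<bar>det A\<bar>)"
      unfolding T dc by simp
    show "(\<integral>\<^sup>+x. g x \<partial>lborel) = ennreal \<bar>det A\<bar> * (\<integral>\<^sup>+x. g (A *v x) \<partial>lborel)"
      by (subst eq) (simp add: nn_integral_density nn_integral_distr nn_integral_cmult)
  qed
next
  case (swap1 m n)
  let ?S = "\<chi> i j. mat 1 $ i $ Transposition.transpose m n j :: real^'n^'n"
  have p: "Transposition.transpose m n permutes UNIV"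
    by (rule permutes_swap_id) auto
  have "det ?S = of_int (sign (Transposition.transpose m n)) * det (mat 1 :: real^'n^'n)"
    by (rule det_permute_columns[OF p])
  then have d: "\<bar>det ?S\<bar> = 1" by (simp add: sign_swap_id swap1)
  have "?S *v x = (\<chi> i. x $ Transposition.transpose m n i)" for x
  proof (subst vec_eq_iff, intro allI)
    fix i
    have "(\<Sum>j\<in>UNIV. (if i = Transposition.transpose m n j then 1 else 0) * x $ j) =
        (\<Sum>j\<in>UNIV. if j = Transposition.transpose m n i then x $ j else 0)"
      by (intro sum.cong) (auto simp: transpose_eq_iff)
    then show "(?S *v x) $ i = (\<chi> i. x $ Transposition.transpose m n i) $ i"
      by (simp add: matrix_vector_mult_def mat_def)
  qed
  then show ?case
    using nn_integral_lborel_permute[OF p] d by simp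
next
  case (idplus m n c)
  let ?S = "\<chi> i j. if i = m \<and> j = n then c else of_bool (i = j) :: real^'n^'n"
  have "?S = (\<chi> k. if k = m then row m (mat 1) + c *s row n (mat 1) else row k (mat 1))"
    using idplus by (auto simp: vec_eq_iff row_def mat_def)
  then have d: "det ?S = 1"
    using det_row_operation[OF idplus, of "mat 1" c] by simp
  have "?S *v x = x + (c * (x \<bullet> axis n 1)) *\<^sub>R axis m 1" for x
  proof (subst vec_eq_iff, intro allI)
    fix i
    have "(\<Sum>j\<in>UNIV. (if i = m \<and> j = n then c else of_bool (i = j)) * x $ j) =
        (\<Sum>j\<in>UNIV. (if j = i then x $ j else 0) + (if j = n then (if i = m then c * x $ n else 0) else 0))"
      using idplus by (intro sum.cong) auto
    then show "(?S *v x) $ i = (x + (c * (x \<bullet> axis n 1)) *\<^sub>R axis m 1) $ i"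
      by (simp add: matrix_vector_mult_def sum.distrib inner_axis) (simp add: axis_def)
  qed
  moreover have "axis m (1::real) \<noteq> axis n 1" using idplus by (simp add: axis_eq_axis)
  ultimately show ?case
    using nn_integral_lborel_shear[of "axis m (1::real)" "axis n 1"] d by simp
qed

section \<open>Positive definite matrices and inverses\<close>

lemma pos_def_orthonormal_family:
  fixes P :: "real^'k^'k"
  assumes P: "pos_def P" and "n \<le> CARD('k)"
  shows "\<exists>T. finite T \<and> card T = n \<and> (\<forall>x\<in>T. \<forall>y\<in>T. x \<bullet> (P *v y) = (if x = y then 1 else 0))"
  using \<open>n \<le> CARD('k)\<close>
proof (induction n)
  case 0
  show ?case by (rule exI[of _ "{}"]) simp
next
  case (Suc n)
  have sym: "x \<bullet> (P *v y) = y \<bullet> (P *v x)" for x y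
    using P unfolding pos_def_def by (metis dot_lmul_matrix inner_commute transpose_matrix_vector)
  obtain T where T: "finite T" "card T = n" and on: "\<And>x y. x \<in> T \<Longrightarrow> y \<in> T \<Longrightarrow> x \<bullet> (P *v y) = (if x = y then 1 else 0)"
    using Suc by auto
  have "dim (span T) < DIM(real^'k)"
    using dim_le_card[of T T] T Suc.prems by (simp add: dim_span span_superset)
  then have "span T \<noteq> UNIV" using dim_UNIV[where ?'a = "real^'k"] by (metis less_irrefl)
  then obtain v where v: "v \<notin> span T" by blast
  \<comment> \<open>One step of Gram-Schmidt for the inner product
    \<open>x \<bullet> (P *v y)\<close>.\<close>
  define w where "w = v - (\<Sum>b\<in>T. (b \<bullet> (P *v v)) *\<^sub>R b)"
  have "w \<noteq> 0"
  proof
    assume "w = 0"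
    then have "v = (\<Sum>b\<in>T. (b \<bullet> (P *v v)) *\<^sub>R b)" by (simp add: w_def)
    also have "\<dots> \<in> span T" by (intro span_sum span_scale span_base)
    finally show False using v by simp
  qed
  then have pos: "w \<bullet> (P *v w) > 0" using P by (auto simp: pos_def_def)
  have orth: "a \<bullet> (P *v w) = 0" if "a \<in> T" for a
  proof -
    have "a \<bullet> (P *v w) = a \<bullet> (P *v v) - (\<Sum>b\<in>T. (b \<bullet> (P *v v)) * (a \<bullet> (P *v b)))"
      unfolding w_def
      by (simp add: matrix_vector_mult_diff_distrib inner_diff_right inner_sum_right
          matrix_vector_right_distrib linear_sum[OF matrix_vector_mul_linear] matrix_vector_mult_scaleR)
    also have "(\<Sum>b\<in>T. (b \<bullet> (P *v v)) * (a \<bullet> (P *v b))) = (\<Sum>b\<in>T. if a = b then b \<bullet> (P *v v) else 0)"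
      using on that by (intro sum.cong) auto
    finally show ?thesis using that T by simp
  qed
  define w' where "w' = w /\<^sub>R sqrt (w \<bullet> (P *v w))"
  have 1: "w' \<bullet> (P *v w') = 1"
    using pos by (simp add: w'_def matrix_vector_mult_scaleR field_simps)
  have 2: "a \<bullet> (P *v w') = 0" "w' \<bullet> (P *v a) = 0" if "a \<in> T" for a
    using orth[OF that] sym[of w' a] by (simp_all add: w'_def matrix_vector_mult_scaleR)
  have "w' \<notin> T" using 1 2 by force
  then show ?case
    using T on 1 2 by (intro exI[of _ "insert w' T"]) auto
qed

text \<open>The columns of \<open>B\<close> are a full family orthonormal for the inner product of
  \<open>P\<close>; the identity is the Gram matrix of that family.\<close>

lemma pos_def_diagonalize:
  fixes P :: "real^'k^'k"
  assumes "pos_def P"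
  obtains B :: "real^'k^'k" where "transpose B ** P ** B = mat 1"
proof -
  obtain T where T: "finite T" "card T = CARD('k)" and on: "\<And>x y. x \<in> T \<Longrightarrow> y \<in> T \<Longrightarrow> x \<bullet> (P *v y) = (if x = y then 1 else 0)"
    using pos_def_orthonormal_family[OF assms order_refl] by auto
  then obtain e where e: "bij_betw e (UNIV :: 'k set) T"
    using finite_same_card_bij[of "UNIV :: 'k set" T] by auto
  define B where "B = (\<chi> i j. e j $ i)"
  have "(transpose B ** P ** B) $ i $ j = e i \<bullet> (P *v e j)" for i j
    unfolding matrix_mul_assoc[symmetric]
    by (simp add: B_def matrix_matrix_mult_def transpose_def inner_vec_def matrix_vector_mult_def)
  moreover have "e i \<bullet> (P *v e j) = (if i = j then 1 else 0)" for i j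
    using on[of "e i" "e j"] e by (auto simp: bij_betw_def inj_on_def)
  ultimately have "transpose B ** P ** B = mat 1"
    by (simp add: vec_eq_iff mat_def)
  then show ?thesis by (rule that)
qed

lemma pos_def_det_pos:
  assumes "pos_def (P :: real^'k^'k)"
  shows "det P > 0"
proof -
  obtain B :: "real^'k^'k" where "transpose B ** P ** B = mat 1"
    using assms by (rule pos_def_diagonalize)
  then have "det (transpose B ** P ** B) = 1" by simp
  then have "(det B)\<^sup>2 * det P = 1" by (simp add: det_mul power2_eq_square mult.commute mult.left_commute)
  then show ?thesis
    by (metis mult_less_0_iff not_less zero_less_one zero_le_power2 mult_nonneg_nonpos not_one_le_zero)
qed

lemma matrix_inv_mult:
  assumes "invertible (A :: real^'n^'n)"
  shows "A ** matrix_inv A = mat 1" "matrix_inv A ** A = mat 1"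
  using assms unfolding invertible_def matrix_inv_def
  by (metis (mono_tags, lifting) someI_ex)+

lemma matrix_inv_unique:
  assumes "A ** B = mat 1"
  shows "matrix_inv (A :: real^'n^'n) = B"
proof -
  have "B ** A = mat 1" using assms by (rule matrix_left_right_inverse[THEN iffD1])
  then have inv: "invertible A" using assms unfolding invertible_def by blast
  have "matrix_inv A = matrix_inv A ** (A ** B)" by (simp add: assms)
  also have "\<dots> = B" by (simp add: matrix_mul_assoc matrix_inv_mult[OF inv])
  finally show ?thesis .
qed

lemma invertible_pos_def: "pos_def (P :: real^'k^'k) \<Longrightarrow> invertible P"
  using pos_def_det_pos[of P] by (simp add: invertible_det_nz)

lemma matrix_inv_matrix_inv:
  "invertible (A :: real^'n^'n) \<Longrightarrow> matrix_inv (matrix_inv A) = A"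
  by (rule matrix_inv_unique) (rule matrix_inv_mult)

lemma transpose_matrix_inv:
  assumes "invertible (A :: real^'n^'n)" "transpose A = A"
  shows "transpose (matrix_inv A) = matrix_inv A"
proof -
  have "A ** transpose (matrix_inv A) = transpose (matrix_inv A ** A)"
    by (simp add: matrix_transpose_mul assms)
  then show ?thesis using assms matrix_inv_mult by (metis matrix_inv_unique transpose_mat)
qed

lemma pos_def_matrix_inv:
  assumes P: "pos_def (P :: real^'k^'k)"
  shows "pos_def (matrix_inv P)"
  unfolding pos_def_def
proof (intro conjI allI impI)
  have inv: "invertible P" using P by (rule invertible_pos_def)
  have sym: "transpose P = P" using P by (simp add: pos_def_def)
  show "transpose (matrix_inv P) = matrix_inv P"
    using inv sym by (rule transpose_matrix_inv)
  fix v :: "real^'k" assume "v \<noteq> 0"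
  define u where "u = matrix_inv P *v v"
  have v: "P *v u = v" by (simp add: u_def matrix_vector_mul_assoc matrix_inv_mult[OF inv])
  then have "u \<noteq> 0" using \<open>v \<noteq> 0\<close> by auto
  then have "u \<bullet> (P *v u) > 0" using P by (auto simp: pos_def_def)
  then show "v \<bullet> (matrix_inv P *v v) > 0"
    unfolding v u_def[symmetric] by (simp add: inner_commute)
qed

section \<open>The Gaussian law as a linear image of the standard one\<close>

lemma multi_normal_eq_distr:
  fixes \<Sigma> :: "real^'k^'k"
  assumes S: "pos_def \<Sigma>"
  shows "\<exists>B :: real^'k^'k. B ** transpose B = \<Sigma> \<and> multi_normal 0 \<Sigma> = distr std_gauss borel (\<lambda>v. B *v v)"
proof -
  define Q where "Q = matrix_inv \<Sigma>"
  have Q: "pos_def Q" unfolding Q_def using S by (rule pos_def_matrix_inv)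
  obtain B :: "real^'k^'k" where B: "transpose B ** Q ** B = mat 1"
    using Q by (rule pos_def_diagonalize)
  \<comment> \<open>Cycling the factors around the identity matrix exhibits \<open>B\<close> as a
    square root of \<open>\<Sigma>\<close>. The substitution \<open>x = B *v v\<close> then turns
    the exponent of the density into that of the standard Gaussian, and
    \<open>\<bar>det B\<bar>\<close> cancels the square root of \<open>det \<Sigma>\<close>.\<close>
  have "B ** (transpose B ** Q) = mat 1"
    using B by (rule matrix_left_right_inverse[THEN iffD1])
  then have "Q ** (B ** transpose B) = mat 1"
    by (metis matrix_left_right_inverse matrix_mul_assoc)
  then have "matrix_inv Q = B ** transpose B" by (rule matrix_inv_unique)
  then have BB: "B ** transpose B = \<Sigma>"
    by (simp add: Q_def matrix_inv_matrix_inv invertible_pos_def S)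
  have det: "det \<Sigma> = (det B)\<^sup>2"
    by (simp add: BB[symmetric] det_mul power2_eq_square)
  have "det B \<noteq> 0"
    using pos_def_det_pos[OF S] det by auto
  define h where "h x = exp (- (x \<bullet> (Q *v x)) / 2) / sqrt ((2 * pi) ^ CARD('k) * det \<Sigma>)" for x
  have [measurable]: "h \<in> borel_measurable borel" unfolding h_def by measurable
  have h: "\<bar>det B\<bar> * h (B *v v) = (\<Prod>b\<in>Basis. std_normal_density (v \<bullet> b))" for v
  proof -
    have "(B *v v) \<bullet> (Q *v (B *v v)) = v \<bullet> ((transpose B ** Q ** B) *v v)"
      by (simp add: inner_matrix_vector_transpose matrix_vector_mul_assoc matrix_mul_assoc)
    also have "\<dots> = v \<bullet> v" by (simp add: B)
    finally show ?thesis
      using \<open>det B \<noteq> 0\<close> by (simp add: h_def prod_std_normal_density det real_sqrt_mult)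
  qed
  have "multi_normal 0 \<Sigma> = distr std_gauss borel (\<lambda>v. B *v v)"
  proof (rule measure_eqI)
    show "sets (multi_normal 0 \<Sigma>) = sets (distr std_gauss borel (\<lambda>v. B *v v))"
      by (simp add: multi_normal_def)
    fix A assume "A \<in> sets (multi_normal 0 \<Sigma>)"
    then have A[measurable]: "A \<in> sets borel" by (simp add: multi_normal_def)
    have mn: "multi_normal 0 \<Sigma> = density lborel (\<lambda>x. ennreal (h x))"
      by (simp add: multi_normal_def h_def[abs_def] Q_def)
    have "emeasure (multi_normal 0 \<Sigma>) A = (\<integral>\<^sup>+x. ennreal (h x) * indicator A x \<partial>lborel)"
      unfolding mn by (subst emeasure_density) auto
    also have "\<dots> = ennreal \<bar>det B\<bar> * (\<integral>\<^sup>+x. ennreal (h (B *v x)) * indicator A (B *v x) \<partial>lborel)"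
      by (rule nn_integral_lborel_linear[rule_format, OF \<open>det B \<noteq> 0\<close>]) measurable
    also have "\<dots> = (\<integral>\<^sup>+x. ennreal \<bar>det B\<bar> * (ennreal (h (B *v x)) * indicator A (B *v x)) \<partial>lborel)"
      by (rule nn_integral_cmult[symmetric]) measurable
    also have "\<dots> = (\<integral>\<^sup>+x. ennreal (\<Prod>b\<in>Basis. std_normal_density (x \<bullet> b)) * indicator ((\<lambda>v. B *v v) -` A) x \<partial>lborel)"
      by (intro nn_integral_cong) (simp add: h[symmetric] ennreal_mult' mult.assoc indicator_def)
    also have "\<dots> = emeasure (distr std_gauss borel (\<lambda>v. B *v v)) A"
      unfolding std_gauss_def using measurable_sets[OF borel_measurable_matrix_vector_mult A, of B]
      by (subst emeasure_distr, simp, simp, subst emeasure_density) (auto simp del: prod_std_normal_density)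
    finally show "emeasure (multi_normal 0 \<Sigma>) A = emeasure (distr std_gauss borel (\<lambda>v. B *v v)) A" .
  qed
  with BB show ?thesis by blast
qed

lemma
  fixes \<Sigma> :: "real^'k^'k"
  assumes "pos_def \<Sigma>"
  shows prob_space_multi_normal: "prob_space (multi_normal 0 \<Sigma>)"
    and char_multi_normal: "(CLINT x|multi_normal 0 \<Sigma>. iexp (u \<bullet> x)) = complex_of_real (exp (- (u \<bullet> (\<Sigma> *v u)) / 2))"
proof -
  obtain B :: "real^'k^'k" where B: "B ** transpose B = \<Sigma>" "multi_normal 0 \<Sigma> = distr std_gauss borel (\<lambda>v. B *v v)"
    using multi_normal_eq_distr[OF assms] by auto
  interpret prob_space "std_gauss :: (real^'k) measure" by (rule prob_space_std_gauss)
  show "prob_space (multi_normal 0 \<Sigma>)"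
    unfolding B(2) by (rule prob_space_distr) measurable
  have "(CLINT x|multi_normal 0 \<Sigma>. iexp (u \<bullet> x)) = (CLINT x|std_gauss. iexp (u \<bullet> (B *v x)))"
    unfolding B(2) by (rule integral_distr) measurable
  also have "\<dots> = (CLINT x|std_gauss. iexp ((transpose B *v u) \<bullet> x))"
    by (simp add: dot_lmul_matrix[symmetric])
  also have "\<dots> = complex_of_real (exp (- ((transpose B *v u) \<bullet> (transpose B *v u)) / 2))"
    by (rule char_std_gauss)
  also have "(transpose B *v u) \<bullet> (transpose B *v u) = u \<bullet> (\<Sigma> *v u)"
    by (simp add: B(1)[symmetric] matrix_vector_mul_assoc[symmetric] dot_lmul_matrix[symmetric])
  finally show "(CLINT x|multi_normal 0 \<Sigma>. iexp (u \<bullet> x)) = complex_of_real (exp (- (u \<bullet> (\<Sigma> *v u)) / 2))" .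
qed

lemma sets_multi_normal[simp]: "sets (multi_normal m \<Sigma>) = sets borel"
  by (simp add: multi_normal_def)

section \<open>The multivariate central limit theorem\<close>

lemma (in prob_space) central_limit_theorem_multi:
  fixes \<xi> :: "nat \<Rightarrow> 'a \<Rightarrow> real^'k" and f :: "real^'k \<Rightarrow> real"
  assumes indep: "indep_vars (\<lambda>_. borel) \<xi> UNIV"
    and ident: "\<And>t. distr M borel (\<xi> t) = distr M borel (\<xi> 0)"
    and sq: "\<And>u. integrable M (\<lambda>\<omega>. (u \<bullet> \<xi> 0 \<omega>)\<^sup>2)"
    and mean: "\<And>u. expectation (\<lambda>\<omega>. u \<bullet> \<xi> 0 \<omega>) = 0"
    and cov: "\<And>u. expectation (\<lambda>\<omega>. (u \<bullet> \<xi> 0 \<omega>)\<^sup>2) = u \<bullet> (\<Sigma> *v u)"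
    and \<Sigma>: "pos_def \<Sigma>"
    and f: "continuous_on UNIV f" "\<And>x. norm x \<ge> r \<Longrightarrow> f x = 0"
  shows "(\<lambda>n. expectation (\<lambda>\<omega>. f ((1 / sqrt (real n)) *\<^sub>R (\<Sum>t=1..n. \<xi> t \<omega>)))) \<longlonglongrightarrow> (\<integral>x. f x \<partial>multi_normal 0 \<Sigma>)"
proof (rule continuity_theorem_compact_support[OF _ prob_space_multi_normal[OF \<Sigma>] sets_multi_normal _ f])
  have rv[measurable]: "random_variable borel (\<xi> t)" for t
    using indep unfolding indep_vars_def2 by simp
  show "random_variable borel (\<lambda>\<omega>. (1 / sqrt (real n)) *\<^sub>R (\<Sum>t=1..n. \<xi> t \<omega>))" for n
    by measurable
  fix u :: "real^'k"
  show "(\<lambda>n. CLINT \<omega>|M. iexp (u \<bullet> ((1 / sqrt (real n)) *\<^sub>R (\<Sum>t=1..n. \<xi> t \<omega>)))) \<longlonglongrightarrow>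
      (CLINT x|multi_normal 0 \<Sigma>. iexp (u \<bullet> x))"
  \<comment> \<open>Cramer-Wold: for fixed \<open>u\<close> the projections
    \<open>u \<bullet> \<xi> t \<omega>\<close> are real variables. The one-dimensional theorem
    wants a positive variance, which \<open>\<Sigma>\<close> provides for \<open>u\<close>
    nonzero.\<close>
  proof (cases "u = 0")
    case True
    then show ?thesis
      by (simp add: char_multi_normal[OF \<Sigma>, of 0, simplified] prob_space)
  next
    case False
    define X where "X t \<omega> = u \<bullet> \<xi> t \<omega>" for t \<omega>
    define \<sigma> where "\<sigma> = sqrt (u \<bullet> (\<Sigma> *v u))"
    have pos: "u \<bullet> (\<Sigma> *v u) > 0" using False \<Sigma> by (auto simp: pos_def_def)
    then have \<sigma>: "\<sigma> > 0" "\<sigma>\<^sup>2 = u \<bullet> (\<Sigma> *v u)" by (simp_all add: \<sigma>_def)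
    have [measurable]: "random_variable borel (X t)" for t unfolding X_def by measurable
    have indepX: "indep_vars (\<lambda>_. borel) X UNIV"
      unfolding X_def by (rule indep_vars_compose2[OF indep]) measurable
    have dist: "distr M borel (\<lambda>\<omega>. h (\<xi> t \<omega>)) = distr M borel (\<lambda>\<omega>. h (\<xi> 0 \<omega>))"
      if [measurable]: "h \<in> borel_measurable borel" for h :: "real^'k \<Rightarrow> real" and t
    proof -
      have "distr (distr M borel (\<xi> t)) borel h = distr (distr M borel (\<xi> 0)) borel h"
        by (simp only: ident[of t])
      then show ?thesis by (simp add: distr_distr comp_def)
    qed
    have transfer: "expectation (\<lambda>\<omega>. h (\<xi> t \<omega>)) = expectation (\<lambda>\<omega>. h (\<xi> 0 \<omega>))"
      "integrable M (\<lambda>\<omega>. h (\<xi> t \<omega>)) \<longleftrightarrow> integrable M (\<lambda>\<omega>. h (\<xi> 0 \<omega>))"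
      if [measurable]: "h \<in> borel_measurable borel" for h :: "real^'k \<Rightarrow> real" and t
      using integral_distr[OF rv[of t], of h] integral_distr[OF rv[of 0], of h]
        integrable_distr_eq[OF rv[of t], of h] integrable_distr_eq[OF rv[of 0], of h] ident[of t] by simp_all
    have mX: "expectation (X t) = 0" for t
      using transfer(1)[of "\<lambda>x. u \<bullet> x" t] mean[of u] by (simp add: X_def[abs_def])
    have sX: "integrable M (\<lambda>\<omega>. (X t \<omega>)\<^sup>2)" for t
      using transfer(2)[of "\<lambda>x. (u \<bullet> x)\<^sup>2" t] sq[of u] by (simp add: X_def)
    have vX: "variance (X t) = \<sigma>\<^sup>2" for t
      using transfer(1)[of "\<lambda>x. (u \<bullet> x)\<^sup>2" t] cov[of u] by (simp add: mX \<sigma>) (simp add: X_def)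
    have dX: "distr M borel (X t) = distr M borel (X 0)" for t
      using dist[of "\<lambda>x. u \<bullet> x" t] by (simp add: X_def[abs_def])
    have "weak_conv_m (\<lambda>n. distr M borel (\<lambda>x. (\<Sum>i<n. X i x) / sqrt (real n * \<sigma>\<^sup>2))) std_normal_distribution"
      by (rule central_limit_theorem_zero_mean[OF indepX mX \<sigma>(1) sX vX dX])
    \<comment> \<open>The theorem normalizes the sum by
      \<open>sqrt (real n * \<sigma>\<^sup>2)\<close>; evaluation at the frequency
      \<open>\<sigma>\<close> undoes the division by \<open>\<sigma>\<close>.\<close>
    then have "(\<lambda>n. char (distr M borel (\<lambda>x. (\<Sum>i<n. X i x) / sqrt (real n * \<sigma>\<^sup>2))) \<sigma>) \<longlonglongrightarrow> char std_normal_distribution \<sigma>"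
      by (intro levy_continuity1) (auto intro: real_distribution_distr real_dist_normal_dist)
    moreover have "char (distr M borel (\<lambda>x. (\<Sum>i<n. X i x) / sqrt (real n * \<sigma>\<^sup>2))) \<sigma> =
        (CLINT \<omega>|M. iexp (u \<bullet> ((1 / sqrt (real n)) *\<^sub>R (\<Sum>t=1..n. \<xi> t \<omega>))))" for n
    proof -
      have "char (distr M borel (\<lambda>x. (\<Sum>i<n. X i x) / sqrt (real n * \<sigma>\<^sup>2))) \<sigma> =
          (CLINT \<omega>|M. iexp ((1 / sqrt (real n)) * (\<Sum>i<n. X i \<omega>)))"
        unfolding char_def using \<sigma>(1) by (subst integral_distr) (auto simp: real_sqrt_mult)
      also have "\<dots> = char (distr M borel (\<lambda>\<omega>. \<Sum>i\<in>{..<n}. X i \<omega>)) (1 / sqrt (real n))"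
        unfolding char_def by (subst integral_distr) auto
      also have "\<dots> = (\<Prod>i\<in>{..<n}. char (distr M borel (X i)) (1 / sqrt (real n)))"
        by (intro char_distr_sum indep_vars_subset[OF indepX]) auto
      \<comment> \<open>Passage from the indices \<open>0..n-1\<close> of the one-dimensional
        theorem to \<open>1..n\<close>: the product only sees \<open>n\<close> factors with one
        common law.\<close>
      also have "\<dots> = (\<Prod>i\<in>{1..n}. char (distr M borel (X i)) (1 / sqrt (real n)))"
      proof -
        define c where "c = char (distr M borel (X 0))"
        have "char (distr M borel (X i)) = c" for i
          by (simp only: dX[of i] c_def)
        then show ?thesis by simp
      qed
      also have "\<dots> = char (distr M borel (\<lambda>\<omega>. \<Sum>i\<in>{1..n}. X i \<omega>)) (1 / sqrt (real n))"
        by (intro char_distr_sum[symmetric] indep_vars_subset[OF indepX]) auto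
      also have "\<dots> = (CLINT \<omega>|M. iexp (u \<bullet> ((1 / sqrt (real n)) *\<^sub>R (\<Sum>t=1..n. \<xi> t \<omega>))))"
        unfolding char_def by (subst integral_distr) (auto simp: X_def inner_sum_right)
      finally show ?thesis .
    qed
    ultimately show ?thesis
      unfolding char_multi_normal[OF \<Sigma>] char_std_normal_distribution \<sigma>(2) by simp
  qed
qed

section \<open>Second-order expansions of determinants and of the network\<close>

text \<open>The radius 2 leaves room for a sum of two matrices of norm at most 1. Closure under sums
  and products lets the Leibniz formula be treated factor by factor.\<close>

definition lip_ball :: "('v::real_normed_vector \<Rightarrow> real) \<Rightarrow> bool" where
  "lip_ball f \<longleftrightarrow> (\<exists>K\<ge>0. \<forall>x y. norm x \<le> 2 \<longrightarrow> norm y \<le> 2 \<longrightarrow> \<bar>f y - f x\<bar> \<le> K * norm (y - x))"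

text \<open>Vanishing to second order at 0, phrased through differences: the factor
  \<open>norm (y - x)\<close> is retained, which a bound by squared norms would lose. The
  determinant is later compared at two nearby points neither of which is the identity.\<close>

definition quad_ball :: "('v::real_normed_vector \<Rightarrow> real) \<Rightarrow> bool" where
  "quad_ball f \<longleftrightarrow> f 0 = 0 \<and> (\<exists>K\<ge>0. \<forall>x y. norm x \<le> 2 \<longrightarrow> norm y \<le> 2 \<longrightarrow>
      \<bar>f y - f x\<bar> \<le> K * ((norm x + norm y) * norm (y - x)))"

lemma lip_ballI: "K \<ge> 0 \<Longrightarrow> (\<And>x y. norm x \<le> 2 \<Longrightarrow> norm y \<le> 2 \<Longrightarrow> \<bar>f y - f x\<bar> \<le> K * norm (y - x)) \<Longrightarrow> lip_ball f"
  unfolding lip_ball_def by blast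

lemma quad_ballI: "f 0 = 0 \<Longrightarrow> K \<ge> 0 \<Longrightarrow>
    (\<And>x y. norm x \<le> 2 \<Longrightarrow> norm y \<le> 2 \<Longrightarrow> \<bar>f y - f x\<bar> \<le> K * ((norm x + norm y) * norm (y - x))) \<Longrightarrow> quad_ball f"
  unfolding quad_ball_def by blast

lemma lip_ball_const: "lip_ball (\<lambda>_. c)"
  by (rule lip_ballI[of 0]) auto

lemma lip_ball_bounded:
  assumes "lip_ball f"
  shows "\<exists>B\<ge>0. \<forall>x. norm x \<le> 2 \<longrightarrow> \<bar>f x\<bar> \<le> B"
proof -
  obtain K where K: "K \<ge> 0" "\<And>x y. norm x \<le> 2 \<Longrightarrow> norm y \<le> 2 \<Longrightarrow> \<bar>f y - f x\<bar> \<le> K * norm (y - x)"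
    using assms unfolding lip_ball_def by blast
  have "\<bar>f x\<bar> \<le> \<bar>f 0\<bar> + K * 2" if "norm x \<le> 2" for x
    using K(2)[of 0 x] that mult_left_mono[OF that K(1)] by simp
  then show ?thesis using K(1) by (intro exI[of _ "\<bar>f 0\<bar> + K * 2"]) auto
qed

lemma lip_ball_add:
  assumes "lip_ball f" "lip_ball g"
  shows "lip_ball (\<lambda>x. f x + g x)"
proof -
  obtain K where K: "K \<ge> 0" "\<And>x y. norm x \<le> 2 \<Longrightarrow> norm y \<le> 2 \<Longrightarrow> \<bar>f y - f x\<bar> \<le> K * norm (y - x)"
    using assms(1) unfolding lip_ball_def by blast
  obtain L where L: "L \<ge> 0" "\<And>x y. norm x \<le> 2 \<Longrightarrow> norm y \<le> 2 \<Longrightarrow> \<bar>g y - g x\<bar> \<le> L * norm (y - x)"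
    using assms(2) unfolding lip_ball_def by blast
  show ?thesis
  proof (rule lip_ballI[of "K + L"])
    fix x y :: 'a assume "norm x \<le> 2" "norm y \<le> 2"
    from K(2)[OF this] L(2)[OF this]
    show "\<bar>(f y + g y) - (f x + g x)\<bar> \<le> (K + L) * norm (y - x)"
      unfolding distrib_right by linarith
  qed (use K L in auto)
qed

lemma lip_ball_mult:
  assumes f: "lip_ball f" and g: "lip_ball g"
  shows "lip_ball (\<lambda>x. f x * g x)"
proof -
  obtain K where K: "K \<ge> 0" "\<And>x y. norm x \<le> 2 \<Longrightarrow> norm y \<le> 2 \<Longrightarrow> \<bar>f y - f x\<bar> \<le> K * norm (y - x)"
    using f unfolding lip_ball_def by blast
  obtain L where L: "L \<ge> 0" "\<And>x y. norm x \<le> 2 \<Longrightarrow> norm y \<le> 2 \<Longrightarrow> \<bar>g y - g x\<bar> \<le> L * norm (y - x)"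
    using g unfolding lip_ball_def by blast
  obtain A where A: "A \<ge> 0" "\<And>x. norm x \<le> 2 \<Longrightarrow> \<bar>f x\<bar> \<le> A" using lip_ball_bounded[OF f] by blast
  obtain B where B: "B \<ge> 0" "\<And>x. norm x \<le> 2 \<Longrightarrow> \<bar>g x\<bar> \<le> B" using lip_ball_bounded[OF g] by blast
  show ?thesis
  proof (rule lip_ballI[of "A * L + K * B"])
    fix x y :: 'a assume xy: "norm x \<le> 2" "norm y \<le> 2"
    have "f y * g y - f x * g x = f y * (g y - g x) + (f y - f x) * g x"
      by (simp add: algebra_simps)
    moreover have "\<bar>f y * (g y - g x)\<bar> \<le> A * (L * norm (y - x))"
      unfolding abs_mult using A L xy by (intro mult_mono) auto
    moreover have "\<bar>(f y - f x) * g x\<bar> \<le> (K * norm (y - x)) * B"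
      unfolding abs_mult using B K xy by (intro mult_mono) auto
    ultimately show "\<bar>f y * g y - f x * g x\<bar> \<le> (A * L + K * B) * norm (y - x)"
      unfolding distrib_right by (smt (verit) mult.assoc mult.commute)
  qed (use A B K L in auto)
qed

lemma lip_ball_prod: "(\<And>i. i \<in> I \<Longrightarrow> lip_ball (f i)) \<Longrightarrow> lip_ball (\<lambda>x. \<Prod>i\<in>I. f i x)"
  by (induction I rule: infinite_finite_induct) (auto intro: lip_ball_const lip_ball_mult)

lemma quad_ball_add:
  assumes "quad_ball f" "quad_ball g"
  shows "quad_ball (\<lambda>x. f x + g x)"
proof -
  obtain K where K: "K \<ge> 0" "\<And>x y. norm x \<le> 2 \<Longrightarrow> norm y \<le> 2 \<Longrightarrow> \<bar>f y - f x\<bar> \<le> K * ((norm x + norm y) * norm (y - x))"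
    using assms(1) unfolding quad_ball_def by blast
  obtain L where L: "L \<ge> 0" "\<And>x y. norm x \<le> 2 \<Longrightarrow> norm y \<le> 2 \<Longrightarrow> \<bar>g y - g x\<bar> \<le> L * ((norm x + norm y) * norm (y - x))"
    using assms(2) unfolding quad_ball_def by blast
  show ?thesis
  proof (rule quad_ballI[of _ "K + L"])
    fix x y :: 'a assume "norm x \<le> 2" "norm y \<le> 2"
    from K(2)[OF this] L(2)[OF this]
    show "\<bar>(f y + g y) - (f x + g x)\<bar> \<le> (K + L) * ((norm x + norm y) * norm (y - x))"
      unfolding distrib_right[of K L] by linarith
  qed (use K L assms in \<open>auto simp: quad_ball_def\<close>)
qed

text \<open>In the product rule for differences, the factor that is not differenced vanishes at 0
  and so contributes \<open>norm x\<close> or \<open>norm y\<close>.\<close>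

lemma lip_ball_mult_quad:
  assumes f: "lip_ball f" "f 0 = 0" and g: "lip_ball g" "g 0 = 0"
  shows "quad_ball (\<lambda>x. f x * g x)"
proof -
  obtain K where K: "K \<ge> 0" "\<And>x y. norm x \<le> 2 \<Longrightarrow> norm y \<le> 2 \<Longrightarrow> \<bar>f y - f x\<bar> \<le> K * norm (y - x)"
    using f unfolding lip_ball_def by blast
  obtain L where L: "L \<ge> 0" "\<And>x y. norm x \<le> 2 \<Longrightarrow> norm y \<le> 2 \<Longrightarrow> \<bar>g y - g x\<bar> \<le> L * norm (y - x)"
    using g unfolding lip_ball_def by blast
  show ?thesis
  proof (rule quad_ballI[of _ "K * L"])
    fix x y :: 'a assume xy: "norm x \<le> 2" "norm y \<le> 2"
    have "f y * g y - f x * g x = f y * (g y - g x) + (f y - f x) * g x"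
      by (simp add: algebra_simps)
    moreover have "\<bar>f y * (g y - g x)\<bar> \<le> (K * norm y) * (L * norm (y - x))"
      unfolding abs_mult using K(2)[of 0 y] f(2) K(1) L xy by (intro mult_mono) auto
    moreover have "\<bar>(f y - f x) * g x\<bar> \<le> (K * norm (y - x)) * (L * norm x)"
      unfolding abs_mult using L(2)[of 0 x] g(2) K L xy by (intro mult_mono) auto
    moreover have "K * L * ((norm x + norm y) * norm (y - x)) =
        (K * norm y) * (L * norm (y - x)) + (K * norm (y - x)) * (L * norm x)"
      by (simp add: algebra_simps)
    ultimately show "\<bar>f y * g y - f x * g x\<bar> \<le> K * L * ((norm x + norm y) * norm (y - x))"
      by linarith
  qed (use K L f in auto)
qed

lemma quad_ball_imp_lip:
  assumes "quad_ball f"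
  shows "lip_ball f"
proof -
  obtain K where K: "K \<ge> 0" "\<And>x y. norm x \<le> 2 \<Longrightarrow> norm y \<le> 2 \<Longrightarrow> \<bar>f y - f x\<bar> \<le> K * ((norm x + norm y) * norm (y - x))"
    using assms unfolding quad_ball_def by blast
  show ?thesis
  proof (rule lip_ballI[of "K * 4"])
    fix x y :: 'a assume xy: "norm x \<le> 2" "norm y \<le> 2"
    have "K * ((norm x + norm y) * norm (y - x)) \<le> K * (4 * norm (y - x))"
      using xy K by (intro mult_left_mono mult_right_mono) auto
    then show "\<bar>f y - f x\<bar> \<le> K * 4 * norm (y - x)"
      using K(2)[OF xy] by simp
  qed (use K in auto)
qed

lemma quad_ball_mult_lip:
  assumes f: "lip_ball f" and g: "quad_ball g"
  shows "quad_ball (\<lambda>x. f x * g x)"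
proof -
  obtain K where K: "K \<ge> 0" "\<And>x y. norm x \<le> 2 \<Longrightarrow> norm y \<le> 2 \<Longrightarrow> \<bar>f y - f x\<bar> \<le> K * norm (y - x)"
    using f unfolding lip_ball_def by blast
  obtain L where L: "L \<ge> 0" "\<And>x y. norm x \<le> 2 \<Longrightarrow> norm y \<le> 2 \<Longrightarrow> \<bar>g y - g x\<bar> \<le> L * ((norm x + norm y) * norm (y - x))"
    using g unfolding quad_ball_def by blast
  obtain L' where L': "L' \<ge> 0" "\<And>x y. norm x \<le> 2 \<Longrightarrow> norm y \<le> 2 \<Longrightarrow> \<bar>g y - g x\<bar> \<le> L' * norm (y - x)"
    using quad_ball_imp_lip[OF g] unfolding lip_ball_def by blast
  obtain A where A: "A \<ge> 0" "\<And>x. norm x \<le> 2 \<Longrightarrow> \<bar>f x\<bar> \<le> A" using lip_ball_bounded[OF f] by blast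
  have g0: "g 0 = 0" using g by (simp add: quad_ball_def)
  show ?thesis
  proof (rule quad_ballI[of _ "A * L + K * L'"])
    fix x y :: 'a assume xy: "norm x \<le> 2" "norm y \<le> 2"
    have "f y * g y - f x * g x = f y * (g y - g x) + (f y - f x) * g x"
      by (simp add: algebra_simps)
    moreover have "\<bar>f y * (g y - g x)\<bar> \<le> A * (L * ((norm x + norm y) * norm (y - x)))"
      unfolding abs_mult using A L xy by (intro mult_mono) auto
    moreover have "\<bar>(f y - f x) * g x\<bar> \<le> (K * norm (y - x)) * (L' * norm x)"
      unfolding abs_mult using L'(2)[of 0 x] g0 K L' xy by (intro mult_mono) auto
    moreover have "(K * norm (y - x)) * (L' * norm x) \<le> K * L' * ((norm x + norm y) * norm (y - x))"
    proof -
      have "(K * L') * (norm x * norm (y - x)) \<le> (K * L') * ((norm x + norm y) * norm (y - x))"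
        using K L' by (intro mult_left_mono mult_right_mono) auto
      then show ?thesis by (simp add: ac_simps)
    qed
    ultimately show "\<bar>f y * g y - f x * g x\<bar> \<le> (A * L + K * L') * ((norm x + norm y) * norm (y - x))"
      unfolding distrib_right[of "A * L"] mult.assoc[of A] by linarith
  qed (use A K L L' g0 in auto)
qed

lemma quad_ball_zero: "quad_ball (\<lambda>_. 0)"
  by (rule quad_ballI[of _ 0]) auto

lemma quad_ball_sum: "(\<And>i. i \<in> I \<Longrightarrow> quad_ball (f i)) \<Longrightarrow> quad_ball (\<lambda>x. \<Sum>i\<in>I. f i x)"
  by (induction I rule: infinite_finite_induct) (auto intro: quad_ball_zero quad_ball_add)

text \<open>Multiplying by one more factor adds \<open>f j x\<close> to the linear part and a new
  error, \<open>f j x\<close> times the previous product minus 1; both of these vanish at 0.\<close>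

lemma quad_ball_prod_expand:
  assumes "finite I" "\<And>i. i \<in> I \<Longrightarrow> lip_ball (f i)" "\<And>i. i \<in> I \<Longrightarrow> f i 0 = 0"
  shows "quad_ball (\<lambda>x. (\<Prod>i\<in>I. 1 + f i x) - 1 - (\<Sum>i\<in>I. f i x))"
  using assms
proof (induction I rule: finite_induct)
  case empty
  show ?case using quad_ball_zero by simp
next
  case (insert j I)
  have "lip_ball (\<lambda>x. (\<Prod>i\<in>I. 1 + f i x) + (-1))"
    using insert.prems by (intro lip_ball_add lip_ball_prod lip_ball_const) auto
  then have "quad_ball (\<lambda>x. f j x * ((\<Prod>i\<in>I. 1 + f i x) + (-1)))"
    using insert by (intro lip_ball_mult_quad) auto
  then have "quad_ball (\<lambda>x. ((\<Prod>i\<in>I. 1 + f i x) - 1 - (\<Sum>i\<in>I. f i x)) + f j x * ((\<Prod>i\<in>I. 1 + f i x) + (-1)))"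
    using insert by (intro quad_ball_add) auto
  then show ?case
    using insert by (simp add: algebra_simps)
qed

lemma lip_ball_entry: "lip_ball (\<lambda>X :: real^'n^'m. X $ i $ j)"
proof (rule lip_ballI[of 1])
  fix x y :: "real^'n^'m"
  have "\<bar>(y - x) $ i $ j\<bar> \<le> norm ((y - x) $ i)" by (rule component_le_norm_cart)
  also have "\<dots> \<le> norm (y - x)" by (rule Finite_Cartesian_Product.norm_nth_le)
  finally show "\<bar>y $ i $ j - x $ i $ j\<bar> \<le> 1 * norm (y - x)" by simp
qed simp

text \<open>In the Leibniz formula the identity permutation yields \<open>1 + trace X\<close> up to
  second order. Every other permutation moves at least two indices and so carries two off-diagonal
  entries of \<open>X\<close>.\<close>

lemma quad_ball_det: "quad_ball (\<lambda>X :: real^'n^'n. det (mat 1 + X) - 1 - trace X)"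
proof -
  let ?U = "UNIV :: 'n set"
  let ?term = "\<lambda>p (X :: real^'n^'n). of_int (sign p) * (\<Prod>i\<in>?U. (mat 1 + X) $ i $ p i)"
  have fin: "finite {p. p permutes ?U}" by (simp add: finite_permutations)
  have eq: "det (mat 1 + X) - 1 - trace X =
      (\<Sum>p\<in>{p. p permutes ?U} - {id}. ?term p X) + ((\<Prod>i\<in>?U. 1 + X $ i $ i) - 1 - (\<Sum>i\<in>?U. X $ i $ i))" for X
    unfolding det_def trace_def
    by (subst sum.remove[OF fin, of id]) (auto simp: permutes_id mat_def)
  have "quad_ball (?term p)" if p: "p permutes ?U" "p \<noteq> id" for p
  proof -
    obtain a where a: "p a \<noteq> a" using p by (auto simp: fun_eq_iff)
    define b where "b = p a"
    have b: "p b \<noteq> b" "b \<noteq> a" using a permutes_inj[OF p(1)] by (auto simp: b_def inj_def)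
    have split: "?term p X = (of_int (sign p) * (\<Prod>i\<in>?U - {a} - {b}. mat 1 $ i $ p i + X $ i $ p i)) *
        (X $ a $ p a * X $ b $ p b)" for X
      using a b by (subst prod.remove[of _ a], simp, simp, subst prod.remove[of _ b]) (auto simp: mat_def)
    show ?thesis
      unfolding split
      by (intro quad_ball_mult_lip lip_ball_mult_quad lip_ball_mult lip_ball_prod lip_ball_add lip_ball_const lip_ball_entry) auto
  qed
  then show ?thesis
    unfolding eq
    by (intro quad_ball_add quad_ball_sum quad_ball_prod_expand lip_ball_entry) auto
qed

text \<open>\<open>X\<close> will be the deviation of the base point from the identity and
  \<open>E\<close> the increment. The error keeps a factor \<open>norm E\<close>, hence is of
  smaller order than \<open>E\<close> once \<open>X\<close> and \<open>E\<close> are small.\<close>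

lemma det_expansion:
  "\<exists>K\<ge>0. \<forall>X E :: real^'n^'n. norm X \<le> 1 \<longrightarrow> norm E \<le> 1 \<longrightarrow>
     \<bar>det (mat 1 + X + E) - det (mat 1 + X) - trace E\<bar> \<le> K * ((norm X + norm E) * norm E)"
proof -
  obtain K where K: "K \<ge> 0" "\<And>x y :: real^'n^'n. norm x \<le> 2 \<Longrightarrow> norm y \<le> 2 \<Longrightarrow>
      \<bar>(det (mat 1 + y) - 1 - trace y) - (det (mat 1 + x) - 1 - trace x)\<bar> \<le> K * ((norm x + norm y) * norm (y - x))"
    using quad_ball_det[where ?'n='n] unfolding quad_ball_def by blast
  have "\<bar>det (mat 1 + X + E) - det (mat 1 + X) - trace E\<bar> \<le> 2 * K * ((norm X + norm E) * norm E)"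
    if "norm X \<le> 1" "norm E \<le> 1" for X E :: "real^'n^'n"
  proof -
    have XE: "norm (X + E) \<le> norm X + norm E" by (rule norm_triangle_ineq)
    have "\<bar>det (mat 1 + X + E) - det (mat 1 + X) - trace E\<bar> \<le> K * ((norm X + norm (X + E)) * norm E)"
      using K(2)[of X "X + E"] XE that by (simp add: trace_add add.assoc algebra_simps)
    also have "\<dots> \<le> K * ((2 * (norm X + norm E)) * norm E)"
    proof -
      have "norm X + norm (X + E) \<le> 2 * (norm X + norm E)"
      proof -
        have "norm X + norm (X + E) \<le> norm X + (norm X + norm E)"
          using XE by (rule add_left_mono)
        also have "\<dots> \<le> 2 * (norm X + norm E)" by simp
        finally show ?thesis .
      qed
      then show ?thesis using K by (intro mult_left_mono mult_right_mono) auto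
    qed
    finally show ?thesis by (simp add: ac_simps)
  qed
  then show ?thesis using K(1) by (intro exI[of _ "2 * K"]) auto
qed

section \<open>Differentiability of the network in its weights\<close>

definition twice_diff :: "(real^'k \<Rightarrow> real) \<Rightarrow> bool" where
  "twice_diff f \<longleftrightarrow> (\<exists>G H. (\<forall>W. (f has_derivative (\<lambda>h. h \<bullet> G W)) (at W)) \<and> (\<forall>W. (G has_derivative H W) (at W)))"

lemma twice_diff_const: "twice_diff (\<lambda>_. c)"
  unfolding twice_diff_def
  by (intro exI[of _ "\<lambda>_. 0"] exI[of _ "\<lambda>_ _. 0"]) auto

lemma twice_diff_coord: "twice_diff (\<lambda>W :: real^'k. W $ k)"
  unfolding twice_diff_def
proof (intro exI[of _ "\<lambda>_. axis k 1"] exI[of _ "\<lambda>_ _. 0"] conjI allI)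
  fix W :: "real^'k"
  have "((\<lambda>W. W \<bullet> axis k 1) has_derivative (\<lambda>h. h \<bullet> axis k 1)) (at W)"
    by (auto intro!: derivative_eq_intros)
  then show "((\<lambda>W. W $ k) has_derivative (\<lambda>h. h \<bullet> axis k 1)) (at W)"
    by (simp add: inner_axis)
qed auto

lemma twice_diff_add:
  assumes "twice_diff f" "twice_diff g"
  shows "twice_diff (\<lambda>W. f W + g W)"
proof -
  obtain G H where 1: "\<And>W. (f has_derivative (\<lambda>h. h \<bullet> G W)) (at W)" "\<And>W. (G has_derivative H W) (at W)"
    using assms(1) unfolding twice_diff_def by blast
  obtain G' H' where 2: "\<And>W. (g has_derivative (\<lambda>h. h \<bullet> G' W)) (at W)" "\<And>W. (G' has_derivative H' W) (at W)"
    using assms(2) unfolding twice_diff_def by blast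
  show ?thesis
    unfolding twice_diff_def
    by (intro exI[of _ "\<lambda>W. G W + G' W"] exI[of _ "\<lambda>W h. H W h + H' W h"])
       (auto intro!: derivative_eq_intros 1 2 simp: inner_add_right)
qed

lemma twice_diff_mult:
  assumes "twice_diff f" "twice_diff g"
  shows "twice_diff (\<lambda>W. f W * g W)"
proof -
  obtain G H where 1: "\<And>W. (f has_derivative (\<lambda>h. h \<bullet> G W)) (at W)" "\<And>W. (G has_derivative H W) (at W)"
    using assms(1) unfolding twice_diff_def by blast
  obtain G' H' where 2: "\<And>W. (g has_derivative (\<lambda>h. h \<bullet> G' W)) (at W)" "\<And>W. (G' has_derivative H' W) (at W)"
    using assms(2) unfolding twice_diff_def by blast
  show ?thesis
    unfolding twice_diff_def
    by (intro exI[of _ "\<lambda>W. f W *\<^sub>R G' W + g W *\<^sub>R G W"]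
          exI[of _ "\<lambda>W h. (f W *\<^sub>R H' W h + (h \<bullet> G W) *\<^sub>R G' W) + (g W *\<^sub>R H W h + (h \<bullet> G' W) *\<^sub>R G W)"])
       (auto intro!: derivative_eq_intros 1 2 simp: inner_add_right algebra_simps)
qed

lemma twice_diff_sum: "(\<And>i. i \<in> I \<Longrightarrow> twice_diff (f i)) \<Longrightarrow> twice_diff (\<lambda>W. \<Sum>i\<in>I. f i W)"
  by (induction I rule: infinite_finite_induct) (auto intro: twice_diff_const twice_diff_add)

lemma twice_diff_compose:
  fixes \<phi> :: "real \<Rightarrow> real"
  assumes "twice_diff f"
    and \<phi>: "\<And>x. (\<phi> has_real_derivative \<phi>' x) (at x)" "\<And>x. (\<phi>' has_real_derivative \<phi>'' x) (at x)"
  shows "twice_diff (\<lambda>W. \<phi> (f W))"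
proof -
  obtain G H where 1: "\<And>W. (f has_derivative (\<lambda>h. h \<bullet> G W)) (at W)" "\<And>W. (G has_derivative H W) (at W)"
    using assms(1) unfolding twice_diff_def by blast
  have 2: "((\<lambda>W. \<phi> (f W)) has_derivative (\<lambda>h. (h \<bullet> G W) * \<phi>' (f W))) (at W)" for W
    using has_derivative_compose[OF 1(1) \<phi>(1)[THEN has_field_derivative_imp_has_derivative]] by (simp add: mult.commute)
  have 5: "((\<lambda>W. \<phi> (f W)) has_derivative (\<lambda>h. h \<bullet> (\<phi>' (f W) *\<^sub>R G W))) (at W)" for W
    unfolding inner_scaleR_right by (rule has_derivative_eq_rhs[OF 2]) (simp add: mult.commute)
  have 3: "((\<lambda>W. \<phi>' (f W)) has_derivative (\<lambda>h. (h \<bullet> G W) * \<phi>'' (f W))) (at W)" for W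
    using has_derivative_compose[OF 1(1) \<phi>(2)[THEN has_field_derivative_imp_has_derivative]] by (simp add: mult.commute)
  have 4: "((\<lambda>W. \<phi>' (f W) *\<^sub>R G W) has_derivative
      (\<lambda>h. \<phi>' (f W) *\<^sub>R H W h + ((h \<bullet> G W) * \<phi>'' (f W)) *\<^sub>R G W)) (at W)" for W
    by (rule has_derivative_scaleR[OF 3 1(2)])
  show ?thesis
    unfolding twice_diff_def
    by (intro exI[of _ "\<lambda>W. \<phi>' (f W) *\<^sub>R G W"]
          exI[of _ "\<lambda>W h. \<phi>' (f W) *\<^sub>R H W h + ((h \<bullet> G W) * \<phi>'' (f W)) *\<^sub>R G W"] conjI allI 4 5)
qed

text \<open>Induction over the layers: a unit is an activation composed with a sum of products of
  one weight, a coordinate of \<open>W\<close>, with a unit of the preceding layer.\<close>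

lemma twice_diff_mlp_layer:
  assumes activation: "\<And>l. l < L \<Longrightarrow> \<phi> l differentiable_on UNIV \<and> deriv (\<phi> l) C1_differentiable_on UNIV"
    and "l \<le> L"
  shows "twice_diff (\<lambda>W. mlp_layer \<phi> ns (\<lambda>s. W $ idx s) x l i)"
  using \<open>l \<le> L\<close>
proof (induction l arbitrary: i)
  case 0
  show ?case by (simp add: twice_diff_const)
next
  case (Suc l)
  have \<phi>: "(\<phi> l has_real_derivative deriv (\<phi> l) x) (at x)" for x
  proof -
    have "\<phi> l differentiable at x" using activation[of l] Suc.prems by (auto simp: differentiable_on_def)
    then show ?thesis by (metis DERIV_imp_deriv real_differentiable_def)
  qed
  obtain \<phi>'' where "\<And>x. (deriv (\<phi> l) has_vector_derivative \<phi>'' x) (at x)"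
    using activation[of l] Suc.prems by (auto simp: C1_differentiable_on_def)
  then have \<phi>'': "\<And>x. (deriv (\<phi> l) has_real_derivative \<phi>'' x) (at x)"
    by (simp add: has_real_derivative_iff_has_vector_derivative)
  show ?case
    unfolding mlp_layer.simps using Suc
    by (intro twice_diff_compose[OF _ \<phi> \<phi>''] twice_diff_add twice_diff_coord twice_diff_sum twice_diff_mult) auto
qed

lemma twice_diff_mlp:
  assumes "\<And>l. l \<le> length hs \<Longrightarrow> \<phi> l differentiable_on UNIV \<and> deriv (\<phi> l) C1_differentiable_on UNIV"
  shows "twice_diff (\<lambda>W. mlp \<phi> hs idx W z $ i)"
  unfolding mlp_def using assms by (simp del: mlp_layer.simps) (rule twice_diff_mlp_layer[of "Suc (length hs)"], auto)

text \<open>Continuity in the input, as opposed to the weights, is the source of Borel measurability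
  of \<open>F W\<close>.\<close>

lemma continuous_mlp_layer:
  assumes activation: "\<And>l. l < L \<Longrightarrow> \<phi> l differentiable_on UNIV" and "l \<le> L"
  shows "continuous_on UNIV (\<lambda>z :: real^'q. mlp_layer \<phi> ns w (\<lambda>j. z $ e j) l i)"
  using \<open>l \<le> L\<close>
proof (induction l arbitrary: i)
  case 0
  show ?case by (auto intro!: continuous_intros)
next
  case (Suc l)
  have "continuous_on UNIV (\<phi> l)"
    using activation[of l] Suc.prems by (intro differentiable_imp_continuous_on) auto
  moreover have "continuous_on UNIV (\<lambda>z :: real^'q. w (l, i, ns ! l) +
      (\<Sum>j<ns ! l. w (l, i, j) * mlp_layer \<phi> ns w (\<lambda>j. z $ e j) l j))"
    using Suc.prems by (intro continuous_on_add continuous_on_const continuous_on_sum continuous_on_mult Suc.IH) simp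
  ultimately show ?case
    unfolding mlp_layer.simps by (rule continuous_on_compose2) simp
qed

lemma continuous_mlp:
  assumes "\<And>l. l \<le> length hs \<Longrightarrow> \<phi> l differentiable_on UNIV \<and> deriv (\<phi> l) C1_differentiable_on UNIV"
  shows "continuous_on UNIV (mlp \<phi> hs idx W)"
  unfolding mlp_def
  by (intro continuous_intros continuous_mlp_layer[of "Suc (length hs)"]) (use assms in auto)

section \<open>Partial derivatives and Taylor estimates\<close>

lemma partial_deriv_eq:
  assumes "(f has_derivative f') (at W)"
  shows "partial_deriv k f W = f' (axis k 1)"
proof -
  have "((\<lambda>t. f (W + t *\<^sub>R axis k 1)) has_derivative (\<lambda>t. f' (t *\<^sub>R axis k 1))) (at 0)"
    by (rule has_derivative_compose[where g = f and g' = f'])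
       (auto intro!: derivative_eq_intros simp: assms)
  moreover have "f' (t *\<^sub>R axis k 1) = t *\<^sub>R f' (axis k 1)" for t
    using has_derivative_linear[OF assms] by (rule linear_scale)
  ultimately have "((\<lambda>t. f (W + t *\<^sub>R axis k 1)) has_vector_derivative f' (axis k 1)) (at 0)"
    by (simp add: has_vector_derivative_def)
  then show ?thesis
    unfolding partial_deriv_def by (rule vector_derivative_at)
qed

text \<open>Difference quotients along a sequence make the partial derivative a pointwise limit of
  functions measurable in the input.\<close>

lemma partial_deriv_LIMSEQ:
  assumes "(f has_derivative f') (at W)"
  shows "(\<lambda>n. real (Suc n) *\<^sub>R (f (W + (1 / real (Suc n)) *\<^sub>R axis k 1) - f W)) \<longlonglongrightarrow> partial_deriv k f W"
proof -
  have "((\<lambda>t. f (W + t *\<^sub>R axis k 1)) has_derivative (\<lambda>t. f' (t *\<^sub>R axis k 1))) (at 0)"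
    by (rule has_derivative_compose[where g = f and g' = f'])
       (auto intro!: derivative_eq_intros simp: assms)
  moreover have "f' (t *\<^sub>R axis k 1) = t *\<^sub>R f' (axis k 1)" for t
    using has_derivative_linear[OF assms] by (rule linear_scale)
  ultimately have "((\<lambda>t. f (W + t *\<^sub>R axis k 1)) has_vector_derivative f' (axis k 1)) (at 0)"
    by (simp add: has_vector_derivative_def)
  then have lim: "((\<lambda>t. norm (f (W + t *\<^sub>R axis k 1) - f W - t *\<^sub>R f' (axis k 1)) / norm t) \<longlongrightarrow> 0) (at 0)"
    by (simp add: has_vector_derivative_def has_derivative_at)
  have "((\<lambda>t. (f (W + t *\<^sub>R axis k 1) - f W) /\<^sub>R t - f' (axis k 1)) \<longlongrightarrow> 0) (at 0)"
  proof (rule tendsto_norm_zero_cancel, rule Lim_transform_eventually[OF lim])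
    show "\<forall>\<^sub>F t in at 0. norm (f (W + t *\<^sub>R axis k 1) - f W - t *\<^sub>R f' (axis k 1)) / norm t =
        norm ((f (W + t *\<^sub>R axis k 1) - f W) /\<^sub>R t - f' (axis k 1))"
    proof (rule eventually_at_ball'[of 1 0 UNIV, THEN eventually_mono])
      fix t :: real assume "t \<in> ball 0 1 \<and> t \<noteq> 0 \<and> t \<in> UNIV"
      then have "(f (W + t *\<^sub>R axis k 1) - f W) /\<^sub>R t - f' (axis k 1) =
          (f (W + t *\<^sub>R axis k 1) - f W - t *\<^sub>R f' (axis k 1)) /\<^sub>R t"
        by (simp add: scaleR_diff_right)
      then show "norm (f (W + t *\<^sub>R axis k 1) - f W - t *\<^sub>R f' (axis k 1)) / norm t =
          norm ((f (W + t *\<^sub>R axis k 1) - f W) /\<^sub>R t - f' (axis k 1))"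
        by (simp add: divide_inverse mult.commute)
    qed simp
  qed
  then have "((\<lambda>t. (f (W + t *\<^sub>R axis k 1) - f W) /\<^sub>R t) \<longlongrightarrow> f' (axis k 1)) (at 0)"
    by (rule LIM_zero_cancel)
  moreover have "filterlim (\<lambda>n. 1 / real (Suc n)) (at 0) sequentially"
    unfolding filterlim_at using LIMSEQ_Suc[OF lim_1_over_n[where 'a = real]] by (simp del: of_nat_Suc)
  ultimately have "(\<lambda>n. (f (W + (1 / real (Suc n)) *\<^sub>R axis k 1) - f W) /\<^sub>R (1 / real (Suc n))) \<longlonglongrightarrow> f' (axis k 1)"
    by (rule filterlim_compose)
  then show ?thesis by (simp add: partial_deriv_eq[OF assms])
qed


definition twice_diff_vec :: "(real^'k \<Rightarrow> real^'d) \<Rightarrow> bool" where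
  "twice_diff_vec f \<longleftrightarrow> (\<forall>i. twice_diff (\<lambda>W. f W $ i))"

text \<open>A dictionary between the abstract derivatives (gradients \<open>G\<close>, their
  derivatives \<open>H\<close>) and the iterated \<open>partial_deriv\<close> in which the growth
  bounds are phrased.\<close>

lemma twice_diff_vec_derivs:
  fixes f :: "real^'k \<Rightarrow> real^'d"
  assumes "twice_diff_vec f"
  shows "\<exists>G H. (\<forall>i W. ((\<lambda>W. f W $ i) has_derivative (\<lambda>h. h \<bullet> G i W)) (at W)) \<and>
    (\<forall>i W. (G i has_derivative H i W) (at W)) \<and>
    (\<forall>W. (f has_derivative (\<lambda>h. \<chi> i. h \<bullet> G i W)) (at W)) \<and>
    (\<forall>k W. partial_deriv k f W = (\<chi> i. G i W $ k)) \<and>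
    (\<forall>k W. (partial_deriv k f has_derivative (\<lambda>h. \<chi> i. H i W h $ k)) (at W)) \<and>
    (\<forall>k l W. partial_deriv k (partial_deriv l f) W = (\<chi> i. H i W (axis k 1) $ l))"
proof -
  have "\<forall>i. \<exists>G H. (\<forall>W. ((\<lambda>W. f W $ i) has_derivative (\<lambda>h. h \<bullet> G W)) (at W)) \<and> (\<forall>W. (G has_derivative H W) (at W))"
    using assms unfolding twice_diff_vec_def twice_diff_def by blast
  then obtain G H where 1: "\<And>i W. ((\<lambda>W. f W $ i) has_derivative (\<lambda>h. h \<bullet> G i W)) (at W)"
    and 2: "\<And>i W. (G i has_derivative H i W) (at W)"
    by metis
  have vec: "(g has_derivative (\<lambda>h. \<chi> i. g' i h)) (at W)"
    if "\<And>i. ((\<lambda>W. g W $ i) has_derivative g' i) (at W)" for g :: "real^'k \<Rightarrow> real^'d" and g' W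
    by (subst has_derivative_componentwise_within) (auto simp: Basis_cart inner_axis that)
  have 3: "(f has_derivative (\<lambda>h. \<chi> i. h \<bullet> G i W)) (at W)" for W
    by (rule vec) (rule 1)
  have 4: "partial_deriv k f W = (\<chi> i. G i W $ k)" for k W
    by (subst partial_deriv_eq[OF 3]) (simp add: inner_axis inner_commute[of "axis k 1"])
  have 5: "(partial_deriv k f has_derivative (\<lambda>h. \<chi> i. H i W h $ k)) (at W)" for k W
  proof (rule vec)
    fix i
    have "((\<lambda>W. G i W $ k) has_derivative (\<lambda>h. H i W h $ k)) (at W)"
      by (rule bounded_linear.has_derivative[OF bounded_linear_vec_nth 2])
    then show "((\<lambda>W. partial_deriv k f W $ i) has_derivative (\<lambda>h. H i W h $ k)) (at W)"
      by (simp add: 4)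
  qed
  have 6: "partial_deriv k (partial_deriv l f) W = (\<chi> i. H i W (axis k 1) $ l)" for k l W
    by (rule partial_deriv_eq[OF 5])
  from 1 2 3 4 5 6 show ?thesis by blast
qed

lemma abs_sum_sum_le:
  fixes h :: "real^'k"
  assumes "\<And>k l. \<bar>a k l\<bar> \<le> B"
  shows "\<bar>\<Sum>k\<in>UNIV. \<Sum>l\<in>UNIV. h $ k * h $ l * a k l\<bar> \<le> (real CARD('k))\<^sup>2 * B * (norm h)\<^sup>2"
proof -
  have "\<bar>h $ k * h $ l * a k l\<bar> \<le> norm h * norm h * B" for k l
    unfolding abs_mult using assms[of k l] component_le_norm_cart[of h]
    by (intro mult_mono) auto
  then have "\<bar>\<Sum>k\<in>UNIV. \<Sum>l\<in>UNIV. h $ k * h $ l * a k l\<bar> \<le> (\<Sum>k\<in>(UNIV::'k set). \<Sum>l\<in>(UNIV::'k set). norm h * norm h * B)"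
    by (intro order_trans[OF sum_abs] sum_mono)
  then show ?thesis by (simp add: power2_eq_square mult_ac)
qed

text \<open>Three orders of accuracy for three uses: the size of an increment, its linear
  approximation, and the second-order approximation needed where noise cancels the quadratic term.
  All arise by restricting one component to the segment from \<open>W0\<close> to
  \<open>W0 + h\<close>; the last compares second derivatives at an intermediate point and at
  \<open>W0\<close> through the Lipschitz bound.\<close>

lemma taylor_estimates:
  fixes f :: "real^'k \<Rightarrow> real^'d"
  assumes f: "twice_diff_vec f" and h: "norm h < \<delta>"
    and A: "\<And>W k. norm (W - W0) < \<delta> \<Longrightarrow> norm (partial_deriv k f W) \<le> A"
    and B: "\<And>W k l. norm (W - W0) < \<delta> \<Longrightarrow> norm (partial_deriv k (partial_deriv l f) W) \<le> B"
    and L: "\<And>W k l. norm (W - W0) < \<delta> \<Longrightarrow>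
        norm (partial_deriv k (partial_deriv l f) W - partial_deriv k (partial_deriv l f) W0) \<le> L * norm (W - W0)"
  shows "\<bar>f (W0 + h) $ i - f W0 $ i\<bar> \<le> real CARD('k) * A * norm h"
    and "\<bar>f (W0 + h) $ i - f W0 $ i - (\<Sum>k\<in>UNIV. h $ k * partial_deriv k f W0 $ i)\<bar> \<le> (real CARD('k))\<^sup>2 * B * (norm h)\<^sup>2"
    and "\<bar>f (W0 + h) $ i - f W0 $ i - (\<Sum>k\<in>UNIV. h $ k * partial_deriv k f W0 $ i)
        - (\<Sum>k\<in>UNIV. \<Sum>l\<in>UNIV. h $ k * h $ l * partial_deriv k (partial_deriv l f) W0 $ i) / 2\<bar>
      \<le> (real CARD('k))\<^sup>2 * L * norm h ^ 3"
proof -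
  obtain G H where 1: "\<And>i W. ((\<lambda>W. f W $ i) has_derivative (\<lambda>h. h \<bullet> G i W)) (at W)"
    and 2: "\<And>i W. (G i has_derivative H i W) (at W)"
    and pd: "\<And>k W. partial_deriv k f W = (\<chi> i. G i W $ k)"
    and pd2: "\<And>k l W. partial_deriv k (partial_deriv l f) W = (\<chi> i. H i W (axis k 1) $ l)"
    using twice_diff_vec_derivs[OF f] by blast
  define N where "N = real CARD('k)"
  define p where "p t = f (W0 + t *\<^sub>R h) $ i" for t
  define p1 where "p1 t = (\<Sum>k\<in>UNIV. h $ k * partial_deriv k f (W0 + t *\<^sub>R h) $ i)" for t
  define p2 where "p2 t = (\<Sum>k\<in>UNIV. \<Sum>l\<in>UNIV. h $ k * h $ l * partial_deriv k (partial_deriv l f) (W0 + t *\<^sub>R h) $ i)" for t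
  have line: "((\<lambda>t. W0 + t *\<^sub>R h) has_derivative (\<lambda>t. t *\<^sub>R h)) (at t)" for t
    by (auto intro!: derivative_eq_intros)
  have p1_eq: "p1 t = h \<bullet> G i (W0 + t *\<^sub>R h)" for t
    by (simp add: p1_def pd inner_vec_def)
  have p2_eq: "p2 t = h \<bullet> H i (W0 + t *\<^sub>R h) h" for t
  proof -
    have lin: "linear (H i (W0 + t *\<^sub>R h))" using 2 by (rule has_derivative_linear)
    have "H i (W0 + t *\<^sub>R h) h = H i (W0 + t *\<^sub>R h) (\<Sum>k\<in>UNIV. h $ k *\<^sub>R axis k 1)"
      using basis_expansion[of h] by (simp add: scalar_mult_eq_scaleR)
    also have "\<dots> = (\<Sum>k\<in>UNIV. h $ k *\<^sub>R H i (W0 + t *\<^sub>R h) (axis k 1))"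
      by (simp add: linear_sum[OF lin] linear_scale[OF lin])
    finally have "h \<bullet> H i (W0 + t *\<^sub>R h) h = (\<Sum>k\<in>UNIV. h $ k * (h \<bullet> H i (W0 + t *\<^sub>R h) (axis k 1)))"
      by (simp add: inner_sum_right)
    then show ?thesis
      by (simp add: p2_def pd2 inner_vec_def sum_distrib_left mult.assoc)
  qed
  have d1: "(p has_real_derivative p1 t) (at t)" for t
  proof -
    have "(p has_derivative (\<lambda>s. (s *\<^sub>R h) \<bullet> G i (W0 + t *\<^sub>R h))) (at t)"
      unfolding p_def by (rule has_derivative_compose[OF line 1])
    then show ?thesis
      by (simp add: has_field_derivative_def p1_eq mult_commute_abs)
  qed
  have d2: "(p1 has_real_derivative p2 t) (at t)" for t
  proof -
    have lin: "linear (H i (W0 + t *\<^sub>R h))" using 2 by (rule has_derivative_linear)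
    have "((\<lambda>t. G i (W0 + t *\<^sub>R h)) has_derivative (\<lambda>s. H i (W0 + t *\<^sub>R h) (s *\<^sub>R h))) (at t)"
      by (rule has_derivative_compose[OF line 2])
    then have "(p1 has_derivative (\<lambda>s. h \<bullet> H i (W0 + t *\<^sub>R h) (s *\<^sub>R h))) (at t)"
      unfolding p1_eq[abs_def] by (rule has_derivative_inner_right)
    then show ?thesis
      by (simp add: has_field_derivative_def p2_eq linear_scale[OF lin] mult_commute_abs)
  qed
  have close: "norm ((W0 + t *\<^sub>R h) - W0) < \<delta>" "norm ((W0 + t *\<^sub>R h) - W0) \<le> norm h" if "0 \<le> t" "t \<le> 1" for t
  proof -
    have "t * norm h \<le> 1 * norm h" using that by (intro mult_right_mono) auto
    then show "norm ((W0 + t *\<^sub>R h) - W0) < \<delta>" "norm ((W0 + t *\<^sub>R h) - W0) \<le> norm h"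
      using that h by auto
  qed
  \<comment> \<open>The Lipschitz assumption at the endpoint \<open>W0 + h\<close>, with arbitrary
    indices, dominates a norm by this product.\<close>
  have L0: "L * norm h \<ge> 0"
    using order_trans[OF norm_ge_zero L[OF close(1)[of 1], of undefined undefined]] by simp
  obtain s where s: "0 < s" "s < 1" "p 1 = p 0 + p1 s"
    using MVT2[of 0 1 p p1] d1 by auto
  have "\<bar>p1 s\<bar> \<le> (\<Sum>k\<in>(UNIV::'k set). norm h * A)"
    unfolding p1_def
  proof (intro order_trans[OF sum_abs] sum_mono)
    fix k
    have "\<bar>partial_deriv k f (W0 + s *\<^sub>R h) $ i\<bar> \<le> A"
      using component_le_norm_cart[of "partial_deriv k f (W0 + s *\<^sub>R h)" i] A[OF close(1)[of s], of k] s by linarith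
    then show "\<bar>h $ k * partial_deriv k f (W0 + s *\<^sub>R h) $ i\<bar> \<le> norm h * A"
      unfolding abs_mult using component_le_norm_cart[of h k] by (intro mult_mono) auto
  qed
  then show "\<bar>f (W0 + h) $ i - f W0 $ i\<bar> \<le> real CARD('k) * A * norm h"
    using s by (simp add: p_def mult_ac)
  have "\<exists>t. 0 < t \<and> t < 1 \<and> p 1 = (\<Sum>m<2. (if m = 0 then p else if m = 1 then p1 else p2) 0 / fact m * 1 ^ m) +
      (if (2::nat) = 0 then p else if (2::nat) = 1 then p1 else p2) t / fact 2 * 1 ^ 2"
    by (rule Maclaurin[where diff = "\<lambda>m. if m = 0 then p else if m = 1 then p1 else p2"])
       (auto simp: d1 d2)
  then obtain r where r: "0 < r" "r < 1" "p 1 = p 0 + p1 0 + p2 r / 2"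
    by (auto simp: numeral_2_eq_2)
  have comp: "\<bar>partial_deriv k (partial_deriv l f) (W0 + r *\<^sub>R h) $ i\<bar> \<le> B" for k l
    using component_le_norm_cart[of "partial_deriv k (partial_deriv l f) (W0 + r *\<^sub>R h)" i] B[OF close(1)[of r], of k l] r by linarith
  have B0: "B \<ge> 0" using comp[of undefined undefined] by linarith
  have "\<bar>p2 r\<bar> \<le> N\<^sup>2 * B * (norm h)\<^sup>2"
    unfolding p2_def N_def by (rule abs_sum_sum_le) (rule comp)
  then show "\<bar>f (W0 + h) $ i - f W0 $ i - (\<Sum>k\<in>UNIV. h $ k * partial_deriv k f W0 $ i)\<bar> \<le> (real CARD('k))\<^sup>2 * B * (norm h)\<^sup>2"
    using r by (simp add: p_def p1_def N_def)
  have comp': "\<bar>partial_deriv k (partial_deriv l f) (W0 + r *\<^sub>R h) $ i - partial_deriv k (partial_deriv l f) W0 $ i\<bar> \<le> L * norm h" for k l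
  proof -
    have "\<bar>(partial_deriv k (partial_deriv l f) (W0 + r *\<^sub>R h) - partial_deriv k (partial_deriv l f) W0) $ i\<bar> \<le>
        L * norm ((W0 + r *\<^sub>R h) - W0)"
      by (rule order_trans[OF component_le_norm_cart L[OF close(1)]]) (use r in auto)
    also have "\<dots> \<le> L * norm h"
    proof -
      have "L * norm ((W0 + r *\<^sub>R h) - W0) = r * (L * norm h)" using r by simp
      also have "\<dots> \<le> 1 * (L * norm h)" using r L0 by (intro mult_right_mono) auto
      finally show ?thesis by simp
    qed
    finally show ?thesis by simp
  qed
  have "p2 r - p2 0 = (\<Sum>k\<in>UNIV. \<Sum>l\<in>UNIV. h $ k * h $ l *
      (partial_deriv k (partial_deriv l f) (W0 + r *\<^sub>R h) $ i - partial_deriv k (partial_deriv l f) W0 $ i))"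
    by (simp add: p2_def sum_subtractf right_diff_distrib)
  also have "\<bar>\<dots>\<bar> \<le> N\<^sup>2 * (L * norm h) * (norm h)\<^sup>2"
    unfolding N_def by (rule abs_sum_sum_le) (rule comp')
  finally have "\<bar>p2 r - p2 0\<bar> \<le> N\<^sup>2 * L * norm h ^ 3"
    by (simp add: power2_eq_square power3_eq_cube mult_ac)
  then have "\<bar>p 1 - p 0 - p1 0 - p2 0 / 2\<bar> \<le> N\<^sup>2 * L * norm h ^ 3"
    unfolding r(3) by (simp add: diff_divide_distrib[symmetric])
  then show "\<bar>f (W0 + h) $ i - f W0 $ i - (\<Sum>k\<in>UNIV. h $ k * partial_deriv k f W0 $ i)
        - (\<Sum>k\<in>UNIV. \<Sum>l\<in>UNIV. h $ k * h $ l * partial_deriv k (partial_deriv l f) W0 $ i) / 2\<bar>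
      \<le> (real CARD('k))\<^sup>2 * L * norm h ^ 3"
    by (simp add: p_def p1_def p2_def N_def)
qed

lemma borel_measurable_partial_deriv:
  fixes F :: "real^'k \<Rightarrow> real^'q \<Rightarrow> real^'d"
  assumes [measurable]: "\<And>W. F W \<in> borel_measurable borel"
    and diff: "\<And>z. \<exists>f'. ((\<lambda>V. F V z) has_derivative f') (at W)"
  shows "(\<lambda>z. partial_deriv k (\<lambda>V. F V z) W) \<in> borel_measurable borel"
proof (rule borel_measurable_LIMSEQ_metric)
  show "(\<lambda>n. real (Suc n) *\<^sub>R (F (W + (1 / real (Suc n)) *\<^sub>R axis k 1) z - F W z)) \<longlonglongrightarrow> partial_deriv k (\<lambda>V. F V z) W" for z
    using diff[of z] partial_deriv_LIMSEQ by blast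
qed measurable

lemma
  fixes F :: "real^'k \<Rightarrow> real^'q \<Rightarrow> real^'d"
  assumes [measurable]: "\<And>W. F W \<in> borel_measurable borel"
    and diff: "\<And>z. twice_diff_vec (\<lambda>V. F V z)"
  shows borel_measurable_partial_deriv1: "(\<lambda>z. partial_deriv k (\<lambda>V. F V z) W) \<in> borel_measurable borel"
    and borel_measurable_partial_deriv2: "(\<lambda>z. partial_deriv k (partial_deriv l (\<lambda>V. F V z)) W) \<in> borel_measurable borel"
proof -
  have 1: "(\<lambda>z. partial_deriv k (\<lambda>V. F V z) W) \<in> borel_measurable borel" for k W
  proof (rule borel_measurable_partial_deriv)
    show "\<exists>f'. ((\<lambda>V. F V z) has_derivative f') (at W)" for z
      using twice_diff_vec_derivs[OF diff[of z]] by blast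
  qed measurable
  then show "(\<lambda>z. partial_deriv k (\<lambda>V. F V z) W) \<in> borel_measurable borel" .
  show "(\<lambda>z. partial_deriv k (partial_deriv l (\<lambda>V. F V z)) W) \<in> borel_measurable borel"
  proof (rule borel_measurable_partial_deriv[of "\<lambda>W z. partial_deriv l (\<lambda>V. F V z) W"])
    show "\<exists>f'. (partial_deriv l (\<lambda>V. F V z) has_derivative f') (at W)" for z
      using twice_diff_vec_derivs[OF diff[of z]] by blast
  qed (rule 1)
qed

section \<open>Expansion of the contrasts\<close>

text \<open>The constant is the minimum of the form on the compact unit sphere; homogeneity does the
  rest.\<close>

lemma pos_def_coercive:
  fixes A :: "real^'k^'k"
  assumes "pos_def A"
  shows "\<exists>c>0. \<forall>v. c * (norm v)\<^sup>2 \<le> v \<bullet> (A *v v)"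
proof -
  have "continuous_on (sphere 0 1) (\<lambda>v. v \<bullet> (A *v v))"
    by (intro continuous_intros linear_continuous_on) (simp add: linear_linear)
  moreover have "sphere 0 1 \<noteq> ({} :: (real^'k) set)"
    by simp
  ultimately obtain u where u: "u \<in> sphere 0 1" "\<And>v. v \<in> sphere 0 1 \<Longrightarrow> u \<bullet> (A *v u) \<le> v \<bullet> (A *v v)"
    using continuous_attains_inf[OF compact_sphere] by blast
  have "u \<bullet> (A *v u) * (norm v)\<^sup>2 \<le> v \<bullet> (A *v v)" for v
  proof (cases "v = 0")
    case False
    define w where "w = v /\<^sub>R norm v"
    have "v = norm v *\<^sub>R w" using False by (simp add: w_def)
    then have "v \<bullet> (A *v v) = (norm v *\<^sub>R w) \<bullet> (A *v (norm v *\<^sub>R w))" by simp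
    also have "\<dots> = (norm v)\<^sup>2 * (w \<bullet> (A *v w))"
      by (simp add: matrix_vector_mult_scaleR power2_eq_square)
    finally have "v \<bullet> (A *v v) = (norm v)\<^sup>2 * (w \<bullet> (A *v w))" .
    moreover have "w \<in> sphere 0 1" using False by (simp add: w_def)
    ultimately show ?thesis using mult_right_mono[OF u(2)[of w] zero_le_power2[of "norm v"]] by (simp add: mult.commute)
  qed simp
  moreover have "u \<bullet> (A *v u) > 0"
  proof -
    have "u \<noteq> 0" using u(1) by auto
    then show ?thesis using assms unfolding pos_def_def by blast
  qed
  ultimately show ?thesis by blast
qed

lemma matrix_vector_mult_bounded:
  "\<exists>K>0. \<forall>v. norm ((A :: real^'n^'m) *v v) \<le> K * norm v"
  using bounded_linear.pos_bounded[OF matrix_vector_mul_bounded_linear[of A]] by (simp add: mult.commute)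

text \<open>Completing the square at \<open>hs p = matrix_inv A *v g p\<close> turns the quadratic
  model into \<open>(h - hs p) \<bullet> (A *v (h - hs p))\<close> plus a term free of
  \<open>h\<close>. Since \<open>hhat\<close> does at least as well as the competitor
  \<open>hs\<close>, coercivity bounds their distance by the two expansion errors. The part of the
  error that involves \<open>hhat\<close> is absorbed on the left.\<close>

lemma argmin_close:
  fixes V :: "'p \<Rightarrow> real^'k \<Rightarrow> real" and g hhat :: "'p \<Rightarrow> real^'k"
  assumes A: "pos_def A" and b0: "\<And>p. b p \<ge> 0" and gb: "\<And>p. norm (g p) \<le> c * b p"
    and b: "(b \<longlongrightarrow> 0) \<F>" and hhat: "(hhat \<longlongrightarrow> 0) \<F>"
    and expansion: "(\<lambda>(p, h). V p h - (h \<bullet> (A *v h) - 2 * (h \<bullet> g p))) \<in> o[\<F> \<times>\<^sub>F nhds 0](\<lambda>(p, h). (norm h)\<^sup>2 + (b p)\<^sup>2)"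
    and min: "\<forall>\<^sub>F p in \<F>. V p (hhat p) \<le> V p (matrix_inv A *v g p)"
    and \<eta>: "\<eta> > 0"
  shows "\<forall>\<^sub>F p in \<F>. norm (hhat p - matrix_inv A *v g p) \<le> \<eta> * b p"
proof -
  define J where "J = matrix_inv A"
  define hs where "hs p = J *v g p" for p
  have sym: "transpose A = A" using A by (simp add: pos_def_def)
  have inv: "invertible A" using A by (rule invertible_pos_def)
  have Ahs: "A *v hs p = g p" for p
    by (simp add: hs_def J_def matrix_vector_mul_assoc matrix_inv_mult[OF inv])
  obtain l where l: "l > 0" "\<And>v. l * (norm v)\<^sup>2 \<le> v \<bullet> (A *v v)"
    using pos_def_coercive[OF A] by blast
  obtain K where K: "K > 0" "\<And>v. norm (J *v v) \<le> K * norm v"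
    using matrix_vector_mult_bounded[of J] by blast
  define c' where "c' = K * c"
  have hs_b: "norm (hs p) \<le> c' * b p" for p
    unfolding hs_def c'_def using order_trans[OF K(2)[of "g p"] mult_left_mono[OF gb[of p], of K]] K(1) by (simp add: mult.assoc)
  have hs_b2: "(norm (hs p))\<^sup>2 \<le> c'\<^sup>2 * (b p)\<^sup>2" for p
    using power_mono[OF hs_b[of p], of 2] by (simp add: power_mult_distrib)
  have hs_lim: "(hs \<longlongrightarrow> 0) \<F>"
    by (rule Lim_null_comparison[OF _ tendsto_mult_right_zero[OF b, of c']]) (use hs_b in auto)
  \<comment> \<open>The first bound lets \<open>2 * s * (norm x)\<^sup>2\<close> be absorbed by half
    of the coercivity constant \<open>l\<close>, the second keeps the \<open>b\<close> terms below
    \<open>l / 2 * (\<eta> * b p)\<^sup>2\<close>. The factor \<open>3 * c'\<^sup>2 + 2\<close>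
    collects three copies of the square of \<open>hs\<close> and two of \<open>b\<close>.\<close>
  define s where "s = min (l / 4) (l * \<eta>\<^sup>2 / (2 * (3 * c'\<^sup>2 + 2)))"
  have den: "3 * c'\<^sup>2 + 2 > 0" by (simp add: add_nonneg_pos)
  have s: "s > 0" using l \<eta> den by (simp add: s_def)
  have s1: "2 * s \<le> l / 2" by (simp add: s_def)
  have s2: "s * (3 * c'\<^sup>2 + 2) \<le> l / 2 * \<eta>\<^sup>2"
  proof -
    have "s \<le> l * \<eta>\<^sup>2 / (2 * (3 * c'\<^sup>2 + 2))" by (simp add: s_def)
    then have "s * (3 * c'\<^sup>2 + 2) \<le> l * \<eta>\<^sup>2 / (2 * (3 * c'\<^sup>2 + 2)) * (3 * c'\<^sup>2 + 2)"
      using den by (intro mult_right_mono) auto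
    also have "\<dots> = l / 2 * \<eta>\<^sup>2"
    proof -
      have "l * \<eta>\<^sup>2 / (2 * y) * y = l / 2 * \<eta>\<^sup>2" if "y > 0" for y using that by (simp add: field_simps)
      then show ?thesis using den by blast
    qed
    finally show ?thesis .
  qed
  have ev: "\<forall>\<^sub>F x in \<F> \<times>\<^sub>F nhds 0. \<bar>V (fst x) (snd x) - (snd x \<bullet> (A *v snd x) - 2 * (snd x \<bullet> g (fst x)))\<bar>
      \<le> s * ((norm (snd x))\<^sup>2 + (b (fst x))\<^sup>2)"
    using landau_o.smallD[OF expansion s] by (simp add: case_prod_beta)
  \<comment> \<open>Evaluation of the expansion at a displacement depending on \<open>p\<close>,
    possible because the product filter makes the error uniform near 0.\<close>
  have comp: "\<forall>\<^sub>F p in \<F>. \<bar>V p (h p) - (h p \<bullet> (A *v h p) - 2 * (h p \<bullet> g p))\<bar> \<le> s * ((norm (h p))\<^sup>2 + (b p)\<^sup>2)"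
    if "(h \<longlongrightarrow> 0) \<F>" for h
    using eventually_compose_filterlim[OF ev filterlim_Pair[OF filterlim_ident that]] by simp
  show ?thesis
    unfolding J_def[symmetric] hs_def[symmetric]
    using comp[OF hhat] comp[OF hs_lim] min[folded J_def, folded hs_def]
  proof eventually_elim
    case (elim p)
    define x where "x = hhat p - hs p"
    have Q: "h \<bullet> (A *v h) - 2 * (h \<bullet> g p) = (h - hs p) \<bullet> (A *v (h - hs p)) - hs p \<bullet> g p" for h
    proof -
      have "hs p \<bullet> (A *v h) = h \<bullet> g p"
        using inner_matrix_vector_transpose[of A "hs p" h] by (simp add: sym Ahs inner_commute)
      then show ?thesis
        by (simp add: matrix_vector_mult_diff_distrib inner_diff_left inner_diff_right Ahs)
    qed
    have "x \<bullet> (A *v x) = (hhat p \<bullet> (A *v hhat p) - 2 * (hhat p \<bullet> g p)) - (hs p \<bullet> (A *v hs p) - 2 * (hs p \<bullet> g p))"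
      unfolding Q by (simp add: x_def)
    also have "\<dots> \<le> s * ((norm (hhat p))\<^sup>2 + (b p)\<^sup>2) + s * ((norm (hs p))\<^sup>2 + (b p)\<^sup>2)"
      using elim by linarith
    finally have 1: "x \<bullet> (A *v x) \<le> s * ((norm (hhat p))\<^sup>2 + (norm (hs p))\<^sup>2 + 2 * (b p)\<^sup>2)"
      by (simp add: algebra_simps)
    have "(norm (hhat p))\<^sup>2 \<le> 2 * (norm x)\<^sup>2 + 2 * (norm (hs p))\<^sup>2"
    proof -
      have "norm (hhat p) \<le> norm x + norm (hs p)"
        unfolding x_def using norm_triangle_ineq[of "hhat p - hs p" "hs p"] by simp
      then have "(norm (hhat p))\<^sup>2 \<le> (norm x + norm (hs p))\<^sup>2" by (rule power_mono) simp
      also have "\<dots> \<le> 2 * (norm x)\<^sup>2 + 2 * (norm (hs p))\<^sup>2"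
        using sum_squares_bound[of "norm x" "norm (hs p)"] by (simp add: power2_sum)
      finally show ?thesis .
    qed
    then have "(norm (hhat p))\<^sup>2 + (norm (hs p))\<^sup>2 + 2 * (b p)\<^sup>2 \<le> 2 * (norm x)\<^sup>2 + (3 * c'\<^sup>2 + 2) * (b p)\<^sup>2"
      using hs_b2[of p] by (simp add: algebra_simps)
    then have "x \<bullet> (A *v x) \<le> s * (2 * (norm x)\<^sup>2 + (3 * c'\<^sup>2 + 2) * (b p)\<^sup>2)"
      using 1 s by (meson less_imp_le mult_left_mono order_trans)
    also have "\<dots> = (2 * s) * (norm x)\<^sup>2 + (s * (3 * c'\<^sup>2 + 2)) * (b p)\<^sup>2"
      by (simp add: algebra_simps)
    also have "\<dots> \<le> (l / 2) * (norm x)\<^sup>2 + (l / 2 * \<eta>\<^sup>2) * (b p)\<^sup>2"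
      using s1 s2 by (intro add_mono mult_right_mono) auto
    finally have "(l / 2) * (norm x)\<^sup>2 \<le> (l / 2) * (\<eta>\<^sup>2 * (b p)\<^sup>2)"
      using l(2)[of x] by (simp add: algebra_simps)
    then have "(norm x)\<^sup>2 \<le> (\<eta> * b p)\<^sup>2"
      using l(1) by (simp add: power_mult_distrib)
    then show "norm (hhat p - hs p) \<le> \<eta> * b p"
      unfolding x_def[symmetric] using \<eta> b0[of p] by (rule power2_le_imp_le[OF _ mult_nonneg_nonneg[OF less_imp_le]])
  qed
qed

section \<open>The regression model and its moments\<close>

lemma vec_expand: "(v :: real^'n) = (\<Sum>i\<in>UNIV. v $ i *\<^sub>R axis i 1)"
  using basis_expansion[of v] by (simp add: scalar_mult_eq_scaleR)

lemma
  fixes v :: "'a \<Rightarrow> 'b::euclidean_space^'n"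
  assumes "\<And>i. integrable M (\<lambda>\<omega>. v \<omega> $ i)"
  shows integrable_vec: "integrable M v" and integral_vec: "(\<integral>\<omega>. v \<omega> \<partial>M) $ i = (\<integral>\<omega>. v \<omega> $ i \<partial>M)"
proof -
  have "linear (axis i :: 'b \<Rightarrow> 'b^'n)" for i
    by (rule linearI) (auto simp: axis_def vec_eq_iff)
  then have axis: "bounded_linear (axis i :: 'b \<Rightarrow> 'b^'n)" for i
    by (simp add: linear_linear)
  have "integrable M (\<lambda>\<omega>. \<Sum>i\<in>UNIV. axis i (v \<omega> $ i))"
    by (intro Bochner_Integration.integrable_sum integrable_bounded_linear[OF axis] assms)
  moreover have "(\<Sum>i\<in>UNIV. axis i (v \<omega> $ i)) = v \<omega>" for \<omega>
    by (simp add: vec_eq_iff axis_def)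
  ultimately show int: "integrable M v" by simp
  show "(\<integral>\<omega>. v \<omega> \<partial>M) $ i = (\<integral>\<omega>. v \<omega> $ i \<partial>M)"
    by (rule integral_bounded_linear[OF bounded_linear_vec_nth int, symmetric])
qed

lemma integral_mat:
  fixes A :: "'a \<Rightarrow> real^'n^'m"
  assumes "\<And>i j. integrable M (\<lambda>\<omega>. A \<omega> $ i $ j)"
  shows "(\<integral>\<omega>. A \<omega> \<partial>M) $ i $ j = (\<integral>\<omega>. A \<omega> $ i $ j \<partial>M)"
proof -
  have row: "integrable M (\<lambda>\<omega>. A \<omega> $ i)" for i
    by (rule integrable_vec) (rule assms)
  then have int: "integrable M A"
    by (rule integrable_vec)
  show "(\<integral>\<omega>. A \<omega> \<partial>M) $ i $ j = (\<integral>\<omega>. A \<omega> $ i $ j \<partial>M)"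
    using integral_bounded_linear[OF bounded_linear_vec_nth int, of i]
      integral_vec[of M "\<lambda>\<omega>. A \<omega> $ i" j] assms by simp
qed

lemma borel_measurable_nth[measurable]: "(\<lambda>v :: real^'n. v $ i) \<in> borel_measurable borel"
  by (intro borel_measurable_continuous_onI continuous_intros)

text \<open>What the asymptotics use of the network is measurability in the input, twice
  differentiability in the weights and bounds near \<open>W0\<close>; so \<open>F\<close> is an
  abstract family here. Independence of noise and input is stated at time 0, and expectations at
  other times are reduced to it by \<open>ident\<close>.\<close>

locale noisy_regression = prob_space M for M :: "'a measure" +
  fixes e :: "nat \<Rightarrow> 'a \<Rightarrow> real^'d" and Z :: "nat \<Rightarrow> 'a \<Rightarrow> real^'q"
    and F :: "real^'k \<Rightarrow> real^'q \<Rightarrow> real^'d" and W0 :: "real^'k"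
    and C \<delta> :: real and \<Gamma> :: "real^'d^'d" and I0 :: "real^'k^'k"
  assumes indep: "indep_vars (\<lambda>_. borel) (\<lambda>t \<omega>. (e t \<omega>, Z t \<omega>)) UNIV"
    and ident: "\<And>t. distr M borel (\<lambda>\<omega>. (e t \<omega>, Z t \<omega>)) = distr M borel (\<lambda>\<omega>. (e 0 \<omega>, Z 0 \<omega>))"
    and F_measurable[measurable]: "\<And>W. F W \<in> borel_measurable borel"
    and F_diff: "\<And>z. twice_diff_vec (\<lambda>V. F V z)"
    and \<delta>: "\<delta> > 0"
    and bound1: "\<And>W z k. norm (W - W0) < \<delta> \<Longrightarrow> norm (partial_deriv k (\<lambda>V. F V z) W) \<le> C * (1 + norm z)"
    and bound2: "\<And>W z k l. norm (W - W0) < \<delta> \<Longrightarrow>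
        norm (partial_deriv k (partial_deriv l (\<lambda>V. F V z)) W) \<le> C * (1 + norm z ^ 2)"
    and bound3: "\<And>W z k l. norm (W - W0) < \<delta> \<Longrightarrow>
        norm (partial_deriv k (partial_deriv l (\<lambda>V. F V z)) W - partial_deriv k (partial_deriv l (\<lambda>V. F V z)) W0)
          \<le> C * norm (W - W0) * (1 + norm z ^ 3)"
    and noise_indep: "indep_set (sets (vimage_algebra (space M) (e 0) borel)) (sets (vimage_algebra (space M) (Z 0) borel))"
    and noise_moment: "integrable M (\<lambda>\<omega>. norm (e 0 \<omega>) ^ 2)"
    and noise_centered: "(\<integral>\<omega>. e 0 \<omega> \<partial>M) = 0"
    and \<Gamma>_def: "\<Gamma> = (\<integral>\<omega>. outer (e 0 \<omega>) (e 0 \<omega>) \<partial>M)" and \<Gamma>_inv: "invertible \<Gamma>"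
    and Z_moment: "integrable M (\<lambda>\<omega>. norm (Z 0 \<omega>) ^ 3)"
    and I0_def: "I0 = info_matrix M \<Gamma> F W0 (Z 0)" and I0_pos: "pos_def I0"
begin

definition grad :: "'k \<Rightarrow> 'd \<Rightarrow> real^'q \<Rightarrow> real" where
  "grad k a z = partial_deriv k (\<lambda>V. F V z) W0 $ a"

definition hess :: "'k \<Rightarrow> 'k \<Rightarrow> 'd \<Rightarrow> real^'q \<Rightarrow> real" where
  "hess k l a z = partial_deriv k (partial_deriv l (\<lambda>V. F V z)) W0 $ a"

text \<open>A function of the pair of sample size and outcome, the shape on which
  \<open>whp M\<close> acts; the value at sample size 0 is 0.\<close>

definition avg :: "(real^'d \<Rightarrow> real^'q \<Rightarrow> real) \<Rightarrow> nat \<times> 'a \<Rightarrow> real" where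
  "avg \<psi> p = 1 / real (fst p) * (\<Sum>t=1..fst p. \<psi> (e t (snd p)) (Z t (snd p)))"

lemma rv_pair[measurable]: "random_variable borel (\<lambda>\<omega>. (e t \<omega>, Z t \<omega>))"
  using indep unfolding indep_vars_def2 by simp

lemma rv_e[measurable]: "random_variable borel (e t)"
  using measurable_compose[OF rv_pair[of t], of fst borel]
  by (simp add: borel_measurable_continuous_onI continuous_on_fst continuous_on_id)

lemma rv_Z[measurable]: "random_variable borel (Z t)"
  using measurable_compose[OF rv_pair[of t], of snd borel]
  by (simp add: borel_measurable_continuous_onI continuous_on_snd continuous_on_id)

lemma grad_measurable[measurable]: "grad k a \<in> borel_measurable borel"
  unfolding grad_def[abs_def]
  by (rule measurable_compose[OF borel_measurable_partial_deriv1[OF F_measurable F_diff] borel_measurable_nth])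

lemma hess_measurable[measurable]: "hess k l a \<in> borel_measurable borel"
  unfolding hess_def[abs_def]
  by (rule measurable_compose[OF borel_measurable_partial_deriv2[OF F_measurable F_diff] borel_measurable_nth])

lemma C_nonneg: "C \<ge> 0"
proof -
  have "0 \<le> C * (1 + norm (0 :: real^'q))"
    using order_trans[OF norm_ge_zero bound1[of W0 undefined 0]] \<delta> by simp
  then show ?thesis by simp
qed

lemma grad_bound: "\<bar>grad k a z\<bar> \<le> C * (1 + norm z)"
  unfolding grad_def using order_trans[OF component_le_norm_cart bound1[of W0 k z]] \<delta> by simp

lemma hess_bound: "\<bar>hess k l a z\<bar> \<le> C * (1 + norm z ^ 2)"
  unfolding hess_def using order_trans[OF component_le_norm_cart bound2[of W0 k l z]] \<delta> by simp

lemma iid_function: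
  fixes \<psi> :: "real^'d \<Rightarrow> real^'q \<Rightarrow> 'b::{second_countable_topology, t2_space}"
  assumes [measurable]: "case_prod \<psi> \<in> borel_measurable borel"
  shows "indep_vars (\<lambda>_. borel) (\<lambda>t \<omega>. \<psi> (e t \<omega>) (Z t \<omega>)) UNIV"
    and "distr M borel (\<lambda>\<omega>. \<psi> (e t \<omega>) (Z t \<omega>)) = distr M borel (\<lambda>\<omega>. \<psi> (e 0 \<omega>) (Z 0 \<omega>))"
proof -
  show "indep_vars (\<lambda>_. borel) (\<lambda>t \<omega>. \<psi> (e t \<omega>) (Z t \<omega>)) UNIV"
    using indep_vars_compose2[OF indep, of "\<lambda>_. case_prod \<psi>" "\<lambda>_. borel"] assms by simp
  have "distr M borel (\<lambda>\<omega>. \<psi> (e t \<omega>) (Z t \<omega>)) = distr (distr M borel (\<lambda>\<omega>. (e t \<omega>, Z t \<omega>))) borel (case_prod \<psi>)" for t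
    by (simp add: distr_distr comp_def)
  then show "distr M borel (\<lambda>\<omega>. \<psi> (e t \<omega>) (Z t \<omega>)) = distr M borel (\<lambda>\<omega>. \<psi> (e 0 \<omega>) (Z 0 \<omega>))"
    by (simp only: ident[of t])
qed

lemma avg_tendsto:
  assumes "case_prod \<psi> \<in> borel_measurable borel" and "integrable M (\<lambda>\<omega>. \<psi> (e 0 \<omega>) (Z 0 \<omega>))"
  shows "(avg \<psi> \<longlongrightarrow> expectation (\<lambda>\<omega>. \<psi> (e 0 \<omega>) (Z 0 \<omega>))) (whp M)"
  unfolding avg_def[abs_def]
  using law_of_large_numbers[OF iid_function[OF assms(1)] assms(2)] by simp

lemma avg_measurable:
  assumes [measurable]: "case_prod \<psi> \<in> borel_measurable borel"
  shows "(\<lambda>\<omega>. avg \<psi> (n, \<omega>)) \<in> borel_measurable M"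
proof -
  have [measurable]: "(\<lambda>\<omega>. \<psi> (e t \<omega>) (Z t \<omega>)) \<in> borel_measurable M" for t
    using measurable_compose[OF rv_pair[of t] assms] by simp
  show ?thesis unfolding avg_def by simp
qed

lemma integrable_e: "integrable M (\<lambda>\<omega>. norm (e 0 \<omega>))"
  by (rule square_integrable_imp_integrable) (use noise_moment in auto)

lemma integrable_Z_power:
  assumes "j \<le> 3"
  shows "integrable M (\<lambda>\<omega>. norm (Z 0 \<omega>) ^ j)"
proof (rule Bochner_Integration.integrable_bound)
  show "integrable M (\<lambda>\<omega>. 1 + norm (Z 0 \<omega>) ^ 3)" using Z_moment by simp
  have "x ^ j \<le> 1 + x ^ 3" if "x \<ge> 0" for x :: real
  proof (cases "x \<le> 1")
    case True
    then show ?thesis using that power_le_one[of x j] by (simp add: add_increasing2)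
  next
    case False
    then show ?thesis using power_increasing[OF assms, of x] by linarith
  qed
  then show "AE \<omega> in M. norm (norm (Z 0 \<omega>) ^ j) \<le> norm (1 + norm (Z 0 \<omega>) ^ 3)" by simp
qed measurable

text \<open>By independence, moments of noise and input multiply instead of competing: a product is
  integrable as soon as both factors are. In this way two noise moments and three input moments are
  enough.\<close>

lemma
  assumes [measurable]: "u \<in> borel_measurable borel" "v \<in> borel_measurable borel"
    and "integrable M (\<lambda>\<omega>. u (e 0 \<omega>) :: real)" "integrable M (\<lambda>\<omega>. v (Z 0 \<omega>))"
  shows integrable_e_Z: "integrable M (\<lambda>\<omega>. u (e 0 \<omega>) * v (Z 0 \<omega>))"
    and expectation_e_Z: "expectation (\<lambda>\<omega>. u (e 0 \<omega>) * v (Z 0 \<omega>)) = expectation (\<lambda>\<omega>. u (e 0 \<omega>)) * expectation (\<lambda>\<omega>. v (Z 0 \<omega>))"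
proof -
  have "indep_var borel (\<lambda>\<omega>. u (e 0 \<omega>)) borel (\<lambda>\<omega>. v (Z 0 \<omega>))"
    unfolding indep_var_eq
  proof (intro conjI)
    \<comment> \<open>A Borel function of \<open>X\<close> generates no more events than
      \<open>X\<close> does, so independence passes from \<open>e 0\<close> and \<open>Z 0\<close>
      to functions of them.\<close>
    have sub: "sigma_sets (space M) {(\<lambda>\<omega>. w (X \<omega>)) -` A \<inter> space M | A. A \<in> sets borel} \<subseteq>
        sets (vimage_algebra (space M) X borel)"
      if [measurable]: "w \<in> borel_measurable borel" for w :: "'z::topological_space \<Rightarrow> real" and X
    proof -
      have "(\<lambda>\<omega>. w (X \<omega>)) -` A \<inter> space M \<in> sets (vimage_algebra (space M) X borel)" if "A \<in> sets borel" for A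
      proof -
        have "X -` (w -` A \<inter> space borel) \<inter> space M \<in> sets (vimage_algebra (space M) X borel)"
          using that by (intro in_vimage_algebra measurable_sets[of w borel borel]) auto
        then show ?thesis by (simp add: vimage_def)
      qed
      then show ?thesis
        by (intro sets.sigma_sets_subset[of _ "vimage_algebra (space M) X borel", simplified space_vimage_algebra]) auto
    qed
    show "indep_set (sigma_sets (space M) {(\<lambda>\<omega>. u (e 0 \<omega>)) -` A \<inter> space M | A. A \<in> sets borel})
        (sigma_sets (space M) {(\<lambda>\<omega>. v (Z 0 \<omega>)) -` A \<inter> space M | A. A \<in> sets borel})"
      using noise_indep sub[OF assms(1), of "e 0"] sub[OF assms(2), of "Z 0"] unfolding indep_sets2_eq by blast
  qed measurable
  with assms(3,4) show "integrable M (\<lambda>\<omega>. u (e 0 \<omega>) * v (Z 0 \<omega>))"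
    and "expectation (\<lambda>\<omega>. u (e 0 \<omega>) * v (Z 0 \<omega>)) = expectation (\<lambda>\<omega>. u (e 0 \<omega>)) * expectation (\<lambda>\<omega>. v (Z 0 \<omega>))"
    by (auto intro: indep_var_integrable indep_var_lebesgue_integral)
qed

lemma integrable_e_component: "integrable M (\<lambda>\<omega>. e 0 \<omega> $ a)"
  by (rule Bochner_Integration.integrable_bound[OF integrable_e]) (auto simp: component_le_norm_cart)

lemma expectation_e_component: "expectation (\<lambda>\<omega>. e 0 \<omega> $ a) = 0"
  using integral_vec[of M "e 0" a] integrable_e_component noise_centered by simp

lemma integrable_e_e: "integrable M (\<lambda>\<omega>. e 0 \<omega> $ a * e 0 \<omega> $ b)"
proof (rule Bochner_Integration.integrable_bound[OF noise_moment])
  have "\<bar>x $ a * x $ b\<bar> \<le> norm x ^ 2" for x :: "real^'d"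
    unfolding abs_mult power2_eq_square using component_le_norm_cart by (intro mult_mono) auto
  then show "AE \<omega> in M. norm (e 0 \<omega> $ a * e 0 \<omega> $ b) \<le> norm (norm (e 0 \<omega>) ^ 2)"
    by simp
qed measurable

lemma \<Gamma>_component: "\<Gamma> $ a $ b = expectation (\<lambda>\<omega>. e 0 \<omega> $ a * e 0 \<omega> $ b)"
  unfolding \<Gamma>_def using integral_mat[of M "\<lambda>\<omega>. outer (e 0 \<omega>) (e 0 \<omega>)" a b] integrable_e_e
  by (simp add: outer_def)

lemma \<Gamma>_sym: "transpose \<Gamma> = \<Gamma>"
  by (simp add: vec_eq_iff transpose_def \<Gamma>_component mult.commute)

lemma integrable_grad: "integrable M (\<lambda>\<omega>. grad k a (Z 0 \<omega>))"
  by (rule Bochner_Integration.integrable_bound[of _ "\<lambda>\<omega>. C * (1 + norm (Z 0 \<omega>))"])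
     (use integrable_Z_power[of 1] grad_bound C_nonneg in auto)

lemma integrable_hess: "integrable M (\<lambda>\<omega>. hess k l a (Z 0 \<omega>))"
  by (rule Bochner_Integration.integrable_bound[of _ "\<lambda>\<omega>. C * (1 + norm (Z 0 \<omega>) ^ 2)"])
     (use integrable_Z_power[of 2] hess_bound C_nonneg in auto)

lemma integrable_grad_grad: "integrable M (\<lambda>\<omega>. grad k a (Z 0 \<omega>) * grad l b (Z 0 \<omega>))"
proof (rule Bochner_Integration.integrable_bound[of _ "\<lambda>\<omega>. C\<^sup>2 * (1 + norm (Z 0 \<omega>))\<^sup>2"])
  show "integrable M (\<lambda>\<omega>. C\<^sup>2 * (1 + norm (Z 0 \<omega>))\<^sup>2)"
    using integrable_Z_power[of 1] integrable_Z_power[of 2] by (simp add: power2_sum)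
  have "\<bar>grad k a z * grad l b z\<bar> \<le> C\<^sup>2 * (1 + norm z)\<^sup>2" for z
  proof -
    have "\<bar>grad k a z * grad l b z\<bar> \<le> (C * (1 + norm z)) * (C * (1 + norm z))"
      unfolding abs_mult using grad_bound C_nonneg by (intro mult_mono) auto
    then show ?thesis by (simp add: power2_eq_square ac_simps)
  qed
  then show "AE \<omega> in M. norm (grad k a (Z 0 \<omega>) * grad l b (Z 0 \<omega>)) \<le> norm (C\<^sup>2 * (1 + norm (Z 0 \<omega>))\<^sup>2)"
    by simp
qed measurable

text \<open>If the form vanished at \<open>v\<close>, then \<open>v \<bullet> e 0 \<omega>\<close>
  would be 0 almost surely. Since \<open>\<Gamma> *v v\<close> is the mean of \<open>e 0\<close>
  times this scalar, it would vanish too, against invertibility.\<close>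

lemma \<Gamma>_pos: "pos_def \<Gamma>"
  unfolding pos_def_def
proof (intro conjI allI impI \<Gamma>_sym)
  fix v :: "real^'d" assume v: "v \<noteq> 0"
  have Gv: "(\<Gamma> *v w) $ a = expectation (\<lambda>\<omega>. e 0 \<omega> $ a * (w \<bullet> e 0 \<omega>))" for w a
  proof -
    have "e 0 \<omega> $ a * (w \<bullet> e 0 \<omega>) = (\<Sum>b\<in>UNIV. (e 0 \<omega> $ a * e 0 \<omega> $ b) * w $ b)" for \<omega>
      by (simp add: inner_vec_def sum_distrib_left mult_ac)
    then have "expectation (\<lambda>\<omega>. e 0 \<omega> $ a * (w \<bullet> e 0 \<omega>)) =
        (\<Sum>b\<in>UNIV. expectation (\<lambda>\<omega>. (e 0 \<omega> $ a * e 0 \<omega> $ b) * w $ b))"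
      using integrable_e_e by simp
    also have "\<dots> = (\<Sum>b\<in>UNIV. \<Gamma> $ a $ b * w $ b)"
      by (intro sum.cong refl) (simp only: \<Gamma>_component integral_mult_left_zero)
    finally show ?thesis by (simp add: matrix_vector_mult_def)
  qed
  have int: "integrable M (\<lambda>\<omega>. e 0 \<omega> $ a * (w \<bullet> e 0 \<omega>))" for w a
  proof -
    have "e 0 \<omega> $ a * (w \<bullet> e 0 \<omega>) = (\<Sum>b\<in>UNIV. (e 0 \<omega> $ a * e 0 \<omega> $ b) * w $ b)" for \<omega>
      by (simp add: inner_vec_def sum_distrib_left mult_ac)
    then show ?thesis using integrable_e_e by simp
  qed
  have sq: "integrable M (\<lambda>\<omega>. (v \<bullet> e 0 \<omega>)\<^sup>2)"
    "expectation (\<lambda>\<omega>. (v \<bullet> e 0 \<omega>)\<^sup>2) = v \<bullet> (\<Gamma> *v v)"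
  proof -
    have eq: "(v \<bullet> e 0 \<omega>)\<^sup>2 = (\<Sum>a\<in>UNIV. v $ a * (e 0 \<omega> $ a * (v \<bullet> e 0 \<omega>)))" for \<omega>
      by (simp add: power2_eq_square inner_vec_def[of v "e 0 \<omega>"] sum_distrib_right mult.assoc)
    show "integrable M (\<lambda>\<omega>. (v \<bullet> e 0 \<omega>)\<^sup>2)" unfolding eq using int by auto
    show "expectation (\<lambda>\<omega>. (v \<bullet> e 0 \<omega>)\<^sup>2) = v \<bullet> (\<Gamma> *v v)"
      unfolding eq using int by (simp add: inner_vec_def[of v "\<Gamma> *v v"] Gv)
  qed
  have "v \<bullet> (\<Gamma> *v v) \<noteq> 0"
  proof
    assume "v \<bullet> (\<Gamma> *v v) = 0"
    then have "AE \<omega> in M. (v \<bullet> e 0 \<omega>)\<^sup>2 = 0"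
      using integral_nonneg_eq_0_iff_AE[OF sq(1)] sq(2) by simp
    then have "expectation (\<lambda>\<omega>. e 0 \<omega> $ a * (v \<bullet> e 0 \<omega>)) = expectation (\<lambda>\<omega>. 0)" for a
      by (intro integral_cong_AE) auto
    then have "\<Gamma> *v v = 0" by (simp add: vec_eq_iff Gv)
    then have "matrix_inv \<Gamma> *v (\<Gamma> *v v) = 0" by simp
    then show False using v by (simp add: matrix_vector_mul_assoc matrix_inv_mult[OF \<Gamma>_inv])
  qed
  moreover have "v \<bullet> (\<Gamma> *v v) \<ge> 0" unfolding sq(2)[symmetric] by simp
  ultimately show "v \<bullet> (\<Gamma> *v v) > 0" by simp
qed

definition P :: "real^'d^'d" where "P = matrix_inv \<Gamma>"

lemma P_sym: "P $ a $ b = P $ b $ a"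
proof -
  have "transpose P = P" unfolding P_def by (rule transpose_matrix_inv[OF \<Gamma>_inv \<Gamma>_sym])
  then have "transpose P $ a $ b = P $ a $ b" by simp
  then show ?thesis by (simp add: transpose_def)
qed

definition J :: "'k \<Rightarrow> 'd \<Rightarrow> 'k \<Rightarrow> 'd \<Rightarrow> real" where
  "J k a l b = expectation (\<lambda>\<omega>. grad k a (Z 0 \<omega>) * grad l b (Z 0 \<omega>))"

lemma I0_component: "I0 $ k $ l = (\<Sum>a\<in>UNIV. \<Sum>b\<in>UNIV. P $ a $ b * J k b l a)"
proof -
  have "(\<integral>\<omega>. outer (partial_deriv k (\<lambda>V. F V (Z 0 \<omega>)) W0) (partial_deriv l (\<lambda>V. F V (Z 0 \<omega>)) W0) \<partial>M) $ b $ a = J k b l a" for a b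
    using integral_mat[of M "\<lambda>\<omega>. outer (partial_deriv k (\<lambda>V. F V (Z 0 \<omega>)) W0) (partial_deriv l (\<lambda>V. F V (Z 0 \<omega>)) W0)" b a]
      integrable_grad_grad[of k _ l]
    by (simp add: outer_def J_def grad_def)
  then show ?thesis
    by (simp add: I0_def info_matrix_def trace_def matrix_matrix_mult_def P_def)
qed

end

text \<open>The form in which smallness arises below: an explicit random factor \<open>r\<close>,
  built from convergent averages and from norms tending to 0.\<close>

lemma smallo_factorI:
  fixes f g r :: "'x \<Rightarrow> real"
  assumes "\<forall>\<^sub>F x in \<F>. \<bar>f x\<bar> \<le> r x * \<bar>g x\<bar>" and "(r \<longlongrightarrow> 0) \<F>"
  shows "f \<in> o[\<F>](g)"
proof (rule landau_o.smallI)
  fix c :: real assume "c > 0"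
  then have "\<forall>\<^sub>F x in \<F>. r x < c" by (rule order_tendstoD(2)[OF assms(2)])
  with assms(1) show "\<forall>\<^sub>F x in \<F>. norm (f x) \<le> c * norm (g x)"
  proof eventually_elim
    case (elim x)
    have "r x * \<bar>g x\<bar> \<le> c * \<bar>g x\<bar>" using elim by (intro mult_right_mono) auto
    then show ?case using elim by simp
  qed
qed

lemma borel_measurable_pair_fst[measurable]: "fst \<in> borel_measurable (borel :: ('a::topological_space \<times> 'b::topological_space) measure)"
  by (intro borel_measurable_continuous_onI continuous_intros)

lemma borel_measurable_pair_snd[measurable]: "snd \<in> borel_measurable (borel :: ('a::topological_space \<times> 'b::topological_space) measure)"
  by (intro borel_measurable_continuous_onI continuous_intros)

lemma sum_swap3: "(\<Sum>a\<in>A. \<Sum>b\<in>B. \<Sum>c\<in>C. f a b c) = (\<Sum>c\<in>C. \<Sum>a\<in>A. \<Sum>b\<in>B. f a b c)"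
  for f :: "_ \<Rightarrow> _ \<Rightarrow> _ \<Rightarrow> real"
proof -
  have "(\<Sum>a\<in>A. \<Sum>b\<in>B. \<Sum>c\<in>C. f a b c) = (\<Sum>a\<in>A. \<Sum>c\<in>C. \<Sum>b\<in>B. f a b c)"
    by (intro sum.cong refl sum.swap)
  also have "\<dots> = (\<Sum>c\<in>C. \<Sum>a\<in>A. \<Sum>b\<in>B. f a b c)" by (rule sum.swap)
  finally show ?thesis .
qed

lemma sum_swap4: "(\<Sum>a\<in>A. \<Sum>b\<in>B. \<Sum>c\<in>C. \<Sum>d\<in>D. f a b c d) = (\<Sum>c\<in>C. \<Sum>d\<in>D. \<Sum>a\<in>A. \<Sum>b\<in>B. f a b c d)"
  for f :: "_ \<Rightarrow> _ \<Rightarrow> _ \<Rightarrow> _ \<Rightarrow> real"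
  by (subst sum_swap3) (intro sum.cong refl sum_swap3)

lemma smallo_cmult: "f \<in> o[\<F>](g) \<Longrightarrow> (\<lambda>x. c * f x) \<in> o[\<F>](g)" for f g :: "'x \<Rightarrow> real"
  by (cases "c = 0") auto

lemma bigo_cmult: "f \<in> O[\<F>](g) \<Longrightarrow> (\<lambda>x. c * f x) \<in> O[\<F>](g)" for f g :: "'x \<Rightarrow> real"
  by (cases "c = 0") auto

section \<open>Expansion of the empirical residual covariance\<close>

context noisy_regression
begin

lemma avg_add: "avg (\<lambda>x z. \<psi> x z + \<theta> x z) p = avg \<psi> p + avg \<theta> p"
  by (simp add: avg_def sum.distrib distrib_left add_divide_distrib)

lemma avg_diff: "avg (\<lambda>x z. \<psi> x z - \<theta> x z) p = avg \<psi> p - avg \<theta> p"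
  by (simp add: avg_def sum_subtractf diff_divide_distrib)

lemma avg_cmult: "avg (\<lambda>x z. c * \<psi> x z) p = c * avg \<psi> p"
  by (simp add: avg_def sum_distrib_left mult_ac)

lemma avg_sum: "avg (\<lambda>x z. \<Sum>i\<in>I. \<psi> i x z) p = (\<Sum>i\<in>I. avg (\<psi> i) p)"
  unfolding avg_def by (subst sum.swap) (simp add: sum_distrib_left)

lemma avg_abs_le:
  assumes "\<And>x z. \<bar>\<psi> x z\<bar> \<le> \<theta> x z"
  shows "\<bar>avg \<psi> p\<bar> \<le> avg \<theta> p"
proof -
  have "\<bar>\<Sum>t=1..fst p. \<psi> (e t (snd p)) (Z t (snd p))\<bar> \<le> (\<Sum>t=1..fst p. \<theta> (e t (snd p)) (Z t (snd p)))"
    by (intro order_trans[OF sum_abs] sum_mono assms)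
  then show ?thesis
    unfolding avg_def abs_mult by (simp add: divide_right_mono)
qed

text \<open>An error term that is small along this filter is small uniformly for all displacements
  in some ball around 0, outside events of vanishing probability.\<close>

abbreviation filt :: "((nat \<times> 'a) \<times> (real^'k)) filter" where
  "filt \<equiv> whp M \<times>\<^sub>F nhds 0"

lemma avg_tendsto_filt:
  assumes "case_prod \<psi> \<in> borel_measurable borel" and "integrable M (\<lambda>\<omega>. \<psi> (e 0 \<omega>) (Z 0 \<omega>))"
  shows "((\<lambda>x. avg \<psi> (fst x)) \<longlongrightarrow> expectation (\<lambda>\<omega>. \<psi> (e 0 \<omega>) (Z 0 \<omega>))) filt"
  by (rule filterlim_compose[OF avg_tendsto[OF assms] filterlim_fst])

lemma norm_snd_tendsto: "((\<lambda>x. norm (snd x)) \<longlongrightarrow> 0) filt"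
  using tendsto_norm[OF filterlim_snd[of "nhds (0::real^'k)" "whp M"]] by simp

lemma eventually_small: "\<forall>\<^sub>F x in filt. norm (snd x) < \<delta>"
  using order_tendstoD(2)[OF norm_snd_tendsto \<delta>] .

definition incr :: "real^'k \<Rightarrow> 'd \<Rightarrow> real^'q \<Rightarrow> real" where
  "incr h a z = F (W0 + h) z $ a - F W0 z $ a"

definition score :: "'d \<Rightarrow> 'k \<Rightarrow> 'd \<Rightarrow> nat \<times> 'a \<Rightarrow> real" where
  "score a k b = avg (\<lambda>x z. x $ a * grad k b z)"

text \<open>The whole array is measured, not just its contraction with \<open>P\<close>: the entries
  of the covariance increment contain individual scores, and the determinant estimate needs the size
  of every entry.\<close>

definition score_norm :: "nat \<times> 'a \<Rightarrow> real" where
  "score_norm p = sqrt (\<Sum>a\<in>UNIV. \<Sum>k\<in>UNIV. \<Sum>b\<in>UNIV. (score a k b p)\<^sup>2)"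

definition lin :: "real^'k \<Rightarrow> 'd \<Rightarrow> real^'q \<Rightarrow> real" where
  "lin h a z = (\<Sum>k\<in>UNIV. h $ k * grad k a z)"

lemma
  assumes "norm h < \<delta>"
  shows incr_bound1: "\<bar>incr h a z\<bar> \<le> real CARD('k) * (C * (1 + norm z)) * norm h"
    and incr_bound2: "\<bar>incr h a z - lin h a z\<bar> \<le> (real CARD('k))\<^sup>2 * (C * (1 + norm z ^ 2)) * (norm h)\<^sup>2"
    and incr_bound3: "\<bar>incr h a z - lin h a z - (\<Sum>k\<in>UNIV. \<Sum>l\<in>UNIV. h $ k * h $ l * hess k l a z) / 2\<bar>
        \<le> (real CARD('k))\<^sup>2 * (C * (1 + norm z ^ 3)) * norm h ^ 3"
proof -
  have b3: "norm (partial_deriv k (partial_deriv l (\<lambda>V. F V z)) W - partial_deriv k (partial_deriv l (\<lambda>V. F V z)) W0)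
      \<le> C * (1 + norm z ^ 3) * norm (W - W0)" if "norm (W - W0) < \<delta>" for k l W
    using bound3[OF that, of k l z] by (simp only: mult.assoc mult.commute[of "norm (W - W0)"])
  note T = taylor_estimates[OF F_diff[of z] assms bound1 bound2 b3, of a]
  show "\<bar>incr h a z\<bar> \<le> real CARD('k) * (C * (1 + norm z)) * norm h"
    using T(1) by (simp add: incr_def)
  show "\<bar>incr h a z - lin h a z\<bar> \<le> (real CARD('k))\<^sup>2 * (C * (1 + norm z ^ 2)) * (norm h)\<^sup>2"
    using T(2) by (simp add: incr_def lin_def grad_def)
  show "\<bar>incr h a z - lin h a z - (\<Sum>k\<in>UNIV. \<Sum>l\<in>UNIV. h $ k * h $ l * hess k l a z) / 2\<bar>
        \<le> (real CARD('k))\<^sup>2 * (C * (1 + norm z ^ 3)) * norm h ^ 3"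
    using T(3) by (simp add: incr_def lin_def grad_def hess_def)
qed

lemma lin_bound: "\<bar>lin h a z\<bar> \<le> real CARD('k) * (C * (1 + norm z)) * norm h"
proof -
  have "\<bar>h $ k * grad k a z\<bar> \<le> norm h * (C * (1 + norm z))" for k
    unfolding abs_mult using grad_bound component_le_norm_cart[of h] by (intro mult_mono) auto
  then have "\<bar>lin h a z\<bar> \<le> (\<Sum>k\<in>(UNIV::'k set). norm h * (C * (1 + norm z)))"
    unfolding lin_def by (intro order_trans[OF sum_abs] sum_mono)
  then show ?thesis by (simp add: mult_ac)
qed

text \<open>Centred noise, independent of the input, averages out against any fixed function of the
  input. This is why second derivatives of the network leave no trace in the limit Hessian.\<close>

lemma noise_hess_tendsto: "(avg (\<lambda>x z. x $ a * hess k l b z) \<longlongrightarrow> 0) (whp M)"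
proof -
  have "expectation (\<lambda>\<omega>. e 0 \<omega> $ a * hess k l b (Z 0 \<omega>)) = 0"
    using expectation_e_Z[of "\<lambda>x. x $ a" "hess k l b"] integrable_e_component integrable_hess
    by (simp add: expectation_e_component)
  moreover have "integrable M (\<lambda>\<omega>. e 0 \<omega> $ a * hess k l b (Z 0 \<omega>))"
    using integrable_e_Z[of "\<lambda>x. x $ a" "hess k l b"] integrable_e_component integrable_hess by simp
  ultimately show ?thesis
    using avg_tendsto[of "\<lambda>x z. x $ a * hess k l b z"] by (simp add: case_prod_beta')
qed

text \<open>The linear part of the network increment is kept exactly and gives the scores. The
  quadratic part averages out by \<open>noise_hess_tendsto\<close>, and the third-order remainder
  has weight \<open>norm y * (1 + norm z ^ 3)\<close>, whose mean is finite by independence.\<close>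

lemma noise_incr_expansion:
  "(\<lambda>x. avg (\<lambda>y z. y $ a * incr (snd x) b z) (fst x) - (\<Sum>k\<in>UNIV. snd x $ k * score a k b (fst x)))
    \<in> o[filt](\<lambda>x. (norm (snd x))\<^sup>2)"
proof (rule smallo_factorI)
  let ?n = "(real CARD('k))\<^sup>2"
  let ?w = "\<lambda>(y::real^'d) (z::real^'q). norm y * (1 + norm z ^ 3)"
  \<comment> \<open>Two sources of smallness: the noise averages of the second derivatives, and the
    additional factor \<open>norm h\<close> carried by the cubic remainder.\<close>
  define r where "r x = (\<Sum>k\<in>UNIV. \<Sum>l\<in>UNIV. \<bar>avg (\<lambda>y z. y $ a * hess k l b z) (fst x)\<bar>)
      + ?n * C * norm (snd x) * avg ?w (fst x)" for x :: "(nat \<times> 'a) \<times> (real^'k)"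
  have "integrable M (\<lambda>\<omega>. norm (e 0 \<omega>) * (1 + norm (Z 0 \<omega>) ^ 3))"
    using integrable_e_Z[of norm "\<lambda>z. 1 + norm z ^ 3"] integrable_e Z_moment by simp
  then have w: "((\<lambda>x. avg ?w (fst x)) \<longlongrightarrow> expectation (\<lambda>\<omega>. ?w (e 0 \<omega>) (Z 0 \<omega>))) filt"
    by (intro avg_tendsto_filt) (auto simp: case_prod_beta')
  have "(r \<longlongrightarrow> (\<Sum>k\<in>(UNIV::'k set). \<Sum>l\<in>(UNIV::'k set). \<bar>0\<bar>) + ?n * C * 0 * expectation (\<lambda>\<omega>. ?w (e 0 \<omega>) (Z 0 \<omega>))) filt"
    unfolding r_def[abs_def]
    by (intro tendsto_add tendsto_sum tendsto_rabs tendsto_mult tendsto_const norm_snd_tendsto w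
        filterlim_compose[OF noise_hess_tendsto filterlim_fst])
  then show "(r \<longlongrightarrow> 0) filt" by simp
  show "\<forall>\<^sub>F x in filt. \<bar>avg (\<lambda>y z. y $ a * incr (snd x) b z) (fst x) - (\<Sum>k\<in>UNIV. snd x $ k * score a k b (fst x))\<bar>
      \<le> r x * \<bar>(norm (snd x))\<^sup>2\<bar>"
    using eventually_small
  proof eventually_elim
    case (elim x)
    obtain p h where x: "x = (p, h)" by (cases x)
    have h: "norm h < \<delta>" using elim x by simp
    define R where "R z = incr h b z - lin h b z - (\<Sum>k\<in>UNIV. \<Sum>l\<in>UNIV. h $ k * h $ l * hess k l b z) / 2" for z
    have eq: "y $ a * incr h b z = (\<Sum>k\<in>UNIV. h $ k * (y $ a * grad k b z))
        + ((1/2) * (\<Sum>k\<in>UNIV. \<Sum>l\<in>UNIV. (h $ k * h $ l) * (y $ a * hess k l b z)) + y $ a * R z)" for y z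
      unfolding R_def lin_def
      by (simp add: sum_distrib_left right_diff_distrib mult_ac)
    have "avg (\<lambda>y z. y $ a * incr h b z) p = (\<Sum>k\<in>UNIV. h $ k * score a k b p)
        + ((1/2) * (\<Sum>k\<in>UNIV. \<Sum>l\<in>UNIV. (h $ k * h $ l) * avg (\<lambda>y z. y $ a * hess k l b z) p)
          + avg (\<lambda>y z. y $ a * R z) p)"
      unfolding eq by (simp only: avg_add avg_sum avg_cmult score_def)
    moreover have "\<bar>(1/2) * (\<Sum>k\<in>UNIV. \<Sum>l\<in>UNIV. (h $ k * h $ l) * avg (\<lambda>y z. y $ a * hess k l b z) p)\<bar>
        \<le> (norm h)\<^sup>2 * (\<Sum>k\<in>UNIV. \<Sum>l\<in>UNIV. \<bar>avg (\<lambda>y z. y $ a * hess k l b z) p\<bar>)"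
    proof -
      have "\<bar>(h $ k * h $ l) * m\<bar> \<le> (norm h)\<^sup>2 * \<bar>m\<bar>" for k l and m :: real
        unfolding abs_mult power2_eq_square
        using component_le_norm_cart[of h] by (intro mult_mono) auto
      then have "\<bar>\<Sum>k\<in>UNIV. \<Sum>l\<in>UNIV. (h $ k * h $ l) * avg (\<lambda>y z. y $ a * hess k l b z) p\<bar>
          \<le> (\<Sum>k\<in>UNIV. \<Sum>l\<in>UNIV. (norm h)\<^sup>2 * \<bar>avg (\<lambda>y z. y $ a * hess k l b z) p\<bar>)"
        by (intro order_trans[OF sum_abs] sum_mono)
      also have "\<dots> = (norm h)\<^sup>2 * (\<Sum>k\<in>UNIV. \<Sum>l\<in>UNIV. \<bar>avg (\<lambda>y z. y $ a * hess k l b z) p\<bar>)"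
        by (simp add: sum_distrib_left)
      finally show ?thesis by (rule order_trans[rotated]) (simp add: abs_mult)
    qed
    moreover have "\<bar>avg (\<lambda>y z. y $ a * R z) p\<bar> \<le> (?n * C * norm h ^ 3) * avg ?w p"
    proof -
      have "\<bar>y $ a * R z\<bar> \<le> (?n * C * norm h ^ 3) * (norm y * (1 + norm z ^ 3))" for y z
      proof -
        have "\<bar>y $ a * R z\<bar> \<le> norm y * (?n * (C * (1 + norm z ^ 3)) * norm h ^ 3)"
          unfolding abs_mult using incr_bound3[OF h, of b z] component_le_norm_cart[of y a]
          by (intro mult_mono) (auto simp: R_def)
        then show ?thesis by (simp add: mult_ac)
      qed
      then have "\<bar>avg (\<lambda>y z. y $ a * R z) p\<bar> \<le> avg (\<lambda>y z. (?n * C * norm h ^ 3) * (norm y * (1 + norm z ^ 3))) p"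
        by (rule avg_abs_le)
      then show ?thesis by (simp only: avg_cmult)
    qed
    ultimately have "\<bar>avg (\<lambda>y z. y $ a * incr h b z) p - (\<Sum>k\<in>UNIV. h $ k * score a k b p)\<bar>
        \<le> (norm h)\<^sup>2 * (\<Sum>k\<in>UNIV. \<Sum>l\<in>UNIV. \<bar>avg (\<lambda>y z. y $ a * hess k l b z) p\<bar>) + (?n * C * norm h ^ 3) * avg ?w p"
      by linarith
    also have "\<dots> = r (p, h) * \<bar>(norm h)\<^sup>2\<bar>"
      by (simp add: r_def distrib_left distrib_right power2_eq_square power3_eq_cube mult_ac)
    finally show ?case by (simp add: x)
  qed
qed

text \<open>Linearizing both increments costs a first-order bound times a second-order bound. The
  resulting weight is a cubic polynomial in \<open>norm z\<close>, just within reach of the third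
  moment of the input; no second derivative has to be identified here.\<close>

lemma incr_incr_expansion:
  "(\<lambda>x. avg (\<lambda>y z. incr (snd x) a z * incr (snd x) b z) (fst x)
      - (\<Sum>k\<in>UNIV. \<Sum>l\<in>UNIV. snd x $ k * snd x $ l * J k a l b)) \<in> o[filt](\<lambda>x. (norm (snd x))\<^sup>2)"
proof (rule smallo_factorI)
  let ?n = "real CARD('k)"
  let ?w = "\<lambda>(y::real^'d) (z::real^'q). (1 + norm z) * (1 + norm z ^ 2)"
  let ?g = "\<lambda>k l (y::real^'d) z. grad k a z * grad l b z"
  define r where "r x = (\<Sum>k\<in>UNIV. \<Sum>l\<in>UNIV. \<bar>avg (?g k l) (fst x) - J k a l b\<bar>)
      + 2 * ?n ^ 3 * C\<^sup>2 * norm (snd x) * avg ?w (fst x)" for x :: "(nat \<times> 'a) \<times> (real^'k)"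
  have "integrable M (\<lambda>\<omega>. (1 + norm (Z 0 \<omega>)) * (1 + norm (Z 0 \<omega>) ^ 2))"
  proof -
    have eq: "(1 + s) * (1 + s ^ 2) = 1 + s ^ 1 + s ^ 2 + s ^ 3" for s :: real
      by (simp add: algebra_simps power2_eq_square power3_eq_cube)
    show ?thesis unfolding eq
      by (intro Bochner_Integration.integrable_add integrable_Z_power integrable_const) auto
  qed
  then have w: "((\<lambda>x. avg ?w (fst x)) \<longlongrightarrow> expectation (\<lambda>\<omega>. ?w (e 0 \<omega>) (Z 0 \<omega>))) filt"
    by (intro avg_tendsto_filt) (auto simp: case_prod_beta')
  have g: "((\<lambda>x. avg (?g k l) (fst x)) \<longlongrightarrow> J k a l b) filt" for k l
    unfolding J_def using integrable_grad_grad[of k a l b]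
    by (intro avg_tendsto_filt) (auto simp: case_prod_beta')
  have "(r \<longlongrightarrow> (\<Sum>k\<in>(UNIV::'k set). \<Sum>l\<in>(UNIV::'k set). \<bar>J k a l b - J k a l b\<bar>)
      + 2 * ?n ^ 3 * C\<^sup>2 * 0 * expectation (\<lambda>\<omega>. ?w (e 0 \<omega>) (Z 0 \<omega>))) filt"
    unfolding r_def[abs_def]
    by (intro tendsto_add tendsto_sum tendsto_rabs tendsto_diff tendsto_mult tendsto_const norm_snd_tendsto w g)
  then show "(r \<longlongrightarrow> 0) filt" by simp
  show "\<forall>\<^sub>F x in filt. \<bar>avg (\<lambda>y z. incr (snd x) a z * incr (snd x) b z) (fst x)
      - (\<Sum>k\<in>UNIV. \<Sum>l\<in>UNIV. snd x $ k * snd x $ l * J k a l b)\<bar> \<le> r x * \<bar>(norm (snd x))\<^sup>2\<bar>"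
    using eventually_small
  proof eventually_elim
    case (elim x)
    obtain p h where x: "x = (p, h)" by (cases x)
    have h: "norm h < \<delta>" using elim x by simp
    define R where "R z = incr h a z * incr h b z - lin h a z * lin h b z" for z
    have eq: "incr h a z * incr h b z = (\<Sum>k\<in>UNIV. \<Sum>l\<in>UNIV. (h $ k * h $ l) * (grad k a z * grad l b z)) + R z" for z
      unfolding R_def lin_def by (simp add: sum_product mult_ac)
    have "avg (\<lambda>y z. incr h a z * incr h b z) p - (\<Sum>k\<in>UNIV. \<Sum>l\<in>UNIV. h $ k * h $ l * J k a l b)
        = (\<Sum>k\<in>UNIV. \<Sum>l\<in>UNIV. (h $ k * h $ l) * (avg (?g k l) p - J k a l b)) + avg (\<lambda>y z. R z) p"
      unfolding eq by (simp only: avg_add avg_sum avg_cmult right_diff_distrib sum_subtractf)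
    moreover have "\<bar>\<Sum>k\<in>UNIV. \<Sum>l\<in>UNIV. (h $ k * h $ l) * (avg (?g k l) p - J k a l b)\<bar>
        \<le> (\<Sum>k\<in>UNIV. \<Sum>l\<in>UNIV. (norm h)\<^sup>2 * \<bar>avg (?g k l) p - J k a l b\<bar>)"
    proof -
      have "\<bar>(h $ k * h $ l) * m\<bar> \<le> (norm h)\<^sup>2 * \<bar>m\<bar>" for k l and m :: real
        unfolding abs_mult power2_eq_square
        using component_le_norm_cart[of h] by (intro mult_mono) auto
      then show ?thesis by (intro order_trans[OF sum_abs] sum_mono)
    qed
    moreover have "\<bar>avg (\<lambda>y z. R z) p\<bar> \<le> (2 * ?n ^ 3 * C\<^sup>2 * norm h ^ 3) * avg ?w p"
    proof -
      \<comment> \<open>The constant counts two mixed terms, each the product of a first-order bound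
        with \<open>?n * C\<close> and a second-order bound with
        \<open>?n\<^sup>2 * C\<close>.\<close>
      have "\<bar>R z\<bar> \<le> (2 * ?n ^ 3 * C\<^sup>2 * norm h ^ 3) * ((1 + norm z) * (1 + norm z ^ 2))" for z
      proof -
        let ?A = "?n * (C * (1 + norm z)) * norm h" and ?B = "?n\<^sup>2 * (C * (1 + norm z ^ 2)) * (norm h)\<^sup>2"
        have A0: "?A \<ge> 0" using C_nonneg by simp
        have B0: "?B \<ge> 0" using C_nonneg by simp
        have "R z = incr h a z * (incr h b z - lin h b z) + (incr h a z - lin h a z) * lin h b z"
          by (simp add: R_def algebra_simps)
        moreover have "\<bar>incr h a z * (incr h b z - lin h b z)\<bar> \<le> ?A * ?B"
          unfolding abs_mult by (rule mult_mono[OF incr_bound1[OF h] incr_bound2[OF h] A0]) simp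
        moreover have "\<bar>(incr h a z - lin h a z) * lin h b z\<bar> \<le> ?B * ?A"
          unfolding abs_mult by (rule mult_mono[OF incr_bound2[OF h] lin_bound B0]) simp
        moreover have "\<bar>r\<bar> \<le> 2 * (A * B)" if "r = u + v" "\<bar>u\<bar> \<le> A * B" "\<bar>v\<bar> \<le> B * A" for r u v A B :: real
          using that mult.commute[of A B] by linarith
        ultimately have "\<bar>R z\<bar> \<le> 2 * (?A * ?B)" by blast
        also have "\<dots> = (2 * ?n ^ 3 * C\<^sup>2 * norm h ^ 3) * ((1 + norm z) * (1 + norm z ^ 2))"
          by (simp add: power2_eq_square power3_eq_cube)
        finally show ?thesis .
      qed
      then have "\<bar>avg (\<lambda>y z. R z) p\<bar> \<le> avg (\<lambda>y z. (2 * ?n ^ 3 * C\<^sup>2 * norm h ^ 3) * ((1 + norm z) * (1 + norm z ^ 2))) p"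
        by (rule avg_abs_le)
      then show ?thesis by (simp only: avg_cmult)
    qed
    ultimately have "\<bar>avg (\<lambda>y z. incr h a z * incr h b z) p - (\<Sum>k\<in>UNIV. \<Sum>l\<in>UNIV. h $ k * h $ l * J k a l b)\<bar>
        \<le> (\<Sum>k\<in>UNIV. \<Sum>l\<in>UNIV. (norm h)\<^sup>2 * \<bar>avg (?g k l) p - J k a l b\<bar>) + (2 * ?n ^ 3 * C\<^sup>2 * norm h ^ 3) * avg ?w p"
      by linarith
    also have "\<dots> = r (p, h) * \<bar>(norm h)\<^sup>2\<bar>"
    proof -
      have "s\<^sup>2 * S + (A * s ^ 3) * w = (S + A * s * w) * \<bar>s\<^sup>2\<bar>" for s S A w :: real
        by (simp add: algebra_simps power2_eq_square power3_eq_cube)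
      then show ?thesis by (simp only: r_def sum_distrib_left[symmetric] fst_conv snd_conv)
    qed
    finally show ?case by (simp add: x)
  qed
qed

text \<open>Mixed terms, displacement times score, are bounded by the sum of the two squares but by
  neither square alone.\<close>

definition rate :: "(nat \<times> 'a) \<times> (real^'k) \<Rightarrow> real" where
  "rate x = (norm (snd x))\<^sup>2 + (score_norm (fst x))\<^sup>2"

lemma rate_nonneg[simp]: "rate x \<ge> 0"
  by (simp add: rate_def)

lemma norm_sq_bigo_rate: "(\<lambda>x. (norm (snd x))\<^sup>2) \<in> O[filt](rate)"
  by (rule landau_o.bigI[of 1]) (auto simp: rate_def)

lemma score_norm_nonneg: "score_norm p \<ge> 0"
  by (simp add: score_norm_def sum_nonneg)

lemma score_norm_square: "(score_norm p)\<^sup>2 = (\<Sum>a\<in>UNIV. \<Sum>k\<in>UNIV. \<Sum>b\<in>UNIV. (score a k b p)\<^sup>2)"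
  by (simp add: score_norm_def sum_nonneg)

lemma score_le_score_norm: "\<bar>score a k b p\<bar> \<le> score_norm p"
proof -
  have "(score a k b p)\<^sup>2 \<le> (\<Sum>b\<in>UNIV. (score a k b p)\<^sup>2)"
    by (rule member_le_sum) auto
  also have "\<dots> \<le> (\<Sum>k\<in>UNIV. \<Sum>b\<in>UNIV. (score a k b p)\<^sup>2)"
    by (rule member_le_sum[where f = "\<lambda>k. \<Sum>b\<in>UNIV. (score a k b p)\<^sup>2"]) (auto intro!: sum_nonneg)
  also have "\<dots> \<le> (\<Sum>a\<in>UNIV. \<Sum>k\<in>UNIV. \<Sum>b\<in>UNIV. (score a k b p)\<^sup>2)"
    by (rule member_le_sum[where f = "\<lambda>a. \<Sum>k\<in>UNIV. \<Sum>b\<in>UNIV. (score a k b p)\<^sup>2"]) (auto intro!: sum_nonneg)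
  finally have "(score a k b p)\<^sup>2 \<le> (score_norm p)\<^sup>2" by (simp add: score_norm_square)
  then have "\<bar>score a k b p\<bar>\<^sup>2 \<le> (score_norm p)\<^sup>2" by simp
  then show ?thesis using score_norm_nonneg by (rule power2_le_imp_le)
qed

lemma score_tendsto: "(score a k b \<longlongrightarrow> 0) (whp M)"
proof -
  have "expectation (\<lambda>\<omega>. e 0 \<omega> $ a * grad k b (Z 0 \<omega>)) = 0"
    using expectation_e_Z[of "\<lambda>x. x $ a" "grad k b"] integrable_e_component integrable_grad
    by (simp add: expectation_e_component)
  moreover have "integrable M (\<lambda>\<omega>. e 0 \<omega> $ a * grad k b (Z 0 \<omega>))"
    using integrable_e_Z[of "\<lambda>x. x $ a" "grad k b"] integrable_e_component integrable_grad by simp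
  ultimately show ?thesis
    unfolding score_def using avg_tendsto[of "\<lambda>x z. x $ a * grad k b z"] by (simp add: case_prod_beta')
qed

lemma score_norm_tendsto: "(score_norm \<longlongrightarrow> 0) (whp M)"
proof -
  have "(score_norm \<longlongrightarrow> sqrt (\<Sum>a\<in>(UNIV::'d set). \<Sum>k\<in>(UNIV::'k set). \<Sum>b\<in>(UNIV::'d set). 0\<^sup>2)) (whp M)"
    unfolding score_norm_def[abs_def]
    by (intro tendsto_real_sqrt tendsto_sum tendsto_power score_tendsto)
  then show ?thesis by simp
qed

text \<open>Expressed through the displacement from \<open>W0\<close> and the noise, so that its
  increments are exactly the averages expanded above.\<close>

definition emp_cov :: "nat \<times> 'a \<Rightarrow> real^'k \<Rightarrow> real^'d^'d" where
  "emp_cov p h = (\<chi> a b. avg (\<lambda>y z. (y $ a - incr h a z) * (y $ b - incr h b z)) p)"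

definition lead :: "(nat \<times> 'a) \<times> (real^'k) \<Rightarrow> 'd \<Rightarrow> 'd \<Rightarrow> real" where
  "lead x a b = (\<Sum>k\<in>UNIV. \<Sum>l\<in>UNIV. snd x $ k * snd x $ l * J k a l b)
     - (\<Sum>k\<in>UNIV. snd x $ k * (score a k b (fst x) + score b k a (fst x)))"

definition cov_diff :: "(nat \<times> 'a) \<times> (real^'k) \<Rightarrow> real^'d^'d" where
  "cov_diff x = emp_cov (fst x) (snd x) - emp_cov (fst x) 0"

lemma incr_0[simp]: "incr 0 a z = 0"
  by (simp add: incr_def)

lemma cov_diff_expansion: "(\<lambda>x. cov_diff x $ a $ b - lead x a b) \<in> o[filt](rate)"
proof -
  have eq: "cov_diff x $ a $ b = avg (\<lambda>y z. incr (snd x) a z * incr (snd x) b z) (fst x)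
      - avg (\<lambda>y z. y $ a * incr (snd x) b z) (fst x) - avg (\<lambda>y z. y $ b * incr (snd x) a z) (fst x)" for x
    unfolding cov_diff_def emp_cov_def
    by (simp add: avg_diff[symmetric]) (simp add: algebra_simps)
  have "(\<lambda>x. cov_diff x $ a $ b - lead x a b) \<in> o[filt](\<lambda>x. (norm (snd x))\<^sup>2)"
    using sum_in_smallo(2)[OF sum_in_smallo(2)[OF incr_incr_expansion[of a b] noise_incr_expansion[of a b]] noise_incr_expansion[of b a]]
    by (simp add: eq lead_def sum.distrib distrib_left algebra_simps)
  then show ?thesis by (rule landau_o.small_big_trans[OF _ norm_sq_bigo_rate])
qed


lemma rate_tendsto: "(rate \<longlongrightarrow> 0) filt"
proof -
  have "(rate \<longlongrightarrow> 0\<^sup>2 + 0\<^sup>2) filt"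
    unfolding rate_def[abs_def]
    by (intro tendsto_add tendsto_power norm_snd_tendsto filterlim_compose[OF score_norm_tendsto filterlim_fst])
  then show ?thesis by simp
qed

lemma lead_bigo: "(\<lambda>x. lead x a b) \<in> O[filt](rate)"
proof (rule landau_o.bigI)
  let ?c = "(\<Sum>k\<in>(UNIV::'k set). \<Sum>l\<in>(UNIV::'k set). \<bar>J k a l b\<bar>) + real CARD('k)"
  show "?c + 1 > 0" by (intro add_nonneg_pos add_nonneg_nonneg sum_nonneg) auto
  show "\<forall>\<^sub>F x in filt. norm (lead x a b) \<le> (?c + 1) * norm (rate x)"
  proof (intro always_eventually allI)
    fix x :: "(nat \<times> 'a) \<times> (real^'k)"
    obtain p h where x: "x = (p, h)" by (cases x)
    \<comment> \<open>The arithmetic-geometric mean inequality brings the mixed terms under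
      \<open>rate\<close>.\<close>
    have sq: "(norm h)\<^sup>2 \<le> rate x" "norm h * (2 * score_norm p) \<le> rate x"
      using sum_squares_bound[of "norm h" "score_norm p"] by (auto simp: rate_def x)
    have "\<bar>h $ k * h $ l * J k a l b\<bar> \<le> rate x * \<bar>J k a l b\<bar>" for k l
    proof -
      have "\<bar>h $ k * h $ l\<bar> \<le> norm h * norm h"
        unfolding abs_mult using component_le_norm_cart[of h] by (intro mult_mono) auto
      then show ?thesis
        unfolding abs_mult[of "h $ k * h $ l"] using sq(1) by (intro mult_right_mono) (auto simp: power2_eq_square)
    qed
    then have 1: "\<bar>\<Sum>k\<in>UNIV. \<Sum>l\<in>UNIV. h $ k * h $ l * J k a l b\<bar> \<le> (\<Sum>k\<in>UNIV. \<Sum>l\<in>UNIV. rate x * \<bar>J k a l b\<bar>)"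
      by (intro order_trans[OF sum_abs] sum_mono)
    have "\<bar>h $ k * (score a k b p + score b k a p)\<bar> \<le> rate x" for k
    proof -
      have "\<bar>score a k b p + score b k a p\<bar> \<le> 2 * score_norm p"
        using score_le_score_norm[of a k b p] score_le_score_norm[of b k a p] by linarith
      then have "\<bar>h $ k * (score a k b p + score b k a p)\<bar> \<le> norm h * (2 * score_norm p)"
        unfolding abs_mult using component_le_norm_cart[of h k] by (intro mult_mono) auto
      then show ?thesis using sq(2) by linarith
    qed
    then have 2: "\<bar>\<Sum>k\<in>UNIV. h $ k * (score a k b p + score b k a p)\<bar> \<le> (\<Sum>k\<in>(UNIV::'k set). rate x)"
      by (intro order_trans[OF sum_abs] sum_mono)
    have "\<bar>lead x a b\<bar> \<le> (\<Sum>k\<in>UNIV. \<Sum>l\<in>UNIV. rate x * \<bar>J k a l b\<bar>) + (\<Sum>k\<in>(UNIV::'k set). rate x)"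
      unfolding lead_def using 1 2 by (simp add: x)
    also have "\<dots> = ?c * rate x"
      by (simp add: sum_distrib_left[symmetric] algebra_simps)
    also have "\<dots> \<le> (?c + 1) * rate x" by (intro mult_right_mono) auto
    finally show "norm (lead x a b) \<le> (?c + 1) * norm (rate x)" by simp
  qed
qed

lemma cov_diff_bigo: "(\<lambda>x. cov_diff x $ a $ b) \<in> O[filt](rate)"
  using sum_in_bigo(1)[OF landau_o.small_imp_big[OF cov_diff_expansion[of a b]] lead_bigo[of a b]] by simp

section \<open>Expansions of the trace and of the determinant\<close>

definition score_vec :: "nat \<times> 'a \<Rightarrow> real^'k" where
  "score_vec p = (\<chi> k. \<Sum>a\<in>UNIV. \<Sum>b\<in>UNIV. P $ a $ b * score a k b p)"

lemma I0_quadratic: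
  "(\<Sum>a\<in>UNIV. \<Sum>b\<in>UNIV. P $ a $ b * (\<Sum>k\<in>UNIV. \<Sum>l\<in>UNIV. h $ k * h $ l * J k b l a)) = h \<bullet> (I0 *v h)"
proof -
  have "(\<Sum>a\<in>UNIV. \<Sum>b\<in>UNIV. P $ a $ b * (\<Sum>k\<in>UNIV. \<Sum>l\<in>UNIV. h $ k * h $ l * J k b l a)) =
      (\<Sum>k\<in>UNIV. \<Sum>l\<in>UNIV. \<Sum>a\<in>UNIV. \<Sum>b\<in>UNIV. P $ a $ b * (h $ k * h $ l * J k b l a))"
    by (simp only: sum_distrib_left) (rule sum_swap4)
  also have "\<dots> = (\<Sum>k\<in>UNIV. \<Sum>l\<in>UNIV. h $ k * h $ l * I0 $ k $ l)"
    unfolding I0_component by (simp add: sum_distrib_left mult_ac)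
  also have "\<dots> = h \<bullet> (I0 *v h)"
    by (simp add: inner_vec_def matrix_vector_mult_def sum_distrib_left mult_ac)
  finally show ?thesis .
qed

text \<open>The two noise terms in \<open>lead\<close> differ by exchanging row and column;
  contraction with the symmetric \<open>P\<close> makes them equal, whence the factor 2 in front of
  the score.\<close>

lemma trace_lead:
  "(\<Sum>a\<in>UNIV. \<Sum>b\<in>UNIV. P $ a $ b * lead (p, h) b a) = h \<bullet> (I0 *v h) - 2 * (h \<bullet> score_vec p)"
proof -
  have sym: "(\<Sum>a\<in>UNIV. \<Sum>b\<in>UNIV. P $ a $ b * (\<Sum>k\<in>UNIV. h $ k * score b k a p)) =
      (\<Sum>a\<in>UNIV. \<Sum>b\<in>UNIV. P $ a $ b * (\<Sum>k\<in>UNIV. h $ k * score a k b p))"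
    by (subst sum.swap) (simp add: P_sym)
  have 2: "(\<Sum>a\<in>UNIV. \<Sum>b\<in>UNIV. P $ a $ b * (\<Sum>k\<in>UNIV. h $ k * score a k b p)) = h \<bullet> score_vec p"
  proof -
    have "(\<Sum>a\<in>UNIV. \<Sum>b\<in>UNIV. P $ a $ b * (\<Sum>k\<in>UNIV. h $ k * score a k b p)) =
        (\<Sum>k\<in>UNIV. \<Sum>a\<in>UNIV. \<Sum>b\<in>UNIV. P $ a $ b * (h $ k * score a k b p))"
      by (simp only: sum_distrib_left) (rule sum_swap3)
    also have "\<dots> = h \<bullet> score_vec p"
      by (simp add: inner_vec_def score_vec_def sum_distrib_left mult_ac)
    finally show ?thesis .
  qed
  have "(\<Sum>a\<in>UNIV. \<Sum>b\<in>UNIV. P $ a $ b * lead (p, h) b a) =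
      (\<Sum>a\<in>UNIV. \<Sum>b\<in>UNIV. P $ a $ b * (\<Sum>k\<in>UNIV. \<Sum>l\<in>UNIV. h $ k * h $ l * J k b l a)) -
      ((\<Sum>a\<in>UNIV. \<Sum>b\<in>UNIV. P $ a $ b * (\<Sum>k\<in>UNIV. h $ k * score b k a p)) +
       (\<Sum>a\<in>UNIV. \<Sum>b\<in>UNIV. P $ a $ b * (\<Sum>k\<in>UNIV. h $ k * score a k b p)))"
    unfolding lead_def by (simp only: fst_conv snd_conv distrib_left right_diff_distrib sum.distrib sum_subtractf)
  then show ?thesis by (simp add: I0_quadratic 2 sym)
qed

definition quad_model :: "(nat \<times> 'a) \<times> (real^'k) \<Rightarrow> real" where
  "quad_model x = snd x \<bullet> (I0 *v snd x) - 2 * (snd x \<bullet> score_vec (fst x))"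

lemma trace_expansion: "(\<lambda>x. trace (P ** cov_diff x) - quad_model x) \<in> o[filt](rate)"
proof -
  have "(\<lambda>x. \<Sum>a\<in>UNIV. \<Sum>b\<in>UNIV. P $ a $ b * (cov_diff x $ b $ a - lead x b a)) \<in> o[filt](rate)"
    by (intro big_sum_in_smallo smallo_cmult cov_diff_expansion)
  moreover have "(\<Sum>a\<in>UNIV. \<Sum>b\<in>UNIV. P $ a $ b * (cov_diff x $ b $ a - lead x b a)) = trace (P ** cov_diff x) - quad_model x" for x
    using trace_lead[of "fst x" "snd x"]
    by (simp add: quad_model_def trace_def matrix_matrix_mult_def right_diff_distrib sum_subtractf)
  ultimately show ?thesis by simp
qed

lemma emp_cov_0_tendsto: "((\<lambda>p. P ** emp_cov p 0 - mat 1) \<longlongrightarrow> 0) (whp M)"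
proof (intro vec_tendstoI)
  fix a b
  have "((\<lambda>p. emp_cov p 0 $ c $ b) \<longlongrightarrow> \<Gamma> $ c $ b) (whp M)" for c
    unfolding \<Gamma>_component emp_cov_def using integrable_e_e[of c b] avg_tendsto[of "\<lambda>y z. y $ c * y $ b"]
    by (simp add: case_prod_beta')
  then have "((\<lambda>p. (\<Sum>c\<in>UNIV. P $ a $ c * emp_cov p 0 $ c $ b) - mat 1 $ a $ b) \<longlongrightarrow>
      (\<Sum>c\<in>UNIV. P $ a $ c * \<Gamma> $ c $ b) - mat 1 $ a $ b) (whp M)"
    by (intro tendsto_diff tendsto_sum tendsto_mult tendsto_const)
  moreover have "(\<Sum>c\<in>UNIV. P $ a $ c * \<Gamma> $ c $ b) = mat 1 $ a $ b"
  proof -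
    have "(P ** \<Gamma>) $ a $ b = mat 1 $ a $ b"
      by (simp add: P_def matrix_inv_mult[OF \<Gamma>_inv])
    then show ?thesis by (simp add: matrix_matrix_mult_def)
  qed
  ultimately show "((\<lambda>p. (P ** emp_cov p 0 - mat 1) $ a $ b) \<longlongrightarrow> 0 $ a $ b) (whp M)"
    by (simp add: matrix_matrix_mult_def)
qed

text \<open>With \<open>X\<close> the deviation of \<open>P ** emp_cov p 0\<close> from the identity
  and \<open>E = P ** cov_diff x\<close>, the nonlinear error of the determinant is a multiple of
  \<open>(norm X + norm E) * norm E\<close>. The first factor tends to 0, by consistency of the
  covariance at \<open>W0\<close>, and the second is of order \<open>rate\<close>, so the expansion
  of \<open>trace E\<close> is all that remains.\<close>

lemma det_ratio_expansion:
  "(\<lambda>x. det (P ** emp_cov (fst x) (snd x)) - det (P ** emp_cov (fst x) 0) - quad_model x) \<in> o[filt](rate)"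
proof -
  define X where "X x = P ** emp_cov (fst x) 0 - mat 1" for x :: "(nat \<times> 'a) \<times> (real^'k)"
  define E where "E x = P ** cov_diff x" for x
  obtain K where K: "K \<ge> 0" "\<And>X E :: real^'d^'d. norm X \<le> 1 \<Longrightarrow> norm E \<le> 1 \<Longrightarrow>
     \<bar>det (mat 1 + X + E) - det (mat 1 + X) - trace E\<bar> \<le> K * ((norm X + norm E) * norm E)"
    using det_expansion by blast
  have X0: "((\<lambda>x. norm (X x)) \<longlongrightarrow> 0) filt"
    unfolding X_def by (rule tendsto_norm_zero[OF filterlim_compose[OF emp_cov_0_tendsto filterlim_fst]])
  \<comment> \<open>The entrywise sum dominates the norm of \<open>E\<close> and is accessible to
    the entrywise Landau bounds.\<close>
  have "(\<lambda>x. \<Sum>a\<in>UNIV. \<Sum>b\<in>UNIV. \<bar>E x $ a $ b\<bar>) \<in> O[filt](rate)"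
    unfolding E_def matrix_matrix_mult_def
    by (intro big_sum_in_bigo landau_o.big.abs_in_iff[THEN iffD2])
       (simp, intro big_sum_in_bigo bigo_cmult cov_diff_bigo)
  then obtain c where c: "c > 0" "\<forall>\<^sub>F x in filt. norm (\<Sum>a\<in>UNIV. \<Sum>b\<in>UNIV. \<bar>E x $ a $ b\<bar>) \<le> c * norm (rate x)"
    by (rule landau_o.bigE)
  have E_le: "norm (E x) \<le> (\<Sum>a\<in>UNIV. \<Sum>b\<in>UNIV. \<bar>E x $ a $ b\<bar>)" for x
  proof -
    have "norm (E x) \<le> (\<Sum>a\<in>UNIV. norm (E x $ a))"
      unfolding norm_vec_def[of "E x"] by (rule L2_set_le_sum) simp
    also have "\<dots> \<le> (\<Sum>a\<in>UNIV. \<Sum>b\<in>UNIV. \<bar>E x $ a $ b\<bar>)"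
      by (intro sum_mono norm_le_l1_cart)
    finally show ?thesis .
  qed
  have E_rate: "\<forall>\<^sub>F x in filt. norm (E x) \<le> c * rate x"
    using c(2)
  proof eventually_elim
    case (elim x)
    then show ?case using E_le[of x] by simp
  qed
  have "((\<lambda>x. c * rate x) \<longlongrightarrow> c * 0) filt" by (intro tendsto_mult tendsto_const rate_tendsto)
  then have small: "\<forall>\<^sub>F x in filt. c * rate x < 1" by (intro order_tendstoD(2)) auto
  have "(\<lambda>x. det (P ** emp_cov (fst x) (snd x)) - det (P ** emp_cov (fst x) 0) - trace (E x)) \<in> o[filt](rate)"
  proof (rule smallo_factorI)
    show "((\<lambda>x. K * (norm (X x) + c * rate x) * c) \<longlongrightarrow> 0) filt"
    proof -
      have "((\<lambda>x. K * (norm (X x) + c * rate x) * c) \<longlongrightarrow> K * (0 + c * 0) * c) filt"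
        by (intro tendsto_mult tendsto_add tendsto_const X0 rate_tendsto)
      then show ?thesis by simp
    qed
    show "\<forall>\<^sub>F x in filt. \<bar>det (P ** emp_cov (fst x) (snd x)) - det (P ** emp_cov (fst x) 0) - trace (E x)\<bar>
        \<le> K * (norm (X x) + c * rate x) * c * \<bar>rate x\<bar>"
      using order_tendstoD(2)[OF X0 zero_less_one] E_rate small
    proof eventually_elim
      case (elim x)
      have 1: "mat 1 + X x = P ** emp_cov (fst x) 0" by (simp add: X_def)
      have 2: "mat 1 + X x + E x = P ** emp_cov (fst x) (snd x)"
        unfolding 1 by (simp add: E_def cov_diff_def matrix_add_ldistrib[symmetric])
      have "\<bar>det (P ** emp_cov (fst x) (snd x)) - det (P ** emp_cov (fst x) 0) - trace (E x)\<bar>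
          \<le> K * ((norm (X x) + norm (E x)) * norm (E x))"
        using K(2)[of "X x" "E x"] elim unfolding 2 unfolding 1 by simp
      also have "\<dots> \<le> K * ((norm (X x) + c * rate x) * (c * rate x))"
        using elim K(1) c(1) by (intro mult_left_mono mult_mono add_mono) (auto intro!: add_nonneg_nonneg)
      finally show ?case by (simp add: mult.assoc)
    qed
  qed
  from sum_in_smallo(1)[OF this trace_expansion] show ?thesis unfolding E_def by (simp add: algebra_simps)
qed

lemma score_vec_bound: "norm (score_vec p) \<le> (real CARD('k) * (\<Sum>a\<in>UNIV. \<Sum>b\<in>UNIV. \<bar>P $ a $ b\<bar>)) * score_norm p"
proof -
  have "\<bar>score_vec p $ k\<bar> \<le> (\<Sum>a\<in>UNIV. \<Sum>b\<in>UNIV. \<bar>P $ a $ b\<bar> * score_norm p)" for k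
  proof -
    have "\<bar>P $ a $ b * score a k b p\<bar> \<le> \<bar>P $ a $ b\<bar> * score_norm p" for a b
      unfolding abs_mult by (intro mult_left_mono score_le_score_norm) auto
    then show ?thesis
      unfolding score_vec_def vec_lambda_beta
      by (intro order_trans[OF sum_abs] sum_mono)
  qed
  then have "norm (score_vec p) \<le> (\<Sum>k\<in>(UNIV::'k set). \<Sum>a\<in>UNIV. \<Sum>b\<in>UNIV. \<bar>P $ a $ b\<bar> * score_norm p)"
    by (intro order_trans[OF norm_le_l1_cart] sum_mono)
  then show ?thesis by (simp add: sum_distrib_right[symmetric] mult.assoc)
qed

section \<open>Second moments of the scaled scores\<close>

lemma iid_transfer:
  fixes \<psi> :: "real^'d \<Rightarrow> real^'q \<Rightarrow> real"
  assumes [measurable]: "case_prod \<psi> \<in> borel_measurable borel"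
  shows "integrable M (\<lambda>\<omega>. \<psi> (e t \<omega>) (Z t \<omega>)) \<longleftrightarrow> integrable M (\<lambda>\<omega>. \<psi> (e 0 \<omega>) (Z 0 \<omega>))"
    and "expectation (\<lambda>\<omega>. \<psi> (e t \<omega>) (Z t \<omega>)) = expectation (\<lambda>\<omega>. \<psi> (e 0 \<omega>) (Z 0 \<omega>))"
  using integrable_distr_eq[OF rv_pair[of t] assms] integrable_distr_eq[OF rv_pair[of 0] assms]
    integral_distr[OF rv_pair[of t] assms] integral_distr[OF rv_pair[of 0] assms] ident[of t]
  by simp_all

lemma score_measurable[measurable]: "(\<lambda>\<omega>. score a k b (n, \<omega>)) \<in> borel_measurable M"
  unfolding score_def by (rule avg_measurable) (simp add: case_prod_beta')

lemma score_vec_measurable[measurable]: "(\<lambda>\<omega>. score_vec (n, \<omega>)) \<in> borel_measurable M"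
proof -
  have "(\<lambda>\<omega>. \<Sum>k\<in>UNIV. (\<Sum>a\<in>UNIV. \<Sum>b\<in>UNIV. P $ a $ b * score a k b (n, \<omega>)) *\<^sub>R axis k (1::real)) \<in> borel_measurable M"
    by measurable
  then show ?thesis
    by (subst vec_expand) (simp add: score_vec_def)
qed

text \<open>Independent centred summands are orthogonal, so the second moment of the sum grows like
  \<open>n\<close>, which the normalization compensates. The bound is an equality for
  \<open>n\<close> positive and covers the value 0 at \<open>n = 0\<close>.\<close>

lemma score_moment:
  shows "integrable M (\<lambda>\<omega>. (sqrt (real n) * score a k b (n, \<omega>))\<^sup>2)"
    and "expectation (\<lambda>\<omega>. (sqrt (real n) * score a k b (n, \<omega>))\<^sup>2) \<le> expectation (\<lambda>\<omega>. (e 0 \<omega> $ a * grad k b (Z 0 \<omega>))\<^sup>2)"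
proof -
  let ?X = "\<lambda>t \<omega>. e t \<omega> $ a * grad k b (Z t \<omega>)"
  have sq0: "integrable M (\<lambda>\<omega>. (?X 0 \<omega>)\<^sup>2)"
    using integrable_e_Z[of "\<lambda>y. y $ a * y $ a" "\<lambda>z. grad k b z * grad k b z"] integrable_e_e[of a a] integrable_grad_grad[of k b k b]
    by (simp add: power2_eq_square mult_ac)
  have sq: "integrable M (\<lambda>\<omega>. (?X t \<omega>)\<^sup>2)" for t
    using iid_transfer(1)[of "\<lambda>y z. (y $ a * grad k b z)\<^sup>2" t] sq0 by (simp add: case_prod_beta')
  have mean: "expectation (?X t) = 0" for t
    using iid_transfer(2)[of "\<lambda>y z. y $ a * grad k b z" t]
      expectation_e_Z[of "\<lambda>x. x $ a" "grad k b"] integrable_e_component integrable_grad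
    by (simp add: case_prod_beta' expectation_e_component)
  have var: "expectation (\<lambda>\<omega>. (?X t \<omega>)\<^sup>2) = expectation (\<lambda>\<omega>. (?X 0 \<omega>)\<^sup>2)" for t
    using iid_transfer(2)[of "\<lambda>y z. (y $ a * grad k b z)\<^sup>2" t] by (simp add: case_prod_beta')
  have ind: "indep_vars (\<lambda>_. borel) ?X UNIV"
    using iid_function(1)[of "\<lambda>y z. y $ a * grad k b z"] by (simp add: case_prod_beta')
  note S = expectation_sum_square_indep[OF ind sq mean var finite_atLeastAtMost[of 1 n]]
  have eq: "(sqrt (real n) * score a k b (n, \<omega>))\<^sup>2 = (1 / real n) * (\<Sum>t=1..n. ?X t \<omega>)\<^sup>2" for \<omega>
    by (cases "n = 0") (auto simp: score_def avg_def power_mult_distrib power_divide power2_eq_square[of "real n"])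
  show "integrable M (\<lambda>\<omega>. (sqrt (real n) * score a k b (n, \<omega>))\<^sup>2)"
    unfolding eq using S(1) by simp
  show "expectation (\<lambda>\<omega>. (sqrt (real n) * score a k b (n, \<omega>))\<^sup>2) \<le> expectation (\<lambda>\<omega>. (?X 0 \<omega>)\<^sup>2)"
    unfolding eq using S(2) by (cases "n = 0") auto
qed

lemma score_norm_moment:
  shows "integrable M (\<lambda>\<omega>. (sqrt (real n) * score_norm (n, \<omega>))\<^sup>2)"
    and "expectation (\<lambda>\<omega>. (sqrt (real n) * score_norm (n, \<omega>))\<^sup>2) \<le>
      (\<Sum>a\<in>UNIV. \<Sum>k\<in>UNIV. \<Sum>b\<in>UNIV. expectation (\<lambda>\<omega>. (e 0 \<omega> $ a * grad k b (Z 0 \<omega>))\<^sup>2))"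
proof -
  have eq: "(sqrt (real n) * score_norm (n, \<omega>))\<^sup>2 =
      (\<Sum>a\<in>UNIV. \<Sum>k\<in>UNIV. \<Sum>b\<in>UNIV. (sqrt (real n) * score a k b (n, \<omega>))\<^sup>2)" for \<omega>
    unfolding power_mult_distrib score_norm_square by (simp only: sum_distrib_left)
  show "integrable M (\<lambda>\<omega>. (sqrt (real n) * score_norm (n, \<omega>))\<^sup>2)"
    unfolding eq by (intro Bochner_Integration.integrable_sum score_moment)
  have "expectation (\<lambda>\<omega>. (sqrt (real n) * score_norm (n, \<omega>))\<^sup>2) =
      (\<Sum>a\<in>UNIV. \<Sum>k\<in>UNIV. \<Sum>b\<in>UNIV. expectation (\<lambda>\<omega>. (sqrt (real n) * score a k b (n, \<omega>))\<^sup>2))"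
    unfolding eq by (simp only: Bochner_Integration.integral_sum score_moment Bochner_Integration.integrable_sum)
  also have "\<dots> \<le> (\<Sum>a\<in>UNIV. \<Sum>k\<in>UNIV. \<Sum>b\<in>UNIV. expectation (\<lambda>\<omega>. (e 0 \<omega> $ a * grad k b (Z 0 \<omega>))\<^sup>2))"
    by (intro sum_mono score_moment)
  finally show "expectation (\<lambda>\<omega>. (sqrt (real n) * score_norm (n, \<omega>))\<^sup>2) \<le>
      (\<Sum>a\<in>UNIV. \<Sum>k\<in>UNIV. \<Sum>b\<in>UNIV. expectation (\<lambda>\<omega>. (e 0 \<omega> $ a * grad k b (Z 0 \<omega>))\<^sup>2))" .
qed

end

lemma borel_measurable_vecI:
  fixes f :: "'x \<Rightarrow> real^'n"
  assumes "\<And>i. (\<lambda>x. f x $ i) \<in> borel_measurable N"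
  shows "f \<in> borel_measurable N"
proof -
  have "(\<lambda>x. \<Sum>i\<in>UNIV. f x $ i *\<^sub>R axis i (1::real)) \<in> borel_measurable N"
    using assms by measurable
  then show ?thesis by (subst (asm) vec_expand[symmetric])
qed

lemma tendsto_det:
  fixes A :: "'x \<Rightarrow> real^'n^'n"
  assumes "(A \<longlongrightarrow> B) \<F>"
  shows "((\<lambda>x. det (A x)) \<longlongrightarrow> det B) \<F>"
  unfolding det_def using assms by (intro tendsto_intros)

section \<open>Central limit theorem for the score\<close>

context noisy_regression
begin

text \<open>The contribution of one observation, which makes \<open>score_vec\<close> an average of
  independent identically distributed vectors.\<close>

definition summand :: "real^'d \<Rightarrow> real^'q \<Rightarrow> real^'k" where
  "summand y z = (\<chi> k. \<Sum>a\<in>UNIV. \<Sum>b\<in>UNIV. P $ a $ b * (y $ a * grad k b z))"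

text \<open>Component \<open>a\<close> of the inverse noise covariance applied to the directional
  derivative of the network along \<open>v\<close>.\<close>

definition proj :: "real^'k \<Rightarrow> 'd \<Rightarrow> real^'q \<Rightarrow> real" where
  "proj v a z = (\<Sum>b\<in>UNIV. P $ a $ b * lin v b z)"

lemma summand_measurable: "case_prod summand \<in> borel_measurable borel"
  by (rule borel_measurable_vecI) (simp add: summand_def case_prod_beta')

lemma score_vec_summand: "score_vec p = (1 / real (fst p)) *\<^sub>R (\<Sum>t=1..fst p. summand (e t (snd p)) (Z t (snd p)))"
proof (subst vec_eq_iff, intro allI)
  fix k
  have "score_vec p $ k = avg (\<lambda>y z. \<Sum>a\<in>UNIV. \<Sum>b\<in>UNIV. P $ a $ b * (y $ a * grad k b z)) p"
    by (simp only: avg_sum avg_cmult score_vec_def score_def vec_lambda_beta)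
  then show "score_vec p $ k = ((1 / real (fst p)) *\<^sub>R (\<Sum>t=1..fst p. summand (e t (snd p)) (Z t (snd p)))) $ k"
    by (simp add: avg_def summand_def)
qed

lemma inner_summand: "v \<bullet> summand y z = (\<Sum>a\<in>UNIV. y $ a * proj v a z)"
proof -
  have "v \<bullet> summand y z = (\<Sum>k\<in>UNIV. \<Sum>a\<in>UNIV. \<Sum>b\<in>UNIV. v $ k * (P $ a $ b * (y $ a * grad k b z)))"
    by (simp only: inner_vec_def inner_real_def summand_def vec_lambda_beta sum_distrib_left)
  also have "\<dots> = (\<Sum>a\<in>UNIV. \<Sum>b\<in>UNIV. \<Sum>k\<in>UNIV. v $ k * (P $ a $ b * (y $ a * grad k b z)))"
    by (rule sum_swap3[symmetric])
  also have "\<dots> = (\<Sum>a\<in>UNIV. y $ a * proj v a z)"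
    by (simp add: proj_def lin_def sum_distrib_left mult_ac)
  finally show ?thesis .
qed

lemma lin_measurable[measurable]: "lin v b \<in> borel_measurable borel"
  unfolding lin_def[abs_def] by measurable

lemma proj_measurable[measurable]: "proj v b \<in> borel_measurable borel"
  unfolding proj_def[abs_def] by measurable

lemma integrable_proj: "integrable M (\<lambda>\<omega>. proj v a (Z 0 \<omega>))"
  unfolding proj_def lin_def using integrable_grad by auto

lemma
  shows integrable_lin_lin: "integrable M (\<lambda>\<omega>. lin v b (Z 0 \<omega>) * lin v c (Z 0 \<omega>))"
    and expectation_lin_lin: "expectation (\<lambda>\<omega>. lin v b (Z 0 \<omega>) * lin v c (Z 0 \<omega>)) =
      (\<Sum>k\<in>UNIV. \<Sum>l\<in>UNIV. v $ k * v $ l * J k b l c)"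
proof -
  have eq: "lin v b z * lin v c z = (\<Sum>k\<in>UNIV. \<Sum>l\<in>UNIV. v $ k * v $ l * (grad k b z * grad l c z))" for z
    unfolding lin_def by (simp add: sum_product mult_ac)
  show "integrable M (\<lambda>\<omega>. lin v b (Z 0 \<omega>) * lin v c (Z 0 \<omega>))"
    unfolding eq by (intro Bochner_Integration.integrable_sum integrable_mult_right integrable_grad_grad)
  show "expectation (\<lambda>\<omega>. lin v b (Z 0 \<omega>) * lin v c (Z 0 \<omega>)) = (\<Sum>k\<in>UNIV. \<Sum>l\<in>UNIV. v $ k * v $ l * J k b l c)"
    unfolding eq J_def
    by (simp only: Bochner_Integration.integral_sum Bochner_Integration.integrable_sum integrable_mult_right
        integrable_grad_grad integral_mult_right_zero)
qed

lemma
  shows integrable_proj_proj: "integrable M (\<lambda>\<omega>. proj v a (Z 0 \<omega>) * proj v c (Z 0 \<omega>))"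
    and expectation_proj_proj: "expectation (\<lambda>\<omega>. proj v a (Z 0 \<omega>) * proj v c (Z 0 \<omega>)) =
      (\<Sum>b\<in>UNIV. \<Sum>b'\<in>UNIV. P $ a $ b * P $ c $ b' * (\<Sum>k\<in>UNIV. \<Sum>l\<in>UNIV. v $ k * v $ l * J k b l b'))"
proof -
  have eq: "proj v a z * proj v c z = (\<Sum>b\<in>UNIV. \<Sum>b'\<in>UNIV. P $ a $ b * P $ c $ b' * (lin v b z * lin v b' z))" for z
    unfolding proj_def by (simp add: sum_product mult_ac)
  show "integrable M (\<lambda>\<omega>. proj v a (Z 0 \<omega>) * proj v c (Z 0 \<omega>))"
    unfolding eq by (intro Bochner_Integration.integrable_sum integrable_mult_right integrable_lin_lin)
  show "expectation (\<lambda>\<omega>. proj v a (Z 0 \<omega>) * proj v c (Z 0 \<omega>)) =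
      (\<Sum>b\<in>UNIV. \<Sum>b'\<in>UNIV. P $ a $ b * P $ c $ b' * (\<Sum>k\<in>UNIV. \<Sum>l\<in>UNIV. v $ k * v $ l * J k b l b'))"
    unfolding eq expectation_lin_lin[symmetric]
    by (simp only: Bochner_Integration.integral_sum Bochner_Integration.integrable_sum integrable_mult_right
        integrable_lin_lin integral_mult_right_zero)
qed

lemma P_\<Gamma>_P: "(\<Sum>a\<in>UNIV. \<Sum>c\<in>UNIV. \<Gamma> $ a $ c * (P $ a $ b * P $ c $ b')) = P $ b $ b'"
proof -
  have "(\<Sum>a\<in>UNIV. \<Sum>c\<in>UNIV. \<Gamma> $ a $ c * (P $ a $ b * P $ c $ b')) = (P ** (\<Gamma> ** P)) $ b $ b'"
    by (simp add: matrix_matrix_mult_def sum_distrib_left P_sym[of b] mult_ac)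
  then show ?thesis by (simp add: P_def matrix_inv_mult[OF \<Gamma>_inv])
qed

text \<open>Independence separates the covariance \<open>\<Gamma>\<close> of the noise from the two
  weightings by \<open>P\<close>, and \<open>P ** \<Gamma> ** P\<close> collapses to
  \<open>P\<close>. Weighting by the inverse noise covariance is thus what makes the score
  covariance equal to \<open>I0\<close> instead of a sandwich expression.\<close>

lemma
  shows integrable_inner_summand_square: "integrable M (\<lambda>\<omega>. (v \<bullet> summand (e 0 \<omega>) (Z 0 \<omega>))\<^sup>2)"
    and expectation_inner_summand_square: "expectation (\<lambda>\<omega>. (v \<bullet> summand (e 0 \<omega>) (Z 0 \<omega>))\<^sup>2) = v \<bullet> (I0 *v v)"
proof -
  let ?D = "\<lambda>b b'. \<Sum>k\<in>UNIV. \<Sum>l\<in>UNIV. v $ k * v $ l * J k b l b'"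
  have eq: "(v \<bullet> summand y z)\<^sup>2 = (\<Sum>a\<in>UNIV. \<Sum>c\<in>UNIV. (y $ a * y $ c) * (proj v a z * proj v c z))" for y z
    unfolding inner_summand power2_eq_square by (simp add: sum_product mult_ac)
  have ac: "integrable M (\<lambda>\<omega>. (e 0 \<omega> $ a * e 0 \<omega> $ c) * (proj v a (Z 0 \<omega>) * proj v c (Z 0 \<omega>)))"
    "expectation (\<lambda>\<omega>. (e 0 \<omega> $ a * e 0 \<omega> $ c) * (proj v a (Z 0 \<omega>) * proj v c (Z 0 \<omega>))) =
      \<Gamma> $ a $ c * expectation (\<lambda>\<omega>. proj v a (Z 0 \<omega>) * proj v c (Z 0 \<omega>))" for a c
    using integrable_e_Z[of "\<lambda>y. y $ a * y $ c" "\<lambda>z. proj v a z * proj v c z"]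
      expectation_e_Z[of "\<lambda>y. y $ a * y $ c" "\<lambda>z. proj v a z * proj v c z"] integrable_e_e integrable_proj_proj
    by (simp_all add: \<Gamma>_component)
  show "integrable M (\<lambda>\<omega>. (v \<bullet> summand (e 0 \<omega>) (Z 0 \<omega>))\<^sup>2)"
    unfolding eq by (intro Bochner_Integration.integrable_sum ac)
  have "expectation (\<lambda>\<omega>. (v \<bullet> summand (e 0 \<omega>) (Z 0 \<omega>))\<^sup>2) =
      (\<Sum>a\<in>UNIV. \<Sum>c\<in>UNIV. \<Gamma> $ a $ c * (\<Sum>b\<in>UNIV. \<Sum>b'\<in>UNIV. P $ a $ b * P $ c $ b' * ?D b b'))"
    unfolding eq by (simp only: Bochner_Integration.integral_sum Bochner_Integration.integrable_sum ac expectation_proj_proj)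
  also have "\<dots> = (\<Sum>a\<in>UNIV. \<Sum>c\<in>UNIV. \<Sum>b\<in>UNIV. \<Sum>b'\<in>UNIV. \<Gamma> $ a $ c * (P $ a $ b * P $ c $ b') * ?D b b')"
    by (simp only: sum_distrib_left[of "\<Gamma> $ _ $ _"] mult.assoc)
  also have "\<dots> = (\<Sum>b\<in>UNIV. \<Sum>b'\<in>UNIV. \<Sum>a\<in>UNIV. \<Sum>c\<in>UNIV. \<Gamma> $ a $ c * (P $ a $ b * P $ c $ b') * ?D b b')"
    by (rule sum_swap4)
  also have "\<dots> = (\<Sum>b\<in>UNIV. \<Sum>b'\<in>UNIV. P $ b $ b' * ?D b b')"
    by (simp only: sum_distrib_right[symmetric] P_\<Gamma>_P)
  \<comment> \<open>A relabelling, by symmetry of \<open>P\<close>, to meet the index order of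
    \<open>I0_quadratic\<close>.\<close>
  also have "\<dots> = (\<Sum>b'\<in>UNIV. \<Sum>b\<in>UNIV. P $ b' $ b * ?D b b')"
    by (subst sum.swap) (simp add: P_sym)
  also have "\<dots> = v \<bullet> (I0 *v v)" by (rule I0_quadratic)
  finally show "expectation (\<lambda>\<omega>. (v \<bullet> summand (e 0 \<omega>) (Z 0 \<omega>))\<^sup>2) = v \<bullet> (I0 *v v)" .
qed

lemma expectation_inner_summand: "expectation (\<lambda>\<omega>. v \<bullet> summand (e 0 \<omega>) (Z 0 \<omega>)) = 0"
proof -
  have "integrable M (\<lambda>\<omega>. e 0 \<omega> $ a * proj v a (Z 0 \<omega>)) \<and> expectation (\<lambda>\<omega>. e 0 \<omega> $ a * proj v a (Z 0 \<omega>)) = 0" for a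
    using integrable_e_Z[of "\<lambda>y. y $ a" "proj v a"] expectation_e_Z[of "\<lambda>y. y $ a" "proj v a"]
      integrable_e_component integrable_proj by (simp add: expectation_e_component)
  then show ?thesis unfolding inner_summand by simp
qed

text \<open>Multiplying the summands by \<open>J0 = matrix_inv I0\<close> changes their covariance
  from \<open>I0\<close> to \<open>J0 ** I0 ** J0\<close>, that is, to \<open>J0\<close>.\<close>

lemma score_clt:
  fixes f :: "real^'k \<Rightarrow> real"
  assumes f: "continuous_on UNIV f" "\<And>x. norm x \<ge> r \<Longrightarrow> f x = 0"
  shows "(\<lambda>n. expectation (\<lambda>\<omega>. f (sqrt (real n) *\<^sub>R (matrix_inv I0 *v score_vec (n, \<omega>))))) \<longlonglongrightarrow>
    (\<integral>x. f x \<partial>multi_normal 0 (matrix_inv I0))"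
proof -
  define J0 where "J0 = matrix_inv I0"
  have J0: "pos_def J0" unfolding J0_def using I0_pos by (rule pos_def_matrix_inv)
  then have sym: "transpose J0 = J0" by (simp add: pos_def_def)
  define \<xi> where "\<xi> t \<omega> = J0 *v summand (e t \<omega>) (Z t \<omega>)" for t \<omega>
  have meas: "case_prod (\<lambda>y z. J0 *v summand y z) \<in> borel_measurable borel"
    using measurable_compose[OF summand_measurable borel_measurable_matrix_vector_mult] by (simp add: case_prod_beta')
  have inner: "u \<bullet> \<xi> t \<omega> = (J0 *v u) \<bullet> summand (e t \<omega>) (Z t \<omega>)" for u t \<omega>
    using inner_matrix_vector_transpose[of J0 u "summand (e t \<omega>) (Z t \<omega>)"] by (simp add: \<xi>_def sym)
  have cov: "(J0 *v u) \<bullet> (I0 *v (J0 *v u)) = u \<bullet> (J0 *v u)" for u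
    by (simp add: J0_def matrix_vector_mul_assoc matrix_inv_mult[OF invertible_pos_def[OF I0_pos]] inner_commute)
  have "(\<lambda>n. expectation (\<lambda>\<omega>. f ((1 / sqrt (real n)) *\<^sub>R (\<Sum>t=1..n. \<xi> t \<omega>)))) \<longlonglongrightarrow> (\<integral>x. f x \<partial>multi_normal 0 J0)"
  proof (rule central_limit_theorem_multi[OF _ _ _ _ _ J0 f])
    show "indep_vars (\<lambda>_. borel) \<xi> UNIV"
      using iid_function(1)[OF meas] unfolding \<xi>_def .
    show "distr M borel (\<xi> t) = distr M borel (\<xi> 0)" for t
      using iid_function(2)[OF meas] unfolding \<xi>_def .
    show "integrable M (\<lambda>\<omega>. (u \<bullet> \<xi> 0 \<omega>)\<^sup>2)" for u
      unfolding inner by (rule integrable_inner_summand_square)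
    show "expectation (\<lambda>\<omega>. u \<bullet> \<xi> 0 \<omega>) = 0" for u
      unfolding inner by (rule expectation_inner_summand)
    show "expectation (\<lambda>\<omega>. (u \<bullet> \<xi> 0 \<omega>)\<^sup>2) = u \<bullet> (J0 *v u)" for u
      unfolding inner expectation_inner_summand_square by (rule cov)
  qed
  moreover have "sqrt (real n) *\<^sub>R (J0 *v score_vec (n, \<omega>)) = (1 / sqrt (real n)) *\<^sub>R (\<Sum>t=1..n. \<xi> t \<omega>)" for n \<omega>
  proof -
    have "J0 *v (\<Sum>t=1..n. summand (e t \<omega>) (Z t \<omega>)) = (\<Sum>t=1..n. \<xi> t \<omega>)"
      unfolding \<xi>_def by (rule linear_sum[OF matrix_vector_mul_linear])
    then show ?thesis
      by (cases "n = 0") (simp_all add: score_vec_summand matrix_vector_mult_scaleR sqrt_divide_self_eq inverse_eq_divide)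
  qed
  ultimately show ?thesis by (simp add: J0_def)
qed

section \<open>From the expansion of a contrast to the limit law\<close>

lemma estimator_limit:
  assumes T[measurable]: "\<And>n. T n \<in> borel_measurable M"
    and consistent: "AE \<omega> in M. (\<lambda>n. T n \<omega>) \<longlonglongrightarrow> W0"
    and expansion: "(\<lambda>x. V (fst x) (snd x) - quad_model x) \<in> o[filt](rate)"
    and min: "\<forall>\<^sub>F p in whp M. V p (T (fst p) (snd p) - W0) \<le> V p (matrix_inv I0 *v score_vec p)"
  shows "converges_in_law M (\<lambda>n \<omega>. sqrt (real n) *\<^sub>R (T n \<omega> - W0)) (multi_normal 0 (matrix_inv I0))"
proof -
  have J0: "pos_def (matrix_inv I0)" using I0_pos by (rule pos_def_matrix_inv)
  define hs where "hs p = matrix_inv I0 *v score_vec p" for p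
  have hs_meas[measurable]: "(\<lambda>\<omega>. hs (n, \<omega>)) \<in> borel_measurable M" for n
    unfolding hs_def by measurable
  have score_norm_meas[measurable]: "(\<lambda>\<omega>. score_norm (n, \<omega>)) \<in> borel_measurable M" for n
    unfolding score_norm_def by measurable
  have hhat: "((\<lambda>p. T (fst p) (snd p) - W0) \<longlongrightarrow> 0) (whp M)"
    using tendsto_diff[OF tendsto_whp_AE[OF T consistent] tendsto_const[of W0]] by simp
  \<comment> \<open>Consistency is what places the displacement of the estimator in the region where
    the local expansion is valid.\<close>
  have close: "\<forall>\<^sub>F p in whp M. norm ((T (fst p) (snd p) - W0) - hs p) \<le> \<eta> * score_norm p" if "\<eta> > 0" for \<eta>
    unfolding hs_def
    by (rule argmin_close[OF I0_pos score_norm_nonneg score_vec_bound score_norm_tendsto hhat _ min that])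
       (use expansion in \<open>simp add: quad_model_def[abs_def] rate_def[abs_def] case_prod_beta'\<close>)
  \<comment> \<open>The gap between estimator and linear step on the scale of the limit law. By
    \<open>close\<close> it is an arbitrarily small multiple of
    \<open>sqrt (real n) * score_norm (n, \<omega>)\<close>, which is bounded in mean
    square.\<close>
  define R where "R n \<omega> = sqrt (real n) *\<^sub>R (T n \<omega> - W0) - sqrt (real n) *\<^sub>R hs (n, \<omega>)" for n \<omega>
  have R_lim: "((\<lambda>p. R (fst p) (snd p)) \<longlongrightarrow> 0) (whp M)"
  proof (rule tendsto_whp_tight[where b = "\<lambda>n \<omega>. sqrt (real n) * score_norm (n, \<omega>)", OF _ _ score_norm_moment])
    fix \<eta> :: real assume "\<eta> > 0"
    from close[OF this]
    show "\<forall>\<^sub>F p in whp M. norm (R (fst p) (snd p)) \<le> \<eta> * \<bar>sqrt (real (fst p)) * score_norm (fst p, snd p)\<bar>"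
    proof eventually_elim
      case (elim p)
      have "norm (R (fst p) (snd p)) = sqrt (real (fst p)) * norm ((T (fst p) (snd p) - W0) - hs p)"
        unfolding R_def scaleR_diff_right[symmetric] by simp
      also have "\<dots> \<le> sqrt (real (fst p)) * (\<eta> * score_norm p)"
        using elim by (rule mult_left_mono) simp
      finally show ?case using score_norm_nonneg[of p] by (simp add: abs_mult mult_ac)
    qed
  qed (auto simp: R_def)
  show ?thesis
  proof (rule converges_in_law_compact_supportI[OF prob_space_axioms prob_space_multi_normal[OF J0] sets_multi_normal])
    show "(\<lambda>\<omega>. sqrt (real n) *\<^sub>R (T n \<omega> - W0)) \<in> borel_measurable M" for n by measurable
    fix f :: "real^'k \<Rightarrow> real" and r
    assume f: "continuous_on UNIV f" "\<And>x. norm x \<ge> r \<Longrightarrow> f x = 0"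
    show "(\<lambda>n. expectation (\<lambda>\<omega>. f (sqrt (real n) *\<^sub>R (T n \<omega> - W0)))) \<longlonglongrightarrow> (\<integral>x. f x \<partial>multi_normal 0 (matrix_inv I0))"
    proof (rule slutsky_compact_support[OF _ _ f])
      show "(\<lambda>n. expectation (\<lambda>\<omega>. f (sqrt (real n) *\<^sub>R hs (n, \<omega>)))) \<longlonglongrightarrow> (\<integral>x. f x \<partial>multi_normal 0 (matrix_inv I0))"
        unfolding hs_def by (rule score_clt[OF f])
      show "((\<lambda>p. sqrt (real (fst p)) *\<^sub>R (T (fst p) (snd p) - W0) - sqrt (real (fst p)) *\<^sub>R hs (fst p, snd p)) \<longlongrightarrow> 0) (whp M)"
        using R_lim by (simp add: R_def)
    qed measurable
  qed
qed

lemma score_vec_step_tendsto: "((\<lambda>p. matrix_inv I0 *v score_vec p) \<longlongrightarrow> 0) (whp M)"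
proof -
  obtain K where K: "K > 0" "\<And>v. norm (matrix_inv I0 *v v) \<le> K * norm v"
    using matrix_vector_mult_bounded[of "matrix_inv I0"] by blast
  let ?c = "real CARD('k) * (\<Sum>a\<in>UNIV. \<Sum>b\<in>UNIV. \<bar>P $ a $ b\<bar>)"
  show ?thesis
  proof (rule Lim_null_comparison)
    show "\<forall>\<^sub>F p in whp M. norm (matrix_inv I0 *v score_vec p) \<le> K * (?c * score_norm p)"
      using K by (intro always_eventually allI order_trans[OF K(2)] mult_left_mono score_vec_bound) auto
    have "((\<lambda>p. K * (?c * score_norm p)) \<longlongrightarrow> K * (?c * 0)) (whp M)"
      by (intro tendsto_mult tendsto_const score_norm_tendsto)
    then show "((\<lambda>p. K * (?c * score_norm p)) \<longlongrightarrow> 0) (whp M)" by simp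
  qed
qed

text \<open>The competitor must be admissible: it tends to \<open>W0\<close>, an interior point, and
  so lies in \<open>\<Theta>\<close> with probability tending to 1. The contrast takes values in any
  linear order, to serve both the real and the extended real case.\<close>

lemma eventually_argmin:
  fixes U :: "nat \<Rightarrow> 'a \<Rightarrow> real^'k \<Rightarrow> 'c::linorder"
  assumes W0: "W0 \<in> interior \<Theta>"
    and argmin: "AE \<omega> in M. \<forall>n\<ge>1. is_arg_min (U n \<omega>) (\<lambda>W. W \<in> \<Theta>) (T n \<omega>)"
  shows "\<forall>\<^sub>F p in whp M. U (fst p) (snd p) (T (fst p) (snd p)) \<le> U (fst p) (snd p) (W0 + matrix_inv I0 *v score_vec p)"
proof -
  have "((\<lambda>p. W0 + matrix_inv I0 *v score_vec p) \<longlongrightarrow> W0 + 0) (whp M)"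
    by (intro tendsto_add tendsto_const score_vec_step_tendsto)
  then have "\<forall>\<^sub>F p in whp M. W0 + matrix_inv I0 *v score_vec p \<in> interior \<Theta>"
    by (rule topological_tendstoD) (use W0 in auto)
  moreover have "\<forall>\<^sub>F p in whp M. is_arg_min (U (fst p) (snd p)) (\<lambda>W. W \<in> \<Theta>) (T (fst p) (snd p))"
    by (rule eventually_whp_AE[of 1]) (use argmin in simp)
  ultimately show ?thesis
  proof eventually_elim
    case (elim p)
    then have "W0 + matrix_inv I0 *v score_vec p \<in> \<Theta>" using interior_subset by blast
    then show ?case using elim(2) by (auto simp: is_arg_min_def not_less)
  qed
qed

section \<open>The two contrasts in terms of the empirical covariance\<close>

lemma residual_component:
  assumes "\<And>t. y t = F W0 (Z t \<omega>) + e t \<omega>"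
  shows "(y t - F (W0 + h) (Z t \<omega>)) $ a = e t \<omega> $ a - incr h a (Z t \<omega>)"
  by (simp add: assms incr_def)

lemma empirical_covariance:
  assumes y: "\<And>t. y t = F W0 (Z t \<omega>) + e t \<omega>"
  shows "(1 / real n) *\<^sub>R (\<Sum>t=1..n. outer (y t - F (W0 + h) (Z t \<omega>)) (y t - F (W0 + h) (Z t \<omega>))) = emp_cov (n, \<omega>) h"
  unfolding vec_eq_iff
  by (simp add: emp_cov_def avg_def outer_def residual_component[OF y] del: vector_minus_component)

text \<open>A quadratic form \<open>r \<bullet> (P *v r)\<close> is the trace of \<open>P\<close>
  times the outer square of \<open>r\<close>.\<close>

lemma gls_contrast_eq:
  assumes y: "\<And>t. y t = F W0 (Z t \<omega>) + e t \<omega>"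
  shows "gls_contrast \<Gamma> F y (\<lambda>t. Z t \<omega>) n (W0 + h) = trace (P ** emp_cov (n, \<omega>) h)"
proof -
  let ?r = "\<lambda>t. y t - F (W0 + h) (Z t \<omega>)"
  have "(\<Sum>t=1..n. ?r t \<bullet> (P *v ?r t)) = (\<Sum>t=1..n. \<Sum>a\<in>UNIV. \<Sum>b\<in>UNIV. P $ a $ b * (?r t $ b * ?r t $ a))"
    by (simp add: inner_vec_def matrix_vector_mult_def sum_distrib_left mult_ac del: vector_minus_component)
  also have "\<dots> = (\<Sum>a\<in>UNIV. \<Sum>b\<in>UNIV. \<Sum>t=1..n. P $ a $ b * (?r t $ b * ?r t $ a))"
    by (rule sum_swap3[symmetric])
  finally show ?thesis
    by (simp add: gls_contrast_def P_def[symmetric] empirical_covariance[OF y, symmetric] trace_def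
        matrix_matrix_mult_def outer_def sum_distrib_left mult_ac del: vector_minus_component)
qed

lemma gls_limit:
  assumes T: "\<And>n. T n \<in> borel_measurable M"
    and consistent: "AE \<omega> in M. (\<lambda>n. T n \<omega>) \<longlonglongrightarrow> W0"
    and W0: "W0 \<in> interior \<Theta>"
    and argmin: "AE \<omega> in M. \<forall>n\<ge>1. is_arg_min
        (gls_contrast \<Gamma> F (\<lambda>t. F W0 (Z t \<omega>) + e t \<omega>) (\<lambda>t. Z t \<omega>) n) (\<lambda>W. W \<in> \<Theta>) (T n \<omega>)"
  shows "converges_in_law M (\<lambda>n \<omega>. sqrt (real n) *\<^sub>R (T n \<omega> - W0)) (multi_normal 0 (matrix_inv I0))"
proof (rule estimator_limit[OF T consistent, where V = "\<lambda>p h. trace (P ** emp_cov p h) - trace (P ** emp_cov p 0)"])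
  have "trace (P ** emp_cov (fst x) (snd x)) - trace (P ** emp_cov (fst x) 0) = trace (P ** cov_diff x)" for x
  proof -
    have "emp_cov (fst x) (snd x) = emp_cov (fst x) 0 + cov_diff x" by (simp add: cov_diff_def)
    then show ?thesis by (simp add: matrix_add_ldistrib trace_add)
  qed
  then show "(\<lambda>x. trace (P ** emp_cov (fst x) (snd x)) - trace (P ** emp_cov (fst x) 0) - quad_model x) \<in> o[filt](rate)"
    using trace_expansion by simp
  let ?U = "\<lambda>n \<omega>. gls_contrast \<Gamma> F (\<lambda>t. F W0 (Z t \<omega>) + e t \<omega>) (\<lambda>t. Z t \<omega>) n"
  have U: "?U n \<omega> W = trace (P ** emp_cov (n, \<omega>) (W - W0))" for n \<omega> W
    using gls_contrast_eq[of "\<lambda>t. F W0 (Z t \<omega>) + e t \<omega>" \<omega> n "W - W0"] by simp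
  show "\<forall>\<^sub>F p in whp M. trace (P ** emp_cov p (T (fst p) (snd p) - W0)) - trace (P ** emp_cov p 0) \<le>
      trace (P ** emp_cov p (matrix_inv I0 *v score_vec p)) - trace (P ** emp_cov p 0)"
    using eventually_argmin[OF W0 argmin] unfolding U by simp
qed

lemma score_vec_tendsto: "(score_vec \<longlongrightarrow> 0) (whp M)"
proof (rule Lim_null_comparison)
  let ?c = "real CARD('k) * (\<Sum>a\<in>UNIV. \<Sum>b\<in>UNIV. \<bar>P $ a $ b\<bar>)"
  show "\<forall>\<^sub>F p in whp M. norm (score_vec p) \<le> ?c * score_norm p"
    by (intro always_eventually allI score_vec_bound)
  show "((\<lambda>p. ?c * score_norm p) \<longlongrightarrow> 0) (whp M)"
    by (rule tendsto_mult_right_zero[OF score_norm_tendsto])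
qed

text \<open>Guards against the constant value of \<open>ereal_ln\<close> on nonpositive arguments: a
  comparison of logarithms yields one of determinants when the competitor has a positive
  determinant. At the competitor, \<open>det (P ** emp_cov p h)\<close> differs from its value at
  \<open>h = 0\<close> by a vanishing increment, and that value tends to 1.\<close>

lemma eventually_det_pos: "\<forall>\<^sub>F p in whp M. det (emp_cov p (matrix_inv I0 *v score_vec p)) > 0"
proof -
  define D where "D x = det (P ** emp_cov (fst x) (snd x)) - det (P ** emp_cov (fst x) 0)" for x
  have P_pos: "det P > 0"
    unfolding P_def by (intro pos_def_det_pos pos_def_matrix_inv \<Gamma>_pos)
  have snd0: "(snd \<longlongrightarrow> (0 :: real^'k)) filt" by (rule filterlim_snd)
  have "(quad_model \<longlongrightarrow> 0 \<bullet> (I0 *v 0) - 2 * (0 \<bullet> (0 :: real^'k))) filt"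
    unfolding quad_model_def[abs_def]
    by (intro tendsto_diff tendsto_mult tendsto_const tendsto_inner snd0 filterlim_compose[OF score_vec_tendsto filterlim_fst]
        bounded_linear.tendsto[OF matrix_vector_mul_bounded_linear])
  moreover have "((\<lambda>x. D x - quad_model x) \<longlongrightarrow> 0) filt"
    using landau_o.smallD[OF det_ratio_expansion zero_less_one]
    by (intro Lim_null_comparison[OF _ rate_tendsto]) (simp add: D_def)
  ultimately have "(D \<longlongrightarrow> 0) filt"
    using tendsto_add[of "\<lambda>x. D x - quad_model x" 0 filt quad_model 0] by simp
  then have 1: "((\<lambda>p. D (p, matrix_inv I0 *v score_vec p)) \<longlongrightarrow> 0) (whp M)"
    using filterlim_compose[OF _ filterlim_Pair[OF filterlim_ident score_vec_step_tendsto]] by blast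
  have "((\<lambda>p. P ** emp_cov p 0) \<longlongrightarrow> mat 1) (whp M)"
    using emp_cov_0_tendsto by (simp add: LIM_zero_iff)
  then have "((\<lambda>p. det (P ** emp_cov p 0)) \<longlongrightarrow> det (mat 1 :: real^'d^'d)) (whp M)"
    by (rule tendsto_det)
  from tendsto_add[OF 1 this]
  have "((\<lambda>p. det (P ** emp_cov p (matrix_inv I0 *v score_vec p))) \<longlongrightarrow> 1) (whp M)"
    by (simp add: D_def)
  then have "\<forall>\<^sub>F p in whp M. det (P ** emp_cov p (matrix_inv I0 *v score_vec p)) > 0"
    by (rule order_tendstoD(1)) simp
  then show ?thesis
    by eventually_elim (use P_pos in \<open>simp add: det_mul zero_less_mult_iff\<close>)
qed

lemma ereal_ln_le_imp_le:
  assumes "ereal_ln x \<le> ereal_ln y" "y > 0"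
  shows "x \<le> y"
  using assms by (cases "x \<le> 0") (auto simp: ereal_ln_def)

lemma logdet_limit:
  assumes T: "\<And>n. T n \<in> borel_measurable M"
    and consistent: "AE \<omega> in M. (\<lambda>n. T n \<omega>) \<longlonglongrightarrow> W0"
    and W0: "W0 \<in> interior \<Theta>"
    and argmin: "AE \<omega> in M. \<forall>n\<ge>1. is_arg_min
        (logdet_contrast F (\<lambda>t. F W0 (Z t \<omega>) + e t \<omega>) (\<lambda>t. Z t \<omega>) n) (\<lambda>W. W \<in> \<Theta>) (T n \<omega>)"
  shows "converges_in_law M (\<lambda>n \<omega>. sqrt (real n) *\<^sub>R (T n \<omega> - W0)) (multi_normal 0 (matrix_inv I0))"
proof (rule estimator_limit[OF T consistent, where V = "\<lambda>p h. det (P ** emp_cov p h) - det (P ** emp_cov p 0)"])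
  show "(\<lambda>x. det (P ** emp_cov (fst x) (snd x)) - det (P ** emp_cov (fst x) 0) - quad_model x) \<in> o[filt](rate)"
    by (rule det_ratio_expansion)
  \<comment> \<open>Multiplication by this constant preserves the order between determinants, so
    minimality carries over to the normalized \<open>det (P ** emp_cov p h)\<close> for which the
    expansion holds.\<close>
  have P_pos: "det P > 0"
    unfolding P_def by (intro pos_def_det_pos pos_def_matrix_inv \<Gamma>_pos)
  let ?U = "\<lambda>n \<omega>. logdet_contrast F (\<lambda>t. F W0 (Z t \<omega>) + e t \<omega>) (\<lambda>t. Z t \<omega>) n"
  have U: "?U n \<omega> W = ereal_ln (det (emp_cov (n, \<omega>) (W - W0)))" for n \<omega> W
    using empirical_covariance[of "\<lambda>t. F W0 (Z t \<omega>) + e t \<omega>" \<omega> n "W - W0"] by (simp add: logdet_contrast_def)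
  show "\<forall>\<^sub>F p in whp M. det (P ** emp_cov p (T (fst p) (snd p) - W0)) - det (P ** emp_cov p 0) \<le>
      det (P ** emp_cov p (matrix_inv I0 *v score_vec p)) - det (P ** emp_cov p 0)"
    using eventually_argmin[OF W0 argmin] eventually_det_pos unfolding U
  proof eventually_elim
    case (elim p)
    then have "det (emp_cov p (T (fst p) (snd p) - W0)) \<le> det (emp_cov p (matrix_inv I0 *v score_vec p))"
      by (auto intro: ereal_ln_le_imp_le)
    then show ?case using P_pos by (simp add: det_mul)
  qed
qed

end


section \<open>Both estimators in the multilayer perceptron model\<close>

theorem proposition1:
  fixes M :: "'a measure"
    and Y \<epsilon> :: "nat \<Rightarrow> 'a \<Rightarrow> real^'d"
    and Z :: "nat \<Rightarrow> 'a \<Rightarrow> real^'q"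
    and \<phi> :: "nat \<Rightarrow> real \<Rightarrow> real"
    and hs :: "nat list"
    and idx :: "nat \<times> nat \<times> nat \<Rightarrow> 'k::finite"
    and F :: "real^'k \<Rightarrow> real^'q \<Rightarrow> real^'d"
    and \<Theta> :: "(real^'k) set"
    and W0 :: "real^'k"
    and What Wstar :: "nat \<Rightarrow> 'a \<Rightarrow> real^'k"
    and \<Gamma>0 :: "real^'d^'d"
    and I0 :: "real^'k^'k"
  assumes prob: "prob_space M"
    \<comment> \<open>the family of regression functions: an MLP with a given architecture\<close>
    and F_def: "F = mlp \<phi> hs idx"
    and idx: "bij_betw idx (mlp_slots (mlp_widths hs TYPE('q) TYPE('d))) UNIV"
    and activation: "\<And>l. l \<le> length hs \<Longrightarrow>
          \<phi> l differentiable_on UNIV \<and> deriv (\<phi> l) C1_differentiable_on UNIV"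
    and W0: "W0 \<in> interior \<Theta>"
    \<comment> \<open>the model; \<open>(Y 0, Z 0)\<close> serves as the generic pair\<close>
    and indep: "prob_space.indep_vars M (\<lambda>_. borel) (\<lambda>t \<omega>. (Y t \<omega>, Z t \<omega>)) UNIV"
    and ident: "\<And>t. distr M borel (\<lambda>\<omega>. (Y t \<omega>, Z t \<omega>)) = distr M borel (\<lambda>\<omega>. (Y 0 \<omega>, Z 0 \<omega>))"
    and model: "\<And>t \<omega>. \<omega> \<in> space M \<Longrightarrow> Y t \<omega> = F W0 (Z t \<omega>) + \<epsilon> t \<omega>"
    and noise_indep: "prob_space.indep_set M
          (sets (vimage_algebra (space M) (\<epsilon> 0) borel)) (sets (vimage_algebra (space M) (Z 0) borel))"
    and noise_moment: "integrable M (\<lambda>\<omega>. norm (\<epsilon> 0 \<omega>) ^ 2)"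
    and noise_centered: "(\<integral>\<omega>. \<epsilon> 0 \<omega> \<partial>M) = 0"
    and Gamma0: "\<Gamma>0 = covariance_matrix M (\<epsilon> 0)" "invertible \<Gamma>0"
    and Z_moment: "integrable M (\<lambda>\<omega>. norm (Z 0 \<omega>) ^ 3)"
    \<comment> \<open>the growth and Lipschitz bounds for the MLP function, locally around \<open>W0\<close>\<close>
    and bounds: "\<exists>C. \<forall>\<^sub>F W in nhds W0. \<forall>z k l.
          norm (partial_deriv k (\<lambda>V. F V z) W) \<le> C * (1 + norm z) \<and>
          norm (partial_deriv k (partial_deriv l (\<lambda>V. F V z)) W) \<le> C * (1 + norm z ^ 2) \<and>
          norm (partial_deriv k (partial_deriv l (\<lambda>V. F V z)) W
                - partial_deriv k (partial_deriv l (\<lambda>V. F V z)) W0)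
            \<le> C * norm (W - W0) * (1 + norm z ^ 3)"
    \<comment> \<open>positive definite limit Hessian\<close>
    and I0: "I0 = info_matrix M \<Gamma>0 F W0 (Z 0)" "pos_def (2 *\<^sub>R I0)"
    \<comment> \<open>the estimators, both strongly consistent\<close>
    and What_measurable: "\<And>n. What n \<in> borel_measurable M"
    and What_argmin: "AE \<omega> in M. \<forall>n\<ge>1.
          is_arg_min (logdet_contrast F (\<lambda>t. Y t \<omega>) (\<lambda>t. Z t \<omega>) n) (\<lambda>W. W \<in> \<Theta>) (What n \<omega>)"
    and What_consistent: "AE \<omega> in M. (\<lambda>n. What n \<omega>) \<longlonglongrightarrow> W0"
    and Wstar_measurable: "\<And>n. Wstar n \<in> borel_measurable M"
    and Wstar_argmin: "AE \<omega> in M. \<forall>n\<ge>1.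
          is_arg_min (gls_contrast \<Gamma>0 F (\<lambda>t. Y t \<omega>) (\<lambda>t. Z t \<omega>) n) (\<lambda>W. W \<in> \<Theta>) (Wstar n \<omega>)"
    and Wstar_consistent: "AE \<omega> in M. (\<lambda>n. Wstar n \<omega>) \<longlonglongrightarrow> W0"
  shows "converges_in_law M (\<lambda>n \<omega>. sqrt (real n) *\<^sub>R (Wstar n \<omega> - W0)) (multi_normal 0 (matrix_inv I0))
       \<and> converges_in_law M (\<lambda>n \<omega>. sqrt (real n) *\<^sub>R (What n \<omega> - W0)) (multi_normal 0 (matrix_inv I0))"
proof -
  interpret M: prob_space M by (rule prob)
  \<comment> \<open>The model equation holds on \<open>space M\<close>; with the residual taken as
    noise it holds for every argument. Both noises agree on \<open>space M\<close>, hence share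
    integrals and generated events.\<close>
  define e where "e t \<omega> = Y t \<omega> - F W0 (Z t \<omega>)" for t \<omega>
  have e_eq: "e t \<omega> = \<epsilon> t \<omega>" if "\<omega> \<in> space M" for t \<omega>
    using model[OF that] by (simp add: e_def)
  have Y_eq: "Y t \<omega> = F W0 (Z t \<omega>) + e t \<omega>" for t \<omega>
    by (simp add: e_def)
  have F_meas[measurable]: "F W \<in> borel_measurable borel" for W
    unfolding F_def by (intro borel_measurable_continuous_onI continuous_mlp activation)
  have F_diff: "twice_diff_vec (\<lambda>V. F V z)" for z
    unfolding F_def twice_diff_vec_def by (intro allI twice_diff_mlp activation)
  \<comment> \<open>One radius serves all inputs, because the neighbourhood in \<open>bounds\<close>
    is chosen before \<open>z\<close>.\<close>
  obtain C \<delta> where \<delta>: "\<delta> > 0" and bd: "\<And>W z k l. dist W W0 < \<delta> \<Longrightarrow>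
      norm (partial_deriv k (\<lambda>V. F V z) W) \<le> C * (1 + norm z) \<and>
      norm (partial_deriv k (partial_deriv l (\<lambda>V. F V z)) W) \<le> C * (1 + norm z ^ 2) \<and>
      norm (partial_deriv k (partial_deriv l (\<lambda>V. F V z)) W - partial_deriv k (partial_deriv l (\<lambda>V. F V z)) W0)
        \<le> C * norm (W - W0) * (1 + norm z ^ 3)"
    using bounds unfolding eventually_nhds_metric by blast
  \<comment> \<open>Noise and input are one fixed Borel function of output and input; it carries
    independence across times and equality of laws from the observed pairs to the pairs
    \<open>(e t \<omega>, Z t \<omega>)\<close>.\<close>
  have pair_meas: "(\<lambda>p. (fst p - F W0 (snd p), snd p)) \<in> borel_measurable (borel :: ((real^'d) \<times> (real^'q)) measure)"
    by measurable
  have rv: "M.random_variable borel (\<lambda>\<omega>. (Y t \<omega>, Z t \<omega>))" for t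
    using indep unfolding M.indep_vars_def2 by simp
  have dist_eq: "distr M borel (\<lambda>\<omega>. (e t \<omega>, Z t \<omega>)) =
      distr (distr M borel (\<lambda>\<omega>. (Y t \<omega>, Z t \<omega>))) borel (\<lambda>p. (fst p - F W0 (snd p), snd p))" for t
    using rv[of t] by (subst distr_distr[OF pair_meas]) (simp_all add: comp_def e_def)
  have vim: "vimage_algebra (space M) (e 0) borel = vimage_algebra (space M) (\<epsilon> 0) borel"
    by (rule vimage_algebra_cong) (auto simp: e_eq)
  have centered: "(\<integral>\<omega>. e 0 \<omega> \<partial>M) = 0"
    using noise_centered by (simp add: e_eq cong: Bochner_Integration.integral_cong)
  interpret noisy_regression M e Z F W0 C \<delta> \<Gamma>0 I0
  proof
    show "M.indep_vars (\<lambda>_. borel) (\<lambda>t \<omega>. (e t \<omega>, Z t \<omega>)) UNIV"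
      using M.indep_vars_compose2[OF indep, of "\<lambda>_ p. (fst p - F W0 (snd p), snd p)" "\<lambda>_. borel"] pair_meas
      by (simp add: e_def)
    show "distr M borel (\<lambda>\<omega>. (e t \<omega>, Z t \<omega>)) = distr M borel (\<lambda>\<omega>. (e 0 \<omega>, Z 0 \<omega>))" for t
      unfolding dist_eq by (simp only: ident[of t])
    show "M.indep_set (sets (vimage_algebra (space M) (e 0) borel)) (sets (vimage_algebra (space M) (Z 0) borel))"
      unfolding vim by (rule noise_indep)
    show "integrable M (\<lambda>\<omega>. norm (e 0 \<omega>) ^ 2)"
      using noise_moment by (simp add: e_eq cong: Bochner_Integration.integrable_cong)
    show "\<Gamma>0 = (\<integral>\<omega>. outer (e 0 \<omega>) (e 0 \<omega>) \<partial>M)"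
      unfolding Gamma0(1) covariance_matrix_def
      by (simp add: noise_centered e_eq cong: Bochner_Integration.integral_cong)
    show "pos_def I0"
      using I0(2) by (auto simp: pos_def_def scaleR_matrix_vector_assoc[symmetric] transpose_scalar)
  qed (use F_meas F_diff \<delta> bd centered Gamma0(2) Z_moment I0(1) in \<open>auto simp: dist_norm\<close>)
  show ?thesis
  proof
    show "converges_in_law M (\<lambda>n \<omega>. sqrt (real n) *\<^sub>R (Wstar n \<omega> - W0)) (multi_normal 0 (matrix_inv I0))"
      by (rule gls_limit[OF Wstar_measurable Wstar_consistent W0]) (use Wstar_argmin in \<open>simp add: Y_eq[symmetric]\<close>)
    show "converges_in_law M (\<lambda>n \<omega>. sqrt (real n) *\<^sub>R (What n \<omega> - W0)) (multi_normal 0 (matrix_inv I0))"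
      by (rule logdet_limit[OF What_measurable What_consistent W0]) (use What_argmin in \<open>simp add: Y_eq[symmetric]\<close>)
  qed
qed

end
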